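(* There are numbers $r_0(n)>0$ ($n\ge1$) such that for every choice of radii $r=r(n)$ with $0<r(n)<r_0(n)$, the topological entropies $h_{top}(n)$ of the billiard flows on $Q_n$ satisfy $$\frac{1}{\sqrt5}\le\liminf_{n\to\infty}\frac{h_{top}(n)}{\log n}\le\limsup_{n\to\infty}\frac{h_{top}(n)}{\log n}\le 2\sqrt2.$$
   Context: $Q_n=\mathbb{T}^2\setminus\bigcup_{i=0}^{n-1}D_i$, where $\mathbb{T}^2=\mathbb{R}^2/\mathbb{Z}^2$ and $D_i$ is the (open) disk of radius $r$ centered at $(i/n,0)$ mod $\mathbb{Z}^2$; $r$ is small, in particular the disks are pairwise disjoint. The billiard flow $S^t$ is the motion of a point particle with unit speed in $Q_n$ with elastic (specular) reflections at the boundaries of the disks; its phase space consists of pairs (position, unit velocity), with incoming and outgoing velocities identified at collisions. $h_{top}(n)$ denotes the topological entropy of this flow (the topological entropy of its time-one map); $\log$ is the natural logarithm. *)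

theory Defs
  imports "HOL-Analysis.Analysis"
begin

section \<open>Topological entropy\<close>

text \<open>
  Entropy in the sense of Adler, Konheim and McAndrew, by open covers. It needs no metric, so it
  applies directly to the phase space of the billiard, which is a quotient space.
\<close>

definition open_covers :: "'a topology \<Rightarrow> 'a set set set" where
  "open_covers X = {\<U>. (\<forall>U\<in>\<U>. openin X U) \<and> \<Union>\<U> = topspace X}"

text \<open>The logarithm of the least cardinality of a finite subcover.\<close>

definition cover_entropy :: "'a topology \<Rightarrow> 'a set set \<Rightarrow> ereal" where
  "cover_entropy X \<U> =
     (INF \<V>\<in>{\<V>. \<V> \<subseteq> \<U> \<and> finite \<V> \<and> \<Union>\<V> = topspace X}. ereal (ln (real (card \<V>))))"

text \<open>The cover \<open>\<U> \<or> f\<^sup>-\<^sup>1 \<U> \<or> \<dots> \<or> f\<^sup>-\<^sup>(\<^sup>m\<^sup>-\<^sup>1\<^sup>) \<U>\<close>.\<close>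

definition dynamical_join :: "'a topology \<Rightarrow> ('a \<Rightarrow> 'a) \<Rightarrow> 'a set set \<Rightarrow> nat \<Rightarrow> 'a set set" where
  "dynamical_join X f \<U> m =
     {{x \<in> topspace X. \<forall>k<m. (f ^^ k) x \<in> A k} | A. \<forall>k<m. A k \<in> \<U>}"

text \<open>
  For a continuous self-map of a compact space the sequence below converges, by subadditivity, so
  the upper limit is the limit of the usual definition.
\<close>

definition topological_entropy :: "'a topology \<Rightarrow> ('a \<Rightarrow> 'a) \<Rightarrow> ereal" where
  "topological_entropy X f =
     (SUP \<U>\<in>open_covers X.
        limsup (\<lambda>m. cover_entropy X (dynamical_join X f \<U> m) / ereal (real m)))"


section \<open>Quotient topology\<close>

definition quotient_topology :: "'a topology \<Rightarrow> ('a \<times> 'a) set \<Rightarrow> 'a set topology" where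
  "quotient_topology X R =
     topology (\<lambda>U. U \<subseteq> topspace X // R \<and> openin X {x \<in> topspace X. R `` {x} \<in> U})"

lemma openin_quotient_topology:
  "openin (quotient_topology X R) U \<longleftrightarrow>
     U \<subseteq> topspace X // R \<and> openin X {x \<in> topspace X. R `` {x} \<in> U}"
proof -
  let ?L = "\<lambda>U. U \<subseteq> topspace X // R \<and> openin X {x \<in> topspace X. R `` {x} \<in> U}"
  have "istopology ?L"
    unfolding istopology_def
  proof (intro conjI allI impI)
    fix S T assume *: "?L S" "?L T"
    have "{x \<in> topspace X. R `` {x} \<in> S \<inter> T} =
            {x \<in> topspace X. R `` {x} \<in> S} \<inter> {x \<in> topspace X. R `` {x} \<in> T}"
      by auto
    then show "S \<inter> T \<subseteq> topspace X // R" "openin X {x \<in> topspace X. R `` {x} \<in> S \<inter> T}"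
      using * by (auto intro: openin_Int)
  next
    fix K assume *: "\<forall>S\<in>K. ?L S"
    have "{x \<in> topspace X. R `` {x} \<in> \<Union>K} = (\<Union>S\<in>K. {x \<in> topspace X. R `` {x} \<in> S})"
      by auto
    then show "\<Union>K \<subseteq> topspace X // R" "openin X {x \<in> topspace X. R `` {x} \<in> \<Union>K}"
      using * by (auto intro!: openin_Union)
  qed
  then show ?thesis
    by (simp add: quotient_topology_def topology_inverse')
qed

lemma topspace_quotient_topology: "topspace (quotient_topology X R) = topspace X // R"
proof
  show "topspace (quotient_topology X R) \<subseteq> topspace X // R"
    unfolding topspace_def openin_quotient_topology by blast
  have "{x \<in> topspace X. R `` {x} \<in> topspace X // R} = topspace X"
    by (auto intro: quotientI)
  then have "openin (quotient_topology X R) (topspace X // R)"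
    by (simp add: openin_quotient_topology)
  then show "topspace X // R \<subseteq> topspace (quotient_topology X R)"
    by (rule openin_subset)
qed

lemma quotient_map_quotient_topology:
  "quotient_map X (quotient_topology X R) (\<lambda>x. R `` {x})"
  unfolding quotient_map_def
  by (auto simp: topspace_quotient_topology openin_quotient_topology quotient_def)


section \<open>The billiard in the torus with a row of disks\<close>

text \<open>
  The torus is the quotient of the plane by \<open>\<int>\<^sup>2\<close>; we work with the lift to the plane, where the
  scatterers are repeated periodically, and pass to the quotient in the phase space.
\<close>

type_synonym point = "real \<times> real"

definition disk_centers :: "nat \<Rightarrow> point set" where
  "disk_centers n =
     {(real i / real n + real_of_int a, real_of_int b) | (i :: nat) (a :: int) (b :: int). i < n}"

definition billiard_table :: "nat \<Rightarrow> real \<Rightarrow> point set" where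
  "billiard_table n r = - (\<Union>c\<in>disk_centers n. ball c r)"

definition lifted_phase_space :: "nat \<Rightarrow> real \<Rightarrow> (point \<times> point) set" where
  "lifted_phase_space n r = billiard_table n r \<times> sphere 0 1"

text \<open>
  Elastic reflection of the velocity \<open>v\<close> at the point \<open>q\<close> of a circle with centre \<open>c\<close>;
  \<open>sgn (q - c)\<close> is the unit normal.
\<close>

definition reflect :: "point \<Rightarrow> point \<Rightarrow> point \<Rightarrow> point" where
  "reflect c q v = v - (2 * (v \<bullet> sgn (q - c))) *\<^sub>R sgn (q - c)"

text \<open>
  Positions are identified modulo \<open>\<int>\<^sup>2\<close>, and at the boundary the incoming velocity is identified
  with the outgoing one.
\<close>

definition phase_rel :: "nat \<Rightarrow> real \<Rightarrow> ((point \<times> point) \<times> (point \<times> point)) set" where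
  "phase_rel n r =
     {((q, v), (q', v')). (q, v) \<in> lifted_phase_space n r \<and> (q', v') \<in> lifted_phase_space n r \<and>
        (\<exists>a b :: int. q' = q + (real_of_int a, real_of_int b)) \<and>
        (v' = v \<or> (\<exists>c\<in>disk_centers n. dist c q = r \<and> v' = reflect c q v))}"

definition phase_space :: "nat \<Rightarrow> real \<Rightarrow> (point \<times> point) set topology" where
  "phase_space n r = quotient_topology (top_of_set (lifted_phase_space n r)) (phase_rel n r)"

text \<open>
  Here \<open>q t\<close> is the position and \<open>v t\<close> the velocity just after time \<open>t\<close>; the existentially
  quantified \<open>u\<close> is the velocity just before time \<open>t\<close>. Requiring uniform straight motion on a
  punctured neighbourhood of every time makes the collision times discrete and excludes motion
  along the boundary of a disk. At a tangential collision \<open>reflect\<close> leaves the velocity unchanged.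
\<close>

definition billiard_trajectory ::
    "nat \<Rightarrow> real \<Rightarrow> (real \<Rightarrow> point) \<Rightarrow> (real \<Rightarrow> point) \<Rightarrow> bool" where
  "billiard_trajectory n r q v \<longleftrightarrow>
     (\<forall>t. (q t, v t) \<in> lifted_phase_space n r \<and>
       (\<exists>u. (\<exists>\<epsilon>>0. \<forall>s\<in>{0<..<\<epsilon>}.
               q (t + s) = q t + s *\<^sub>R v t \<and> v (t + s) = v t \<and>
               q (t - s) = q t - s *\<^sub>R u \<and> v (t - s) = u) \<and>
            (\<forall>c\<in>disk_centers n. dist c (q t) = r \<longrightarrow> v t = reflect c (q t) u) \<and>
            ((\<forall>c\<in>disk_centers n. dist c (q t) \<noteq> r) \<longrightarrow> v t = u)))"

text \<open>
  If \<open>n > 0\<close> and \<open>0 < r < 1 / (2 * n)\<close>, so that the closed disks are pairwise disjoint, every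
  point of the phase space is the class of \<open>(q 0, v 0)\<close> for some trajectory, which is unique up to
  translation by \<open>\<int>\<^sup>2\<close>.
\<close>

definition billiard_flow ::
    "nat \<Rightarrow> real \<Rightarrow> real \<Rightarrow> (point \<times> point) set \<Rightarrow> (point \<times> point) set" where
  "billiard_flow n r t x =
     (THE y. \<exists>q v. billiard_trajectory n r q v \<and>
        x = phase_rel n r `` {(q 0, v 0)} \<and> y = phase_rel n r `` {(q t, v t)})"

definition h_top :: "nat \<Rightarrow> real \<Rightarrow> ereal" where
  "h_top n r = topological_entropy (phase_space n r) (billiard_flow n r 1)"

end

theory Submission
  imports Defs "HOL-Real_Asymp.Real_Asymp"
begin

text \<open>
  Two trajectories that hit the same disks in the same order are compared through a convexity
  identity for the lengths of broken lines: if their endpoints are close, then so are their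
  velocities and all non-grazing collision points, uniformly in the number of collisions. Hence
  the entropy is at most the exponential growth rate of the number of collision sequences. In a
  time window of length $3/4 < 1 - 2r$ all collisions take place in a single row and alternate
  between two neighbouring disks, so that a window is described by the first disk, a direction
  and the number of collisions, that is, by $O(n^2)$ data; this gives
  \<open>h \<le> 4/3 \<cdot> ln (576 n\<^sup>2)\<close>, and \<open>8/3 \<le> 2\<surd>2\<close>.

  For the lower bound, every sequence of disks that alternates between the first quarter of one
  row and the last quarter of the next row is realized by a trajectory, found as a fixed point of
  a contraction that moves each collision point to where the normal bisects the directions to its
  two neighbours. All flights take between 1 and 2 units of time, so that a cover which detects
  the disk approached at integer times distinguishes the \<open>(n div 4)\<^sup>J\<close> sequences of length \<open>J\<close>
  within time \<open>2J\<close>, and \<open>1/\<surd>5 \<le> 1/2\<close>.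
\<close>

section \<open>Reflections\<close>

text \<open>The obstacle is grazing. A tangential contact may occur on one orbit and not on its
  neighbour, and velocities jump at times that differ from orbit to orbit, so velocities cannot be
  compared time by time. Three devices deal with this. Collision words record only contacts that
  change the velocity. In the comparison each collision is weighted by the size of its velocity
  jump, so a nearly grazing one, whose position is badly controlled, contributes little. Near a
  large jump, orbits are compared with both the incoming and the outgoing velocity at one point,
  which are the same phase point. The precision needed is polynomial in the time, so the number of
  initial and final data does not affect the entropy. A window of length \<open>w\<close> with
  \<open>2 * ln n\<close> in the exponent yields \<open>2 / w\<close>, so \<open>w\<close> must be
  at least \<open>1 / sqrt 2\<close> and less than \<open>1 - 2 * r\<close>. In the lower bound the
  two quarters of the rows keep successive disks horizontally apart; this makes flights definitely
  longer than 1, and two flights that start almost together then share an integer time.\<close>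

lemma norm_sgn_diff: "(q::point) \<noteq> c \<Longrightarrow> sgn (q - c) \<bullet> sgn (q - c) = 1"
  by (simp add: dot_square_norm norm_sgn)

lemma inner_reflect_sgn:
  assumes "q \<noteq> c" shows "reflect c q v \<bullet> sgn (q - c) = - (v \<bullet> sgn (q - c))"
  using norm_sgn_diff[OF assms] by (simp add: reflect_def inner_diff_left)

lemma inner_reflect:
  assumes "q \<noteq> c" shows "(q - c) \<bullet> reflect c q v = - ((q - c) \<bullet> v)"
proof -
  have *: "q - c = norm (q - c) *\<^sub>R sgn (q - c)"
    by (cases "q = c") (simp_all add: sgn_div_norm)
  have "x \<bullet> (q - c) = norm (q - c) * (x \<bullet> sgn (q - c))" for x
    by (subst *) simp
  then show ?thesis
    using inner_reflect_sgn[OF assms, of v] by (simp add: inner_commute[of "q - c"])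
qed

lemma reflect_reflect:
  assumes "q \<noteq> c" shows "reflect c q (reflect c q v) = v"
  using inner_reflect_sgn[OF assms, of v] by (simp add: reflect_def [of c q "reflect c q v"]) (simp add: reflect_def)

lemma norm_reflect:
  assumes "q \<noteq> c" shows "norm (reflect c q v) = norm v"
proof -
  have "reflect c q v \<bullet> reflect c q v = v \<bullet> v"
    using norm_sgn_diff[OF assms]
    by (simp add: reflect_def inner_diff_left inner_diff_right inner_commute algebra_simps)
  then show ?thesis by (simp add: norm_eq_sqrt_inner)
qed

lemma reflect_minus: "reflect c q (- v) = - reflect c q v"
  by (simp add: reflect_def)

lemma reflect_translate: "reflect (c + z) (q + z) v = reflect c q v"
  by (simp add: reflect_def)

lemma reflect_tangent:
  assumes "(q - c) \<bullet> v = 0" shows "reflect c q v = v"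
  using assms by (simp add: reflect_def sgn_div_norm inner_commute)

text \<open>The velocity jump is a multiple of the normal. For an incoming velocity the factor is
  nonnegative, which later gives the comparison of two orbits its sign.\<close>

lemma reflect_diff:
  assumes "dist c q = r" "r > 0"
  shows "reflect c q v - v = (- 2 * ((q - c) \<bullet> v) / r\<^sup>2) *\<^sub>R (q - c)"
proof -
  have "sgn (q - c) = (1 / r) *\<^sub>R (q - c)"
    using assms by (simp add: sgn_div_norm dist_norm norm_minus_commute inverse_eq_divide)
  then show ?thesis by (simp add: reflect_def inner_commute power2_eq_square)
qed


section \<open>Billiards outside separated disks\<close>

lemma dist_ray_sq:
  fixes q c v :: point assumes "norm v = 1"
  shows "(dist c (q + s *\<^sub>R v))\<^sup>2 = (dist c q)\<^sup>2 + 2 * s * ((q - c) \<bullet> v) + s\<^sup>2"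
proof -
  have "v \<bullet> v = 1" using assms by (simp add: norm_eq_1)
  then show ?thesis unfolding dist_norm power2_norm_eq_inner
    by (simp add: power2_eq_square inner_diff_left inner_diff_right
        inner_add_left inner_add_right inner_commute algebra_simps)
qed

lemma ray_avoids:
  fixes q c v :: point
  assumes "norm v = 1" "(q - c) \<bullet> v \<ge> 0" "s \<ge> 0" "r \<le> dist c q"
  shows "r \<le> dist c (q + s *\<^sub>R v)"
proof -
  have "(dist c q)\<^sup>2 \<le> (dist c (q + s *\<^sub>R v))\<^sup>2"
    using assms by (simp add: dist_ray_sq)
  then have "dist c q \<le> dist c (q + s *\<^sub>R v)" using power2_le_imp_le zero_le_dist by blast
  then show ?thesis using assms by linarith
qed

text \<open>By \<open>dist_ray_sq\<close> the squared distance is a quadratic in \<open>s\<close>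
  that starts at the squared radius, so a negative linear coefficient would push the ray into the
  disk at once.\<close>

lemma ray_outgoing:
  fixes q c v :: point
  assumes "norm v = 1" "dist c q = r" "\<epsilon> > 0" and *: "\<And>s. \<lbrakk>0 < s; s < \<epsilon>\<rbrakk> \<Longrightarrow> r \<le> dist c (q + s *\<^sub>R v)"
  shows "(q - c) \<bullet> v \<ge> 0"
proof (rule ccontr)
  assume neg: "\<not> ?thesis"
  define s where "s = min (\<epsilon>/2) (- ((q - c) \<bullet> v))"
  have s: "0 < s" "s < \<epsilon>" "s \<le> - ((q - c) \<bullet> v)" using neg assms by (auto simp: s_def)
  have "r\<^sup>2 \<le> (dist c (q + s *\<^sub>R v))\<^sup>2"
    using *[OF s(1,2)] assms by (intro power_mono) auto
  also have "\<dots> = r\<^sup>2 + s * (2 * ((q - c) \<bullet> v) + s)"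
    unfolding dist_ray_sq[OF assms(1)] using assms(2) by (simp add: power2_eq_square algebra_simps)
  finally have "0 \<le> s * (2 * ((q - c) \<bullet> v) + s)" by simp
  then have "0 \<le> 2 * ((q - c) \<bullet> v) + s" using s by (simp add: zero_le_mult_iff)
  then show False using s neg by linarith
qed

lemma ray_incoming:
  fixes q c v :: point
  assumes "norm v = 1" "dist c q = r" "\<epsilon> > 0" and *: "\<And>s. \<lbrakk>0 < s; s < \<epsilon>\<rbrakk> \<Longrightarrow> r \<le> dist c (q - s *\<^sub>R v)"
  shows "(q - c) \<bullet> v \<le> 0"
  using ray_outgoing[of "- v" c q r \<epsilon>] assms by simp

section \<open>Admissible collisions at separated disks\<close>

locale scatterers =
  fixes C :: "point set" and r g :: real
  assumes r_pos: "0 < r" and gap: "2 * r < g"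
    and separated: "\<lbrakk>c \<in> C; c' \<in> C; c \<noteq> c'\<rbrakk> \<Longrightarrow> g \<le> dist c c'"
begin

definition table :: "point set" where "table = - (\<Union>c\<in>C. ball c r)"

text \<open>The width of the gap between two disks: a particle that leaves a disk outwards needs at
  least this time to reach another one, so collisions cannot accumulate.\<close>

definition h :: real where "h = g - 2 * r"

lemma h_pos: "0 < h" using gap by (simp add: h_def)

lemma in_table_iff: "q \<in> table \<longleftrightarrow> (\<forall>c\<in>C. r \<le> dist c q)"
  by (auto simp: table_def not_less)

lemma near_unique:
  "\<lbrakk>c \<in> C; c' \<in> C; dist c q + dist c' q < g\<rbrakk> \<Longrightarrow> c = c'"
  using separated[of c c'] dist_triangle2[of c c' q] by force

lemma contact_unique:
  "\<lbrakk>c \<in> C; c' \<in> C; dist c q = r; dist c' q = r\<rbrakk> \<Longrightarrow> c = c'"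
  using near_unique[of c c' q] gap by simp

lemma contact_ne: "dist c q = r \<Longrightarrow> q \<noteq> c"
  using r_pos by auto

lemma closed_table: "closed table"
  unfolding table_def by (intro closed_Compl open_UN ballI open_ball)

text \<open>\<open>u\<close> is the velocity before, \<open>v\<close> the velocity after a possible collision at \<open>q\<close>.\<close>

definition admissible :: "point \<Rightarrow> point \<Rightarrow> point \<Rightarrow> bool" where
  "admissible q u v \<longleftrightarrow> q \<in> table \<and> norm u = 1 \<and> norm v = 1 \<and>
     (\<forall>c\<in>C. dist c q = r \<longrightarrow> (q - c) \<bullet> u \<le> 0 \<and> v = reflect c q u) \<and>
     ((\<forall>c\<in>C. dist c q \<noteq> r) \<longrightarrow> v = u)"

definition motion_right :: "(real \<Rightarrow> point) \<Rightarrow> (real \<Rightarrow> point) \<Rightarrow> (real \<Rightarrow> point) \<Rightarrow> real \<Rightarrow> bool" where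
  "motion_right q u v t \<longleftrightarrow> (\<exists>\<epsilon>>0. \<forall>s\<in>{0<..<\<epsilon>}.
     q (t + s) = q t + s *\<^sub>R v t \<and> u (t + s) = v t \<and> v (t + s) = v t)"

definition motion_left :: "(real \<Rightarrow> point) \<Rightarrow> (real \<Rightarrow> point) \<Rightarrow> (real \<Rightarrow> point) \<Rightarrow> real \<Rightarrow> bool" where
  "motion_left q u v t \<longleftrightarrow> (\<exists>\<epsilon>>0. \<forall>s\<in>{0<..<\<epsilon>}.
     q (t - s) = q t - s *\<^sub>R u t \<and> u (t - s) = u t \<and> v (t - s) = u t)"

text \<open>The incoming velocity is carried as a function of its own because time reversal then
  merely exchanges \<open>u\<close> and \<open>v\<close> up to sign; existence and uniqueness in the
  past become mirror images of those in the future.\<close>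

definition trajectory :: "(real \<Rightarrow> point) \<Rightarrow> (real \<Rightarrow> point) \<Rightarrow> (real \<Rightarrow> point) \<Rightarrow> bool" where
  "trajectory q u v \<longleftrightarrow>
     (\<forall>t. admissible (q t) (u t) (v t) \<and> motion_right q u v t \<and> motion_left q u v t)"

lemma admissible_outgoing:
  assumes "admissible q u v" "c \<in> C" "dist c q = r"
  shows "(q - c) \<bullet> v \<ge> 0"
  using assms inner_reflect[of q c u] contact_ne[of c q] by (auto simp: admissible_def)

lemma admissible_reverse:
  assumes "admissible q u v" shows "admissible q (- v) (- u)"
proof -
  have "(q - c) \<bullet> (- v) \<le> 0 \<and> - u = reflect c q (- v)" if "c \<in> C" "dist c q = r" for c
    using assms that admissible_outgoing[OF assms that] contact_ne[OF that(2)]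
    by (auto simp: admissible_def reflect_minus reflect_reflect)
  then show ?thesis using assms by (auto simp: admissible_def)
qed

lemma admissible_extend:
  assumes "q \<in> table" "norm u = 1" "\<And>c. \<lbrakk>c \<in> C; dist c q = r\<rbrakk> \<Longrightarrow> (q - c) \<bullet> u \<le> 0"
  shows "\<exists>v. admissible q u v"
proof (cases "\<exists>c\<in>C. dist c q = r")
  case True
  then obtain c where c: "c \<in> C" "dist c q = r" by blast
  have "c' = c" if "c' \<in> C" "dist c' q = r" for c'
    using contact_unique c that by blast
  then have "admissible q u (reflect c q u)"
    unfolding admissible_def using assms c norm_reflect[OF contact_ne[OF c(2)]]
    by (intro conjI ballI impI) (blast | metis)+
  then show ?thesis ..
next
  case False
  then have "admissible q u u" using assms unfolding admissible_def by blast
  then show ?thesis ..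
qed

lemma admissible_tangent:
  assumes "q \<in> table" "norm u = 1" "\<And>c. \<lbrakk>c \<in> C; dist c q = r\<rbrakk> \<Longrightarrow> (q - c) \<bullet> u = 0"
  shows "admissible q u u"
  using assms by (auto simp: admissible_def reflect_tangent)

text \<open>Inside a segment of the table both \<open>ray_outgoing\<close> and
  \<open>ray_incoming\<close> apply, so a contact is tangential and does not bend the path. A leg
  may therefore run through grazing points.\<close>

lemma segment_tangent:
  assumes "norm v = 1" "\<And>s. \<lbrakk>0 \<le> s; s \<le> l\<rbrakk> \<Longrightarrow> q + s *\<^sub>R v \<in> table" "0 < s" "s < l"
  shows "admissible (q + s *\<^sub>R v) v v"
proof (rule admissible_tangent)
  fix c assume c: "c \<in> C" "dist c (q + s *\<^sub>R v) = r"
  have *: "r \<le> dist c (q + s' *\<^sub>R v)" if "0 \<le> s'" "s' \<le> l" for s'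
    using assms(2)[OF that] c by (auto simp: in_table_iff)
  have "(q + s *\<^sub>R v - c) \<bullet> v \<ge> 0"
  proof (rule ray_outgoing[OF assms(1) c(2), of "l - s"])
    fix s' assume "0 < s'" "s' < l - s"
    then show "r \<le> dist c (q + s *\<^sub>R v + s' *\<^sub>R v)"
      using *[of "s + s'"] assms by (simp add: scaleR_add_left add.assoc)
  qed (use assms in simp)
  moreover have "(q + s *\<^sub>R v - c) \<bullet> v \<le> 0"
  proof (rule ray_incoming[OF assms(1) c(2), of s])
    fix s' assume "0 < s'" "s' < s"
    then show "r \<le> dist c (q + s *\<^sub>R v - s' *\<^sub>R v)"
      using *[of "s - s'"] assms by (simp add: scaleR_diff_left add_diff_eq)
  qed (use assms in simp)
  ultimately show "(q + s *\<^sub>R v - c) \<bullet> v = 0" by simp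
qed (use assms in auto)

text \<open>The distance to the disk just left does not decrease along the ray, and every other disk
  is at least \<open>h\<close> away from the start.\<close>

lemma contact_leg:
  assumes "admissible q u v" "c \<in> C" "dist c q = r" "0 \<le> s" "s \<le> h"
  shows "q + s *\<^sub>R v \<in> table"
  unfolding in_table_iff
proof
  fix c' assume c': "c' \<in> C"
  have v: "norm v = 1" using assms(1) unfolding admissible_def by blast
  show "r \<le> dist c' (q + s *\<^sub>R v)"
  proof (cases "c' = c")
    case True
    show ?thesis unfolding True
      using ray_avoids[OF v admissible_outgoing[OF assms(1-3)] assms(4)] assms by simp
  next
    case False
    have "g \<le> dist c' c" using separated False c' assms by blast
    moreover have "dist c' c \<le> dist c' (q + s *\<^sub>R v) + dist (q + s *\<^sub>R v) q + dist q c"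
      by (meson add_mono dist_triangle order_refl order_trans)
    moreover have "dist (q + s *\<^sub>R v) q = s" using v assms by (simp add: dist_norm)
    ultimately show ?thesis using assms by (simp add: h_def dist_commute)
  qed
qed

text \<open>A leg either has length \<open>h\<close> or ends at a disk, and a leg that starts at a
  disk has length \<open>h\<close>. The last clause keeps infinitely many legs from fitting into a
  finite time.\<close>

lemma next_leg:
  assumes adm: "admissible q u v"
  shows "\<exists>l>0. (\<forall>s. 0 \<le> s \<and> s \<le> l \<longrightarrow> q + s *\<^sub>R v \<in> table) \<and>
           (l = h \<or> (\<exists>c\<in>C. dist c (q + l *\<^sub>R v) = r)) \<and> ((\<exists>c\<in>C. dist c q = r) \<longrightarrow> l = h)"
proof (cases "\<forall>s. 0 \<le> s \<and> s \<le> h \<longrightarrow> q + s *\<^sub>R v \<in> table")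
  case True
  then show ?thesis using h_pos by blast
next
  case False
  define S where "S = {s. 0 \<le> s \<and> q + s *\<^sub>R v \<notin> table}"
  have v: "norm v = 1" and q: "q \<in> table" using adm by (auto simp: admissible_def)
  have ne: "S \<noteq> {}" "bdd_below S" using False by (auto simp: S_def intro!: bdd_belowI)
  define l where "l = Inf S"
  have l0: "0 \<le> l" unfolding l_def using ne by (intro cInf_greatest) (auto simp: S_def)
  have below: "q + s *\<^sub>R v \<in> table" if "0 \<le> s" "s < l" for s
    using that cInf_lower[OF _ ne(2), of s] by (force simp: l_def S_def)
  have at: "q + l *\<^sub>R v \<in> table"
  proof (cases "l = 0")
    case False
    have "((\<lambda>s. q + s *\<^sub>R v) \<longlongrightarrow> q + l *\<^sub>R v) (at_left l)" by (intro tendsto_intros)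
    moreover have "eventually (\<lambda>s. q + s *\<^sub>R v \<in> table) (at_left l)"
      using eventually_at_left_real[of 0 l] False l0 by (auto elim!: eventually_mono intro: below)
    ultimately show ?thesis by (rule Lim_in_closed_set[OF closed_table, rotated 2]) auto
  qed (use q in simp)
  have ex: "\<exists>s c. l \<le> s \<and> s < l + \<epsilon> \<and> c \<in> C \<and> dist c (q + s *\<^sub>R v) < r" if \<epsilon>: "\<epsilon> > 0" for \<epsilon>
  proof -
    obtain s where "s \<in> S" "s < l + \<epsilon>" using cInf_lessD[OF ne(1), of "l + \<epsilon>"] \<epsilon> unfolding l_def by auto
    moreover from this have "l \<le> s" unfolding l_def using cInf_lower ne(2) by blast
    ultimately show ?thesis by (auto simp: S_def in_table_iff not_le)
  qed
  have near: "\<exists>c\<in>C. dist c (q + l *\<^sub>R v) < r + \<epsilon>" if \<epsilon>: "\<epsilon> > 0" for \<epsilon>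
  proof -
    obtain s c where s: "l \<le> s" "s < l + \<epsilon>" "c \<in> C" "dist c (q + s *\<^sub>R v) < r" using ex[OF \<epsilon>] by blast
    have "dist (q + s *\<^sub>R v) (q + l *\<^sub>R v) = s - l"
      using v s by (simp add: dist_norm flip: scaleR_diff_left)
    then show ?thesis using s dist_triangle[of c "q + l *\<^sub>R v" "q + s *\<^sub>R v"] by force
  qed
  \<comment> \<open>A centre at distance below \<open>r + h / 2\<close> is unique by
    \<open>near_unique\<close>, so the centres found for smaller and smaller
    \<open>\<epsilon>\<close> are all this \<open>c\<close>.\<close>
  obtain c where c: "c \<in> C" "dist c (q + l *\<^sub>R v) < r + h / 2" using near[of "h/2"] h_pos by auto
  have "dist c (q + l *\<^sub>R v) < r + \<epsilon>" if \<epsilon>: "\<epsilon> > 0" for \<epsilon>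
  proof -
    obtain c' where "c' \<in> C" "dist c' (q + l *\<^sub>R v) < r + min \<epsilon> (h / 2)"
      using near[of "min \<epsilon> (h/2)"] \<epsilon> h_pos by auto
    moreover from this have "dist c' (q + l *\<^sub>R v) < r + h / 2" by linarith
    then have "dist c' (q + l *\<^sub>R v) + dist c (q + l *\<^sub>R v) < g"
      using c(2) unfolding h_def by argo
    then have "c' = c" using near_unique \<open>c' \<in> C\<close> c(1) by blast
    ultimately show ?thesis by simp
  qed
  then have "dist c (q + l *\<^sub>R v) \<le> r" by (meson field_le_epsilon less_imp_le)
  then have contact: "dist c (q + l *\<^sub>R v) = r" using at c by (force simp: in_table_iff)
  have nc: "\<not> (\<exists>c\<in>C. dist c q = r)" using contact_leg[OF adm] False by blast
  then have "l \<noteq> 0" using contact c by auto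
  moreover have "q + s *\<^sub>R v \<in> table" if "0 \<le> s" "s \<le> l" for s
    using that at below[of s] by (cases "s = l") auto
  ultimately show ?thesis using l0 nc c(1) contact by (intro exI[of _ l]) auto
qed

section \<open>Gluing legs into trajectories\<close>

lemma forward_of_legs:
  fixes Q U V :: "nat \<Rightarrow> point" and L :: "nat \<Rightarrow> real"
  assumes adm: "\<And>k. admissible (Q k) (U k) (V k)"
    and L: "\<And>k. L k > 0"
    and leg: "\<And>k s. \<lbrakk>0 \<le> s; s \<le> L k\<rbrakk> \<Longrightarrow> Q k + s *\<^sub>R V k \<in> table"
    and step: "\<And>k. Q (Suc k) = Q k + L k *\<^sub>R V k" "\<And>k. U (Suc k) = V k"
    and unbounded: "\<And>B. \<exists>k. B < (\<Sum>j<k. L j)"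
  shows "\<exists>q u v. q 0 = Q 0 \<and> u 0 = U 0 \<and> v 0 = V 0 \<and>
    (\<forall>t\<ge>0. admissible (q t) (u t) (v t) \<and> motion_right q u v t) \<and>
    (\<forall>t>0. motion_left q u v t) \<and>
    (\<forall>k s. 0 \<le> s \<and> s < L k \<longrightarrow>
       q ((\<Sum>j<k. L j) + s) = Q k + s *\<^sub>R V k \<and> v ((\<Sum>j<k. L j) + s) = V k)"
proof -
  define T where "T k = (\<Sum>j<k. L j)" for k
  have T0: "T 0 = 0" and TS: "T (Suc k) = T k + L k" for k by (auto simp: T_def)
  have mono: "mono T" using L by (intro incseq_SucI) (simp add: TS less_imp_le)
  define idx where "idx t = (LEAST k. t < T (Suc k))" for t
  have idx: "idx t = k" if "T k \<le> t" "t < T (Suc k)" for t k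
    unfolding idx_def
  proof (rule Least_equality)
    fix j assume "t < T (Suc j)"
    then have "T k < T (Suc j)" using that by linarith
    then show "k \<le> j" using monoD[OF mono, of "Suc j" k] by (cases "k \<le> j") auto
  qed (use that in simp)
  have ex: "\<exists>k. T k \<le> t \<and> t < T (Suc k)" if t: "t \<ge> 0" for t
  proof -
    obtain k where "t < T k" using unbounded[of t] by (auto simp: T_def)
    then have ex: "\<exists>k. t < T (Suc k)" using monoD[OF mono, of k "Suc k"] by (intro exI[of _ k]) auto
    define k where "k = (LEAST k. t < T (Suc k))"
    have "t < T (Suc k)" unfolding k_def using ex by (rule LeastI_ex)
    moreover have "T k \<le> t"
    proof (cases k)
      case (Suc j)
      then show ?thesis using not_less_Least[of j "\<lambda>k. t < T (Suc k)"] by (simp add: k_def)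
    qed (use t T0 in simp)
    ultimately show ?thesis by blast
  qed
  define q where "q t = Q (idx t) + (t - T (idx t)) *\<^sub>R V (idx t)" for t
  define v where "v t = V (idx t)" for t
  \<comment> \<open>Only at a gluing time can the two one-sided velocities differ; \<open>v\<close>
    takes the value of the leg that begins there, \<open>u\<close> the prescribed incoming
    one.\<close>
  define u where "u t = (if t = T (idx t) then U (idx t) else V (idx t))" for t
  have at: "q t = Q k + (t - T k) *\<^sub>R V k" "v t = V k" "u t = (if t = T k then U k else V k)"
    if "T k \<le> t" "t < T (Suc k)" for t k
    using idx[OF that] by (auto simp: q_def v_def u_def)
  have "admissible (q t) (u t) (v t) \<and> motion_right q u v t" if t: "t \<ge> 0" for t
  proof -
    obtain k where k: "T k \<le> t" "t < T (Suc k)" using ex[OF t] by blast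
    have "admissible (q t) (u t) (v t)"
    proof (cases "t = T k")
      case True
      then show ?thesis using adm at[OF k] by simp
    next
      case False
      have "norm (V k) = 1" using adm by (simp add: admissible_def)
      then show ?thesis
        using False k at[OF k] segment_tangent[of "V k" "L k" "Q k" "t - T k"] leg by (simp add: TS)
    qed
    moreover have "motion_right q u v t"
      unfolding motion_right_def
    proof (intro exI[of _ "T (Suc k) - t"] conjI ballI)
      fix s assume s: "s \<in> {0<..<T (Suc k) - t}"
      then have k': "T k \<le> t + s" "t + s < T (Suc k)" "t + s \<noteq> T k" using k by auto
      show "q (t + s) = q t + s *\<^sub>R v t" "u (t + s) = v t" "v (t + s) = v t"
        using at[OF k] at[OF k'(1,2)] k'(3) by (auto simp: scaleR_diff_left scaleR_add_left)
    qed (use k in simp)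
    ultimately show ?thesis ..
  qed
  moreover have "motion_left q u v t" if t: "t > 0" for t
  proof -
    obtain k where k: "T k \<le> t" "t < T (Suc k)" using ex[of t] t by auto
    show ?thesis
    proof (cases "t = T k")
      case False
      show ?thesis unfolding motion_left_def
      proof (intro exI[of _ "t - T k"] conjI ballI)
        fix s assume s: "s \<in> {0<..<t - T k}"
        then have k': "T k \<le> t - s" "t - s < T (Suc k)" "t - s \<noteq> T k" using k by auto
        show "q (t - s) = q t - s *\<^sub>R u t" "u (t - s) = u t" "v (t - s) = u t"
          using at[OF k] at[OF k'(1,2)] k'(3) False
          by (auto simp: scaleR_diff_left scaleR_add_left)
      qed (use k False in simp)
    next
      case True
      then obtain j where j: "k = Suc j" using t T0 by (cases k) auto
      show ?thesis unfolding motion_left_def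
      proof (intro exI[of _ "L j"] conjI ballI)
        fix s assume s: "s \<in> {0<..<L j}"
        then have k': "T j \<le> t - s" "t - s < T (Suc j)" "t - s \<noteq> T j" using True j TS by auto
        show "q (t - s) = q t - s *\<^sub>R u t" "u (t - s) = u t" "v (t - s) = u t"
          using at[OF k] at[OF k'(1,2)] k'(3) True j step TS
          by (auto simp: diff_diff_eq2 scaleR_diff_left scaleR_add_left)
      qed (rule L)
    qed
  qed
  moreover have "q (T k + s) = Q k + s *\<^sub>R V k \<and> v (T k + s) = V k" if "0 \<le> s" "s < L k" for k s
    using at[of k "T k + s"] that by (simp add: TS)
  moreover have "q 0 = Q 0" "u 0 = U 0" "v 0 = V 0" using at[of 0 0] L[of 0] by (auto simp: T0 TS)
  ultimately show ?thesis unfolding T_def by blast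
qed

lemma forward_exists:
  assumes adm: "admissible q0 u0 v0"
  shows "\<exists>q u v. q 0 = q0 \<and> u 0 = u0 \<and> v 0 = v0 \<and>
    (\<forall>t\<ge>0. admissible (q t) (u t) (v t) \<and> motion_right q u v t) \<and> (\<forall>t>0. motion_left q u v t)"
proof -
  define P where "P = (\<lambda>(q, u, v, l). admissible q u v \<and> l > 0 \<and>
    (\<forall>s. 0 \<le> s \<and> s \<le> l \<longrightarrow> q + s *\<^sub>R v \<in> table) \<and>
    (l = h \<or> (\<exists>c\<in>C. dist c (q + l *\<^sub>R v) = r)) \<and> ((\<exists>c\<in>C. dist c q = r) \<longrightarrow> l = h))"
  have start: "\<exists>l. P (q, u, v, l)" if "admissible q u v" for q u v
    using next_leg[OF that] that by (auto simp: P_def)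
  have "\<exists>f. \<forall>n. (P (f n) \<and> (n = 0 \<longrightarrow> (\<exists>l. f n = (q0, u0, v0, l)))) \<and>
    (case f n of (q, u, v, l) \<Rightarrow> \<exists>v' l'. f (Suc n) = (q + l *\<^sub>R v, v, v', l'))"
  proof (rule dependent_nat_choice)
    show "\<exists>x. P x \<and> ((0::nat) = 0 \<longrightarrow> (\<exists>l. x = (q0, u0, v0, l)))" using start[OF adm] by blast
  next
    fix x and n :: nat assume x: "P x \<and> (n = 0 \<longrightarrow> (\<exists>l. x = (q0, u0, v0, l)))"
    obtain q u v l where [simp]: "x = (q, u, v, l)" by (cases x)
    have *: "norm v = 1" "l > 0" "\<And>s. \<lbrakk>0 \<le> s; s \<le> l\<rbrakk> \<Longrightarrow> q + s *\<^sub>R v \<in> table"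
      using x by (auto simp: P_def admissible_def)
    have "\<exists>v'. admissible (q + l *\<^sub>R v) v v'"
    proof (rule admissible_extend)
      fix c assume c: "c \<in> C" "dist c (q + l *\<^sub>R v) = r"
      show "(q + l *\<^sub>R v - c) \<bullet> v \<le> 0"
      proof (rule ray_incoming[OF *(1) c(2) *(2)])
        fix s assume "0 < s" "s < l"
        then show "r \<le> dist c (q + l *\<^sub>R v - s *\<^sub>R v)"
          using *(3)[of "l - s"] c by (simp add: in_table_iff algebra_simps)
      qed
    qed (use * in auto)
    then obtain v' l' where "P (q + l *\<^sub>R v, v, v', l')" using start by blast
    then show "\<exists>y. (P y \<and> (Suc n = 0 \<longrightarrow> (\<exists>l. y = (q0, u0, v0, l)))) \<and>
        (case x of (q, u, v, l) \<Rightarrow> \<exists>v' l'. y = (q + l *\<^sub>R v, v, v', l'))"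
      by (intro exI[of _ "(q + l *\<^sub>R v, v, v', l')"]) simp
  qed
  then obtain f where F: "\<forall>n. (P (f n) \<and> (n = 0 \<longrightarrow> (\<exists>l. f n = (q0, u0, v0, l)))) \<and>
    (case f n of (q, u, v, l) \<Rightarrow> \<exists>v' l'. f (Suc n) = (q + l *\<^sub>R v, v, v', l'))" ..
  have f: "P (f n)" "\<exists>l. f 0 = (q0, u0, v0, l)"
    "case f n of (q, u, v, l) \<Rightarrow> \<exists>v' l'. f (Suc n) = (q + l *\<^sub>R v, v, v', l')" for n
    using F[rule_format, of n] F[rule_format, of 0] by (simp_all only: simp_thms)
  define Q where "Q n = fst (f n)" for n
  define U where "U n = fst (snd (f n))" for n
  define V where "V n = fst (snd (snd (f n)))" for n
  define L where "L n = snd (snd (snd (f n)))" for n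
  have fn: "f n = (Q n, U n, V n, L n)" for n by (simp add: Q_def U_def V_def L_def)
  have PP: "admissible (Q n) (U n) (V n)" "L n > 0"
    "\<And>s. \<lbrakk>0 \<le> s; s \<le> L n\<rbrakk> \<Longrightarrow> Q n + s *\<^sub>R V n \<in> table"
    "L n = h \<or> (\<exists>c\<in>C. dist c (Q n + L n *\<^sub>R V n) = r)" "(\<exists>c\<in>C. dist c (Q n) = r) \<Longrightarrow> L n = h" for n
    using f(1)[of n] unfolding fn P_def by auto
  have step: "Q (Suc n) = Q n + L n *\<^sub>R V n" "U (Suc n) = V n" for n
    using f(3)[of n] unfolding fn by auto
  \<comment> \<open>Either leg \<open>n\<close> has length \<open>h\<close>, or it ends at a disk
    and then leg \<open>Suc n\<close> has length \<open>h\<close>.\<close>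
  have two: "h \<le> L n + L (Suc n)" for n
  proof -
    have "L n = h \<or> L (Suc n) = h" using PP(4)[of n] PP(5)[of "Suc n"] unfolding step(1) by blast
    then show ?thesis using PP(2)[of n] PP(2)[of "Suc n"] by linarith
  qed
  have sum: "real k * h \<le> (\<Sum>j<2*k. L j)" for k
    using two[of "2 * _"] by (induction k) (auto simp: algebra_simps intro: order_trans add_mono)
  have "\<exists>k. B < (\<Sum>j<k. L j)" for B
  proof -
    obtain k where "B < real k * h" using h_pos reals_Archimedean3 by blast
    then show ?thesis using sum[of k] by (meson less_le_trans)
  qed
  from forward_of_legs[of Q U V L, OF PP(1,2,3) step this]
  show ?thesis using f(2) unfolding fn by auto
qed

text \<open>The past is the future of the reversed phase point with velocities \<open>- v 0\<close>
  and \<open>- u 0\<close>, run backwards.\<close>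

lemma trajectory_extend:
  assumes "\<forall>t\<ge>0. admissible (q t) (u t) (v t) \<and> motion_right q u v t" "\<forall>t>0. motion_left q u v t"
  shows "\<exists>q' u' v'. trajectory q' u' v' \<and> (\<forall>t\<ge>0. q' t = q t \<and> u' t = u t \<and> v' t = v t)"
proof -
  have "admissible (q 0) (- v 0) (- u 0)" using assms admissible_reverse by auto
  then obtain q2 u2 v2 where 2: "q2 0 = q 0" "u2 0 = - v 0" "v2 0 = - u 0"
    "\<And>t. t \<ge> 0 \<Longrightarrow> admissible (q2 t) (u2 t) (v2 t)" "\<And>t. t \<ge> 0 \<Longrightarrow> motion_right q2 u2 v2 t"
    "\<And>t. t > 0 \<Longrightarrow> motion_left q2 u2 v2 t"
    using forward_exists[of "q 0" "- v 0" "- u 0"] by blast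
  define q' where "q' t = (if t \<ge> 0 then q t else q2 (- t))" for t
  define u' where "u' t = (if t \<ge> 0 then u t else - v2 (- t))" for t
  define v' where "v' t = (if t \<ge> 0 then v t else - u2 (- t))" for t
  have neg: "q' t = q2 (- t)" "u' t = - v2 (- t)" "v' t = - u2 (- t)" if "t \<le> 0" for t
    using that 2 by (auto simp: q'_def u'_def v'_def)
  have pos: "q' t = q t" "u' t = u t" "v' t = v t" if "t \<ge> 0" for t
    using that by (auto simp: q'_def u'_def v'_def)
  have "admissible (q' t) (u' t) (v' t)" for t
    using 2(4)[of "- t"] admissible_reverse assms(1) neg[of t] pos[of t] by (cases "t \<ge> 0") auto
  moreover have "motion_right q' u' v' t" for t
  proof (cases "t \<ge> 0")
    case True
    then obtain \<epsilon> where "\<epsilon> > 0" "\<forall>s\<in>{0<..<\<epsilon>}. q (t + s) = q t + s *\<^sub>R v t \<and> u (t + s) = v t \<and> v (t + s) = v t"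
      using assms(1) unfolding motion_right_def by blast
    then show ?thesis unfolding motion_right_def using True pos by (intro exI[of _ \<epsilon>]) auto
  next
    case False
    then obtain \<epsilon> where \<epsilon>: "\<epsilon> > 0"
      "\<forall>s\<in>{0<..<\<epsilon>}. q2 (- t - s) = q2 (- t) - s *\<^sub>R u2 (- t) \<and> u2 (- t - s) = u2 (- t) \<and> v2 (- t - s) = u2 (- t)"
      using 2(6)[of "- t"] unfolding motion_left_def by auto
    show ?thesis unfolding motion_right_def
    proof (intro exI[of _ "min \<epsilon> (- t)"] conjI ballI)
      fix s assume "s \<in> {0<..<min \<epsilon> (- t)}"
      then have s: "s \<in> {0<..<\<epsilon>}" "t + s \<le> 0" "- (t + s) = - t - s" by auto
      show "q' (t + s) = q' t + s *\<^sub>R v' t" "u' (t + s) = v' t" "v' (t + s) = v' t"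
        using \<epsilon>(2)[rule_format, OF s(1)] neg[OF s(2)] neg[of t] False unfolding s(3) by auto
    qed (use \<epsilon> False in auto)
  qed
  moreover have "motion_left q' u' v' t" for t
  proof (cases "t > 0")
    case True
    then obtain \<epsilon> where "\<epsilon> > 0" "\<forall>s\<in>{0<..<\<epsilon>}. q (t - s) = q t - s *\<^sub>R u t \<and> u (t - s) = u t \<and> v (t - s) = u t"
      using assms(2) unfolding motion_left_def by blast
    then show ?thesis unfolding motion_left_def using True pos by (intro exI[of _ "min \<epsilon> t"]) auto
  next
    case False
    then obtain \<epsilon> where \<epsilon>: "\<epsilon> > 0"
      "\<forall>s\<in>{0<..<\<epsilon>}. q2 (- t + s) = q2 (- t) + s *\<^sub>R v2 (- t) \<and> u2 (- t + s) = v2 (- t) \<and> v2 (- t + s) = v2 (- t)"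
      using 2(5)[of "- t"] unfolding motion_right_def by auto
    show ?thesis unfolding motion_left_def
    proof (intro exI[of _ \<epsilon>] conjI ballI)
      fix s assume s0: "s \<in> {0<..<\<epsilon>}"
      then have s: "t - s \<le> 0" "- (t - s) = - t + s" using False by auto
      show "q' (t - s) = q' t - s *\<^sub>R u' t" "u' (t - s) = u' t" "v' (t - s) = u' t"
        using \<epsilon>(2)[rule_format, OF s0] neg[OF s(1)] neg[of t] False unfolding s(2) by auto
    qed (use \<epsilon> in auto)
  qed
  ultimately have "trajectory q' u' v'" by (simp add: trajectory_def)
  then show ?thesis using pos by blast
qed

lemma trajectory_exists:
  assumes "admissible q0 u0 v0"
  shows "\<exists>q u v. trajectory q u v \<and> q 0 = q0 \<and> u 0 = u0 \<and> v 0 = v0"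
proof -
  obtain q u v where 0: "q 0 = q0" "u 0 = u0" "v 0 = v0"
    and *: "\<forall>t\<ge>0. admissible (q t) (u t) (v t) \<and> motion_right q u v t" "\<forall>t>0. motion_left q u v t"
    using forward_exists[OF assms] by blast
  obtain q' u' v' where "trajectory q' u' v'" "\<forall>t\<ge>0. q' t = q t \<and> u' t = u t \<and> v' t = v t"
    using trajectory_extend[OF *] by blast
  then show ?thesis using 0 by (metis order_refl)
qed

lemma admissible_forward:
  assumes "admissible q u v" "admissible q u v'" shows "v' = v"
proof (cases "\<exists>c\<in>C. dist c q = r")
  case True
  then obtain c where "c \<in> C" "dist c q = r" ..
  then have "v = reflect c q u" "v' = reflect c q u" using assms unfolding admissible_def by blast+
  then show ?thesis by simp
next
  case False
  then have "v = u" "v' = u" using assms unfolding admissible_def by blast+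
  then show ?thesis by simp
qed

lemma admissible_backward:
  assumes "admissible q u v" "admissible q u' v" shows "u' = u"
  using admissible_forward[OF assms[THEN admissible_reverse]] by simp

text \<open>Near any given time the orbits agree everywhere or nowhere, since at an admissible point
  each one-sided velocity determines the other. So the set of agreement is open and closed in the
  line.\<close>

lemma trajectory_unique:
  assumes X: "trajectory q u v" and X': "trajectory q' u' v'" and eq: "q t0 = q' t0" "v t0 = v' t0"
  shows "q t = q' t \<and> u t = u' t \<and> v t = v' t"
proof -
  define S where "S = {t. q t = q' t \<and> u t = u' t \<and> v t = v' t}"
  have adm: "admissible (q t) (u t) (v t)" "admissible (q' t) (u' t) (v' t)" for t
    using X X' by (auto simp: trajectory_def)
  have t0: "t0 \<in> S" using eq adm[of t0] admissible_backward by (auto simp: S_def)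
  have loc: "\<exists>\<epsilon>>0. \<forall>t'. dist t' t < \<epsilon> \<longrightarrow> (t' \<in> S \<longleftrightarrow> t \<in> S)" for t
  proof -
    obtain \<epsilon>1 where 1: "\<epsilon>1 > 0" "\<And>s. s \<in> {0<..<\<epsilon>1} \<Longrightarrow> q (t + s) = q t + s *\<^sub>R v t \<and> u (t + s) = v t \<and> v (t + s) = v t"
      using X unfolding trajectory_def motion_right_def by blast
    obtain \<epsilon>2 where 2: "\<epsilon>2 > 0" "\<And>s. s \<in> {0<..<\<epsilon>2} \<Longrightarrow> q' (t + s) = q' t + s *\<^sub>R v' t \<and> u' (t + s) = v' t \<and> v' (t + s) = v' t"
      using X' unfolding trajectory_def motion_right_def by blast
    obtain \<epsilon>3 where 3: "\<epsilon>3 > 0" "\<And>s. s \<in> {0<..<\<epsilon>3} \<Longrightarrow> q (t - s) = q t - s *\<^sub>R u t \<and> u (t - s) = u t \<and> v (t - s) = u t"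
      using X unfolding trajectory_def motion_left_def by blast
    obtain \<epsilon>4 where 4: "\<epsilon>4 > 0" "\<And>s. s \<in> {0<..<\<epsilon>4} \<Longrightarrow> q' (t - s) = q' t - s *\<^sub>R u' t \<and> u' (t - s) = u' t \<and> v' (t - s) = u' t"
      using X' unfolding trajectory_def motion_left_def by blast
    define \<epsilon> where "\<epsilon> = min (min \<epsilon>1 \<epsilon>2) (min \<epsilon>3 \<epsilon>4)"
    have "t' \<in> S \<longleftrightarrow> t \<in> S" if "dist t' t < \<epsilon>" for t'
    proof -
      consider "t' = t" | s where "t' = t + s" "0 < s" "s < \<epsilon>" | s where "t' = t - s" "0 < s" "s < \<epsilon>"
        using \<open>dist t' t < \<epsilon>\<close> that(1) that(2)[of "t' - t"] that(3)[of "t - t'"]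
        by (cases t' t rule: linorder_cases) (auto simp: dist_real_def)
      then show ?thesis
      proof cases
        case A: 2
        have "s \<in> {0<..<\<epsilon>1}" "s \<in> {0<..<\<epsilon>2}" using A by (auto simp: \<epsilon>_def)
        note * = 1(2)[OF this(1)] 2(2)[OF this(2)]
        have "u t = u' t" if "q t = q' t" "v t = v' t"
          using adm[of t] that admissible_backward by metis
        then show ?thesis unfolding S_def A mem_Collect_eq using * by (metis add_right_cancel)
      next
        case B: 3
        have "s \<in> {0<..<\<epsilon>3}" "s \<in> {0<..<\<epsilon>4}" using B by (auto simp: \<epsilon>_def)
        note * = 3(2)[OF this(1)] 4(2)[OF this(2)]
        have "v t = v' t" if "q t = q' t" "u t = u' t"
          using adm[of t] that admissible_forward by metis
        then show ?thesis unfolding S_def B mem_Collect_eq using * by (metis diff_add_cancel)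
      qed simp
    qed
    moreover have "\<epsilon> > 0" using 1 2 3 4 by (simp add: \<epsilon>_def)
    ultimately show ?thesis by blast
  qed
  have "open S" "open (- S)" unfolding open_dist using loc by (meson ComplD ComplI)+
  then have "S \<inter> UNIV = {} \<or> - S \<inter> UNIV = {}" by (intro connectedD[OF connected_UNIV]) auto
  then have "S = UNIV" using t0 by blast
  then show ?thesis by (auto simp: S_def)
qed

end

section \<open>The phase space and the flow\<close>

definition lattice_vec :: "int \<Rightarrow> int \<Rightarrow> point" where
  "lattice_vec a b = (real_of_int a, real_of_int b)"

lemma lattice_vec_add: "lattice_vec a b + lattice_vec a' b' = lattice_vec (a + a') (b + b')"
  and lattice_vec_minus: "- lattice_vec a b = lattice_vec (- a) (- b)"
  and lattice_vec_0: "lattice_vec 0 0 = 0"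
  by (auto simp: lattice_vec_def zero_prod_def)

text \<open>The residue and the integer part of the first coordinate merge into one integer: the
  centres are a lattice with spacings \<open>1 / n\<close> and 1.\<close>

lemma disk_centers_eq:
  assumes "n > 0"
  shows "disk_centers n = {(real_of_int k / real n, real_of_int b) | k b. True}"
proof (intro set_eqI iffI)
  fix x assume "x \<in> disk_centers n"
  then obtain i a b where x: "x = (real i / real n + real_of_int a, real_of_int b)"
    by (auto simp: disk_centers_def)
  have "x = (real_of_int (int i + int n * a) / real n, real_of_int b)"
    using assms by (simp add: x field_simps)
  then show "x \<in> {(real_of_int k / real n, real_of_int b) | k b. True}" by blast
next
  fix x assume "x \<in> {(real_of_int k / real n, real_of_int b) | k b. True}"
  then obtain k b where x: "x = (real_of_int k / real n, real_of_int b)" by blast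
  define i where "i = nat (k mod int n)"
  have i: "int i = k mod int n" "i < n" using assms by (auto simp: i_def nat_less_iff)
  have "k = int i + int n * (k div int n)" unfolding i(1) by simp
  then have "real_of_int k = real i + real n * real_of_int (k div int n)"
    by (metis of_int_add of_int_mult of_int_of_nat_eq)
  then have "x = (real i / real n + real_of_int (k div int n), real_of_int b)"
    using assms by (simp add: x field_simps)
  then show "x \<in> disk_centers n" unfolding disk_centers_def using i(2) by blast
qed

lemma disk_centers_translate:
  assumes "n > 0" "c \<in> disk_centers n" shows "c + lattice_vec a b \<in> disk_centers n"
proof -
  obtain k l where c: "c = (real_of_int k / real n, real_of_int l)"
    using assms by (auto simp: disk_centers_eq)
  have "c + lattice_vec a b = (real_of_int (k + int n * a) / real n, real_of_int (l + b))"
    using assms by (simp add: c lattice_vec_def field_simps)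
  then show ?thesis unfolding disk_centers_eq[OF assms(1)] by blast
qed

lemma disk_centers_separated:
  assumes "n > 0" "c \<in> disk_centers n" "c' \<in> disk_centers n" "c \<noteq> c'"
  shows "1 / real n \<le> dist c c'"
proof -
  obtain k l k' l' where c: "c = (real_of_int k / real n, real_of_int l)"
    "c' = (real_of_int k' / real n, real_of_int l')"
    using assms by (auto simp: disk_centers_eq)
  show ?thesis
  proof (cases "l = l'")
    case True
    then have "k \<noteq> k'" using assms c by auto
    then have "1 \<le> \<bar>k - k'\<bar>" by linarith
    then have "1 \<le> \<bar>real_of_int k - real_of_int k'\<bar>" by linarith
    then have "1 / real n \<le> \<bar>real_of_int k - real_of_int k'\<bar> / real n"
      using assms by (intro divide_right_mono) auto
    also have "\<dots> = dist (fst c) (fst c')"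
      using assms by (simp add: c dist_real_def flip: diff_divide_distrib)
    also have "\<dots> \<le> dist c c'" by (rule dist_fst_le)
    finally show ?thesis .
  next
    case False
    then have "1 \<le> \<bar>l - l'\<bar>" by linarith
    then have "1 \<le> dist (snd c) (snd c')" by (simp add: c dist_real_def)
    also have "\<dots> \<le> dist c c'" by (rule dist_snd_le)
    moreover have "1 / real n \<le> 1" using assms by simp
    ultimately show ?thesis by linarith
  qed
qed

text \<open>The bound on \<open>r\<close> is generous. It makes \<open>r\<close> at most a
  thousandth both of the spacing \<open>1 / n\<close> and of the distance 1 between rows, which
  leaves room in all numerical estimates and makes the map \<open>improve\<close> a
  contraction.\<close>

locale disk_row =
  fixes n :: nat and r :: real
  assumes n_pos: "0 < n" and r_pos': "0 < r" and r_small: "r \<le> 1 / (1000 * real n)"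
begin

lemma two_r: "2 * r < 1 / real n"
proof -
  have "1 / (1000 * real n) < 1 / (2 * real n)" using n_pos by (intro divide_strict_left_mono) auto
  then have "r < 1 / (2 * real n)" using r_small by linarith
  then show ?thesis using n_pos by (simp add: field_simps)
qed

sublocale scatterers "disk_centers n" r "1 / real n"
  using n_pos r_pos' two_r disk_centers_separated by unfold_locales auto

abbreviation C where "C \<equiv> disk_centers n"

lemma table_eq: "billiard_table n r = table"
  by (simp add: billiard_table_def table_def)

lemma translate_center: "c \<in> C \<Longrightarrow> c + lattice_vec a b \<in> C"
  using disk_centers_translate n_pos by blast

lemma translate_center_diff: "c \<in> C \<Longrightarrow> c - lattice_vec a b \<in> C"
  using translate_center[of c "- a" "- b"] by (simp flip: lattice_vec_minus)

lemma translate_table: "q + lattice_vec a b \<in> table \<longleftrightarrow> q \<in> table"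
proof -
  have "q + lattice_vec a b \<in> table" if "q \<in> table" for q a b
    unfolding in_table_iff
  proof
    fix c assume "c \<in> C"
    then have "r \<le> dist (c - lattice_vec a b) q"
      using that translate_center_diff by (auto simp: in_table_iff)
    then show "r \<le> dist c (q + lattice_vec a b)" by (simp add: dist_norm algebra_simps)
  qed
  from this[of q a b] this[of "q + lattice_vec a b" "- a" "- b"] show ?thesis
    by (auto simp: add.assoc lattice_vec_add lattice_vec_0)
qed

lemma translate_admissible:
  assumes "admissible q u v" shows "admissible (q + lattice_vec a b) u v"
proof -
  let ?z = "lattice_vec a b"
  have *: "c - ?z \<in> C" "dist (c - ?z) q = r" if "c \<in> C" "dist c (q + ?z) = r" for c
    using that translate_center_diff by (auto simp: dist_norm algebra_simps)
  have refl: "reflect c (q + ?z) u = reflect (c - ?z) q u" for c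
    using reflect_translate[of "c - ?z" ?z q u] by simp
  have 1: "(q + ?z - c) \<bullet> u \<le> 0 \<and> v = reflect c (q + ?z) u" if c: "c \<in> C" "dist c (q + ?z) = r" for c
  proof -
    have "(q - (c - ?z)) \<bullet> u \<le> 0 \<and> v = reflect (c - ?z) q u"
      using assms *[OF c] unfolding admissible_def by blast
    then show ?thesis unfolding refl by (simp add: algebra_simps)
  qed
  have 2: "v = u" if "\<forall>c\<in>C. dist c (q + ?z) \<noteq> r"
  proof -
    have "\<forall>c\<in>C. dist c q \<noteq> r"
    proof
      fix c assume "c \<in> C"
      then have "dist (c + ?z) (q + ?z) \<noteq> r" using that translate_center by blast
      then show "dist c q \<noteq> r" by simp
    qed
    then show ?thesis using assms unfolding admissible_def by blast
  qed
  show ?thesis unfolding admissible_def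
    using 1 2 assms translate_table unfolding admissible_def by blast
qed

lemma translate_trajectory:
  assumes "trajectory q u v" shows "trajectory (\<lambda>t. q t + lattice_vec a b) u v"
proof -
  have "motion_right (\<lambda>t. q t + lattice_vec a b) u v t" if "motion_right q u v t" for t
    using that unfolding motion_right_def by (simp add: algebra_simps)
  moreover have "motion_left (\<lambda>t. q t + lattice_vec a b) u v t" if "motion_left q u v t" for t
    using that unfolding motion_left_def by (simp add: algebra_simps)
  ultimately show ?thesis using assms translate_admissible unfolding trajectory_def by blast
qed

lemma shift_trajectory:
  assumes "trajectory q u v"
  shows "trajectory (\<lambda>t. q (t + a)) (\<lambda>t. u (t + a)) (\<lambda>t. v (t + a))"
proof -
  have "motion_right (\<lambda>t. q (t + a)) (\<lambda>t. u (t + a)) (\<lambda>t. v (t + a)) t" if "motion_right q u v (t + a)" for t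
    using that unfolding motion_right_def by (simp add: algebra_simps)
  moreover have "motion_left (\<lambda>t. q (t + a)) (\<lambda>t. u (t + a)) (\<lambda>t. v (t + a)) t" if "motion_left q u v (t + a)" for t
    using that unfolding motion_left_def by (simp add: algebra_simps)
  ultimately show ?thesis using assms unfolding trajectory_def by blast
qed

text \<open>The original definition quantifies the incoming velocity separately at each time. It is
  forced to be the left limit of \<open>v\<close>, which yields the function \<open>u\<close> and
  its values nearby; that it points into the disk at a contact follows because the particle was in
  the table just before.\<close>

lemma billiard_trajectory_iff: "billiard_trajectory n r q v \<longleftrightarrow> (\<exists>u. trajectory q u v)"
proof
  assume X: "billiard_trajectory n r q v"
  have lift: "q t \<in> table" "norm (v t) = 1" for t
    using X by (auto simp: billiard_trajectory_def lifted_phase_space_def table_eq)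
  have "\<exists>u. (\<exists>\<epsilon>>0. \<forall>s\<in>{0<..<\<epsilon>}.
               q (t + s) = q t + s *\<^sub>R v t \<and> v (t + s) = v t \<and>
               q (t - s) = q t - s *\<^sub>R u \<and> v (t - s) = u) \<and>
            (\<forall>c\<in>C. dist c (q t) = r \<longrightarrow> v t = reflect c (q t) u) \<and>
            ((\<forall>c\<in>C. dist c (q t) \<noteq> r) \<longrightarrow> v t = u)" for t
    using X unfolding billiard_trajectory_def by blast
  then obtain u where u: "\<forall>t. (\<exists>\<epsilon>>0. \<forall>s\<in>{0<..<\<epsilon>}.
               q (t + s) = q t + s *\<^sub>R v t \<and> v (t + s) = v t \<and>
               q (t - s) = q t - s *\<^sub>R u t \<and> v (t - s) = u t) \<and>
            (\<forall>c\<in>C. dist c (q t) = r \<longrightarrow> v t = reflect c (q t) (u t)) \<and>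
            ((\<forall>c\<in>C. dist c (q t) \<noteq> r) \<longrightarrow> v t = u t)"
    by metis
  have ueq: "u t = w" if "\<epsilon> > 0" "\<And>s. \<lbrakk>0 < s; s < \<epsilon>\<rbrakk> \<Longrightarrow> v (t - s) = w" for t w \<epsilon>
  proof -
    obtain \<epsilon>' where "\<epsilon>' > 0" "\<forall>s\<in>{0<..<\<epsilon>'}. v (t - s) = u t" using u by blast
    then have "v (t - min \<epsilon> \<epsilon>' / 2) = u t" using that(1) by auto
    moreover have "v (t - min \<epsilon> \<epsilon>' / 2) = w" using that \<open>\<epsilon>' > 0\<close> by auto
    ultimately show ?thesis by simp
  qed
  have "trajectory q u v" unfolding trajectory_def
  proof (intro allI conjI)
    fix t
    obtain \<epsilon> where \<epsilon>0: "\<epsilon> > 0" "\<forall>s\<in>{0<..<\<epsilon>}.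
               q (t + s) = q t + s *\<^sub>R v t \<and> v (t + s) = v t \<and>
               q (t - s) = q t - s *\<^sub>R u t \<and> v (t - s) = u t"
      using u by blast
    then have \<epsilon>: "\<epsilon> > 0" "\<And>s. \<lbrakk>0 < s; s < \<epsilon>\<rbrakk> \<Longrightarrow>
               q (t + s) = q t + s *\<^sub>R v t \<and> v (t + s) = v t \<and>
               q (t - s) = q t - s *\<^sub>R u t \<and> v (t - s) = u t"
      by simp_all
    have un: "norm (u t) = 1" using lift(2)[of "t - \<epsilon>/2"] \<epsilon>(2)[of "\<epsilon>/2"] \<epsilon>(1) by simp
    show "motion_right q u v t" unfolding motion_right_def
    proof (intro exI[of _ \<epsilon>] conjI ballI)
      fix s assume s: "s \<in> {0<..<\<epsilon>}"
      show "q (t + s) = q t + s *\<^sub>R v t" "v (t + s) = v t" using \<epsilon>(2) s by auto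
      show "u (t + s) = v t"
      proof (rule ueq)
        fix s' assume "0 < s'" "s' < s"
        then show "v (t + s - s') = v t" using \<epsilon>(2)[of "s - s'"] s by (simp add: algebra_simps)
      qed (use s in simp)
    qed (rule \<epsilon>)
    show "motion_left q u v t" unfolding motion_left_def
    proof (intro exI[of _ \<epsilon>] conjI ballI)
      fix s assume s: "s \<in> {0<..<\<epsilon>}"
      show "q (t - s) = q t - s *\<^sub>R u t" "v (t - s) = u t" using \<epsilon>(2) s by auto
      show "u (t - s) = u t"
      proof (rule ueq)
        fix s' assume "0 < s'" "s' < \<epsilon> - s"
        then show "v (t - s - s') = u t" using \<epsilon>(2)[of "s + s'"] s by (simp add: diff_diff_eq)
      qed (use s in simp)
    qed (rule \<epsilon>)
    have "(q t - c) \<bullet> u t \<le> 0" if c: "c \<in> C" "dist c (q t) = r" for c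
    proof (rule ray_incoming[OF un c(2) \<epsilon>(1)])
      fix s assume "0 < s" "s < \<epsilon>"
      then show "r \<le> dist c (q t - s *\<^sub>R u t)" using \<epsilon>(2)[of s] lift(1)[of "t - s"] c(1)
        by (simp add: in_table_iff)
    qed
    then show "admissible (q t) (u t) (v t)"
      unfolding admissible_def using lift[of t] un u by blast
  qed
  then show "\<exists>u. trajectory q u v" by blast
next
  assume "\<exists>u. trajectory q u v"
  then obtain u where X: "trajectory q u v" ..
  show "billiard_trajectory n r q v" unfolding billiard_trajectory_def
  proof
    fix t
    have adm: "admissible (q t) (u t) (v t)" using X by (simp add: trajectory_def)
    obtain \<epsilon>1 where 1: "\<epsilon>1 > 0" "\<And>s. s \<in> {0<..<\<epsilon>1} \<Longrightarrow> q (t + s) = q t + s *\<^sub>R v t \<and> u (t + s) = v t \<and> v (t + s) = v t"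
      using X unfolding trajectory_def motion_right_def by blast
    obtain \<epsilon>2 where 2: "\<epsilon>2 > 0" "\<And>s. s \<in> {0<..<\<epsilon>2} \<Longrightarrow> q (t - s) = q t - s *\<^sub>R u t \<and> u (t - s) = u t \<and> v (t - s) = u t"
      using X unfolding trajectory_def motion_left_def by blast
    have "\<exists>\<epsilon>>0. \<forall>s\<in>{0<..<\<epsilon>}.
               q (t + s) = q t + s *\<^sub>R v t \<and> v (t + s) = v t \<and>
               q (t - s) = q t - s *\<^sub>R u t \<and> v (t - s) = u t"
      using 1 2 by (intro exI[of _ "min \<epsilon>1 \<epsilon>2"]) auto
    moreover have "(q t, v t) \<in> lifted_phase_space n r"
      using adm by (simp add: lifted_phase_space_def table_eq admissible_def)
    ultimately show "(q t, v t) \<in> lifted_phase_space n r \<and>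
       (\<exists>u. (\<exists>\<epsilon>>0. \<forall>s\<in>{0<..<\<epsilon>}.
               q (t + s) = q t + s *\<^sub>R v t \<and> v (t + s) = v t \<and>
               q (t - s) = q t - s *\<^sub>R u \<and> v (t - s) = u) \<and>
            (\<forall>c\<in>C. dist c (q t) = r \<longrightarrow> v t = reflect c (q t) u) \<and>
            ((\<forall>c\<in>C. dist c (q t) \<noteq> r) \<longrightarrow> v t = u))"
      using adm unfolding admissible_def by blast
  qed
qed

section \<open>States modulo lattice translations and reflection\<close>

abbreviation "\<Lambda> \<equiv> lifted_phase_space n r"

definition state :: "point \<Rightarrow> point \<Rightarrow> (point \<times> point) set" where
  "state q v = phase_rel n r `` {(q, v)}"

definition mates :: "point \<Rightarrow> point \<Rightarrow> point \<Rightarrow> bool" where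
  "mates q v v' \<longleftrightarrow> v' = v \<or> (\<exists>c\<in>C. dist c q = r \<and> v' = reflect c q v)"

lemma phase_rel_iff:
  "((q, v), (q', v')) \<in> phase_rel n r \<longleftrightarrow> (q, v) \<in> \<Lambda> \<and> (q', v') \<in> \<Lambda> \<and>
     (\<exists>a b. q' = q + lattice_vec a b) \<and> mates q v v'"
  by (simp add: phase_rel_def lattice_vec_def mates_def)

lemma mates_sym: "mates q v v' \<Longrightarrow> mates q v' v"
  unfolding mates_def using reflect_reflect contact_ne by metis

lemma mates_trans:
  assumes "mates q v v'" "mates q v' v''" shows "mates q v v''"
proof (cases "v' = v \<or> v'' = v'")
  case False
  then obtain c c' where c: "c \<in> C" "dist c q = r" "v' = reflect c q v"
    "c' \<in> C" "dist c' q = r" "v'' = reflect c' q v'" using assms unfolding mates_def by blast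
  then have "c' = c" using contact_unique by blast
  then have "v'' = v" using c reflect_reflect contact_ne by metis
  then show ?thesis by (simp add: mates_def)
qed (use assms in auto)

lemma mates_translate: "mates (q + lattice_vec a b) v v' \<longleftrightarrow> mates q v v'"
proof -
  have *: "mates (q + lattice_vec a b) v v'" if m: "mates q v v'" for q a b
  proof (cases "v' = v")
    case False
    then obtain c where "c \<in> C" "dist c q = r" "v' = reflect c q v" using m by (auto simp: mates_def)
    then have "c + lattice_vec a b \<in> C" "dist (c + lattice_vec a b) (q + lattice_vec a b) = r"
      "v' = reflect (c + lattice_vec a b) (q + lattice_vec a b) v"
      using translate_center by (auto simp: reflect_translate)
    then show ?thesis unfolding mates_def by blast
  qed (simp add: mates_def)
  from *[of q a b] *[of "q + lattice_vec a b" "- a" "- b"] show ?thesis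
    by (auto simp: add.assoc lattice_vec_add lattice_vec_0)
qed

text \<open>Transitivity rests on the separation of the disks: a position touches at most one of
  them, and reflecting twice in it is the identity.\<close>

lemma equiv_phase_rel: "equiv \<Lambda> (phase_rel n r)"
proof (rule equivI)
  show "phase_rel n r \<subseteq> \<Lambda> \<times> \<Lambda>" by (auto simp: phase_rel_def)
  show "refl_on \<Lambda> (phase_rel n r)"
  proof (rule refl_onI)
    fix x assume "x \<in> \<Lambda>"
    then show "(x, x) \<in> phase_rel n r"
      by (cases x) (auto simp: phase_rel_iff mates_def intro!: exI[of _ 0] simp: lattice_vec_0)
  qed
  show "sym (phase_rel n r)"
  proof (rule symI)
    fix x y assume "(x, y) \<in> phase_rel n r"
    moreover obtain q v q' v' where [simp]: "x = (q, v)" "y = (q', v')" by (cases x, cases y)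
    ultimately obtain a b where *: "(q, v) \<in> \<Lambda>" "(q', v') \<in> \<Lambda>" "q' = q + lattice_vec a b" "mates q v v'"
      unfolding \<open>x = _\<close> \<open>y = _\<close> phase_rel_iff by blast
    have "q = q' + lattice_vec (- a) (- b)" by (simp add: *(3) flip: lattice_vec_minus)
    moreover have "mates q' v' v" using * mates_translate mates_sym by simp
    ultimately have "((q', v'), (q, v)) \<in> phase_rel n r"
      unfolding phase_rel_iff using * by blast
    then show "(y, x) \<in> phase_rel n r" by simp
  qed
  show "trans (phase_rel n r)"
  proof (rule transI)
    fix x y z assume A: "(x, y) \<in> phase_rel n r" "(y, z) \<in> phase_rel n r"
    obtain q v q' v' q'' v'' where [simp]: "x = (q, v)" "y = (q', v')" "z = (q'', v'')"
      by (cases x, cases y, cases z)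
    obtain a b where *: "(q, v) \<in> \<Lambda>" "(q', v') \<in> \<Lambda>" "q' = q + lattice_vec a b" "mates q v v'"
      using A(1) unfolding \<open>x = _\<close> \<open>y = _\<close> phase_rel_iff by blast
    obtain a' b' where **: "(q'', v'') \<in> \<Lambda>" "q'' = q' + lattice_vec a' b'" "mates q' v' v''"
      using A(2) unfolding \<open>z = _\<close> \<open>y = _\<close> phase_rel_iff by blast
    have "q'' = q + lattice_vec (a + a') (b + b')" by (simp add: * ** add.assoc lattice_vec_add)
    moreover have "mates q v v''" using * ** mates_translate mates_trans by blast
    ultimately have "((q, v), (q'', v'')) \<in> phase_rel n r"
      unfolding phase_rel_iff using * ** by blast
    then show "(x, z) \<in> phase_rel n r" by simp
  qed
qed

lemma state_eq_iff:
  assumes "(q, v) \<in> \<Lambda>" "(q', v') \<in> \<Lambda>"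
  shows "state q v = state q' v' \<longleftrightarrow> (\<exists>a b. q' = q + lattice_vec a b) \<and> mates q v v'"
  unfolding state_def using eq_equiv_class_iff[OF equiv_phase_rel assms] assms by (simp add: phase_rel_iff)

lemma topspace_phase_space: "topspace (phase_space n r) = {state q v | q v. (q, v) \<in> \<Lambda>}"
  by (auto simp: phase_space_def topspace_quotient_topology quotient_def state_def)

lemma admissible_lifted: "admissible q u v \<Longrightarrow> (q, v) \<in> \<Lambda>"
  by (simp add: lifted_phase_space_def table_eq admissible_def)

text \<open>Reflection reverses the normal component; as both velocities are outgoing it vanishes,
  and the reflection is trivial. Hence the outgoing representative of a state is unique up to the
  lattice.\<close>

lemma mates_admissible:
  assumes "admissible q u v" "admissible q u' v'" "mates q v v'" shows "v' = v"
proof (cases "v' = v")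
  case False
  then obtain c where c: "c \<in> C" "dist c q = r" "v' = reflect c q v"
    using assms by (auto simp: mates_def)
  have "(q - c) \<bullet> v' = - ((q - c) \<bullet> v)" using c inner_reflect contact_ne by metis
  moreover have "(q - c) \<bullet> v \<ge> 0" "(q - c) \<bullet> v' \<ge> 0"
    using admissible_outgoing[OF assms(1) c(1,2)] admissible_outgoing[OF assms(2) c(1,2)] by auto
  ultimately have "(q - c) \<bullet> v = 0" by simp
  then show ?thesis using c reflect_tangent by simp
qed

lemma trajectory_state_unique:
  assumes X: "trajectory q u v" and X': "trajectory q' u' v'"
    and eq: "state (q 0) (v 0) = state (q' 0) (v' 0)"
  shows "state (q t) (v t) = state (q' t) (v' t)"
proof -
  have adm: "admissible (q t) (u t) (v t)" "admissible (q' t) (u' t) (v' t)" for t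
    using X X' by (auto simp: trajectory_def)
  obtain a b where ab: "q' 0 = q 0 + lattice_vec a b" "mates (q 0) (v 0) (v' 0)"
    using eq state_eq_iff[OF adm[THEN admissible_lifted]] by blast
  have "v' 0 = v 0"
    using mates_admissible[OF translate_admissible[OF adm(1)], of 0 a b "u' 0" "v' 0"] adm(2)[of 0]
      ab mates_translate by simp
  then have "q t + lattice_vec a b = q' t \<and> u t = u' t \<and> v t = v' t"
    using trajectory_unique[OF translate_trajectory[OF X, of a b] X', of 0 t] ab by simp
  then have "q' t = q t + lattice_vec a b" "v' t = v t" by auto
  then show ?thesis using state_eq_iff[OF adm(1)[THEN admissible_lifted] adm(2)[THEN admissible_lifted], of t t]
    unfolding mates_def by blast
qed

text \<open>The definite description in \<open>billiard_flow\<close> denotes this state because the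
  state at time 0 determines the trajectory up to translation, and so every later state.\<close>

lemma flow_state:
  assumes X: "trajectory q u v"
  shows "billiard_flow n r t (state (q 0) (v 0)) = state (q t) (v t)"
  unfolding billiard_flow_def state_def[symmetric]
proof (rule the_equality)
  show "\<exists>q' v'. billiard_trajectory n r q' v' \<and> state (q 0) (v 0) = state (q' 0) (v' 0) \<and>
      state (q t) (v t) = state (q' t) (v' t)"
    using X billiard_trajectory_iff by blast
  fix y assume "\<exists>q' v'. billiard_trajectory n r q' v' \<and> state (q 0) (v 0) = state (q' 0) (v' 0) \<and>
      y = state (q' t) (v' t)"
  then show "y = state (q t) (v t)"
    using X billiard_trajectory_iff trajectory_state_unique by metis
qed

lemma flow_iterate:
  assumes X: "trajectory q u v"
  shows "(billiard_flow n r 1 ^^ k) (state (q 0) (v 0)) = state (q (real k)) (v (real k))"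
proof (induction k)
  case (Suc k)
  have "billiard_flow n r 1 (state (q (real k)) (v (real k))) = state (q (1 + real k)) (v (1 + real k))"
    using flow_state[OF shift_trajectory[OF X, of "real k"], of 1] by simp
  then show ?case using Suc by simp
qed simp

text \<open>Starting in the unit square fixes the lift; arbitrary lifts of the same orbits would
  yield infinitely many collision words.\<close>

lemma state_trajectory:
  assumes "x \<in> topspace (phase_space n r)"
  shows "\<exists>q u v. trajectory q u v \<and> x = state (q 0) (v 0) \<and> \<lfloor>fst (q 0)\<rfloor> = 0 \<and> \<lfloor>snd (q 0)\<rfloor> = 0"
proof -
  obtain p0 w where p0: "x = state p0 w" "(p0, w) \<in> \<Lambda>" using assms topspace_phase_space by auto
  define p where "p = p0 + lattice_vec (- \<lfloor>fst p0\<rfloor>) (- \<lfloor>snd p0\<rfloor>)"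
  have fl: "\<lfloor>fst p\<rfloor> = 0" "\<lfloor>snd p\<rfloor> = 0" by (auto simp: p_def lattice_vec_def)
  have p\<Lambda>: "(p, w) \<in> \<Lambda>" using p0(2) translate_table
    by (simp add: lifted_phase_space_def table_eq p_def)
  have xp: "x = state p w" using state_eq_iff[OF p0(2) p\<Lambda>] p0(1) by (auto simp: p_def mates_def)
  have p: "p \<in> table" "norm w = 1" using p\<Lambda> by (auto simp: lifted_phase_space_def table_eq)
  have "\<exists>u v. admissible p u v \<and> mates p w v"
  proof (cases "\<exists>c\<in>C. dist c p = r")
    case True
    then obtain c where c: "c \<in> C" "dist c p = r" ..
    have un: "c' = c" if "c' \<in> C" "dist c' p = r" for c' using that c contact_unique by blast
    have nr: "norm (reflect c p w) = 1" using p norm_reflect contact_ne[OF c(2)] by simp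
    have rr: "reflect c p (reflect c p w) = w" using reflect_reflect contact_ne[OF c(2)] by simp
    \<comment> \<open>The given velocity may be the incoming or the outgoing one; its mate supplies
      the other.\<close>
    show ?thesis
    proof (cases "(p - c) \<bullet> w \<le> 0")
      case True
      then have "admissible p w (reflect c p w)" unfolding admissible_def using p nr un c by blast
      then show ?thesis using c unfolding mates_def by blast
    next
      case False
      then have "(p - c) \<bullet> reflect c p w \<le> 0" using inner_reflect[OF contact_ne[OF c(2)], of w] by simp
      then have "admissible p (reflect c p w) w" unfolding admissible_def using p nr un c rr
        by metis
      then show ?thesis unfolding mates_def by blast
    qed
  next
    case False
    then have "admissible p w w" unfolding admissible_def using p by blast
    then show ?thesis unfolding mates_def by blast
  qed
  then obtain u v where uv: "admissible p u v" "mates p w v" by blast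
  have "p = p + lattice_vec 0 0" by (simp add: lattice_vec_0)
  then have "x = state p v" unfolding xp using state_eq_iff[OF p\<Lambda> admissible_lifted[OF uv(1)]] uv(2) by blast
  then show ?thesis using trajectory_exists[OF uv(1)] fl by metis
qed

end

section \<open>Comparison of two trajectories with the same collisions\<close>

text \<open>Summation by parts: each change of direction acts on a later position with the time
  elapsed since it happened.\<close>

lemma broken_line:
  fixes P D :: "nat \<Rightarrow> 'a::real_vector"
  assumes "\<And>i. i < l \<Longrightarrow> P (Suc i) = P i + (T (Suc i) - T i) *\<^sub>R D i"
  shows "P l + (t - T l) *\<^sub>R D l = P 0 + (t - T 0) *\<^sub>R D 0 + (\<Sum>i=1..l. (t - T i) *\<^sub>R (D i - D (i - 1)))"
  using assms
proof (induction l)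
  case (Suc l)
  have "P (Suc l) + (t - T (Suc l)) *\<^sub>R D (Suc l)
      = P l + (t - T l) *\<^sub>R D l + (t - T (Suc l)) *\<^sub>R (D (Suc l) - D l)"
    using Suc.prems[of l] by (simp add: algebra_simps)
  then show ?case using Suc by simp
qed simp

lemma telescope_bound:
  fixes D :: "nat \<Rightarrow> 'a::real_normed_vector"
  assumes "l \<le> k"
  shows "norm (D k - D l) \<le> (\<Sum>i=Suc l..k. norm (D i - D (i - 1)))"
  using assms
proof (induction k rule: dec_induct)
  case (step k)
  have "norm (D (Suc k) - D l) \<le> norm (D (Suc k) - D k) + norm (D k - D l)"
    using norm_triangle_ineq[of "D (Suc k) - D k" "D k - D l"] by simp
  then show ?case using step by simp
qed simp

lemma abs_inner_unit: "norm (w::'a::real_inner) = 1 \<Longrightarrow> \<bar>x \<bullet> w\<bar> \<le> norm x"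
  using Cauchy_Schwarz_ineq2[of x w] by simp

context scatterers begin

text \<open>\<open>p 0\<close> and \<open>p (Suc K)\<close> are end points, the collisions have
  indices 1 to \<open>K\<close>, and \<open>w i\<close> is the direction on the leg from
  \<open>p i\<close> to \<open>p (Suc i)\<close>. The last equation says that the velocity jumps
  along the outward normal with a nonnegative coefficient.\<close>

definition chain :: "nat \<Rightarrow> (nat \<Rightarrow> real) \<Rightarrow> (nat \<Rightarrow> point) \<Rightarrow> (nat \<Rightarrow> point) \<Rightarrow> (nat \<Rightarrow> point) \<Rightarrow> bool" where
  "chain K T p w c \<longleftrightarrow>
     (\<forall>i\<le>K. T i \<le> T (Suc i) \<and> p (Suc i) = p i + (T (Suc i) - T i) *\<^sub>R w i \<and> norm (w i) = 1) \<and>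
     (\<forall>i. 1 \<le> i \<and> i \<le> K \<longrightarrow> c i \<in> C \<and> dist (c i) (p i) = r \<and>
        w i - w (i - 1) = (norm (w i - w (i - 1)) / r) *\<^sub>R (p i - c i))"

lemma chain_step:
  assumes "chain K T p w c" "i \<le> K"
  shows "T i \<le> T (Suc i)" "p (Suc i) = p i + (T (Suc i) - T i) *\<^sub>R w i" "norm (w i) = 1"
  using assms unfolding chain_def by blast+

lemma chain_contact:
  assumes "chain K T p w c" "1 \<le> i" "i \<le> K"
  shows "c i \<in> C" "dist (c i) (p i) = r" "w i - w (i - 1) = (norm (w i - w (i - 1)) / r) *\<^sub>R (p i - c i)"
  using assms unfolding chain_def by blast+

text \<open>
  All terms on the left are nonnegative. Equality of the lengths of the two chains therefore
  turns closeness of their endpoints into closeness of all velocities and of all non-grazing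
  collision points.
\<close>

lemma chain_identity:
  assumes X: "chain K T p w c" and X': "chain K T' p' w' c" and j: "j \<le> K"
  shows "(\<Sum>i\<le>j. (T' (Suc i) - T' i) * (norm (w i - w' i))\<^sup>2 / 2)
     + (\<Sum>i=1..j. norm (w i - w (i - 1)) * (norm (p i - p' i))\<^sup>2 / (2 * r))
     = (T' (Suc j) - T' 0) - (T (Suc j) - T 0) + (p (Suc j) - p' (Suc j)) \<bullet> w j - (p 0 - p' 0) \<bullet> w 0"
  using j
proof (induction j)
  \<comment> \<open>For unit vectors half the squared distance is 1 minus the inner product.\<close>
  have seg: "(T' (Suc i) - T' i) * (norm (w i - w' i))\<^sup>2 / 2
      = (T' (Suc i) - T' i) - (T (Suc i) - T i) + (p (Suc i) - p' (Suc i)) \<bullet> w i - (p i - p' i) \<bullet> w i"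
    if "i \<le> K" for i
  proof -
    have *: "p (Suc i) = p i + (T (Suc i) - T i) *\<^sub>R w i" "p' (Suc i) = p' i + (T' (Suc i) - T' i) *\<^sub>R w' i"
      "w i \<bullet> w i = 1" "w' i \<bullet> w' i = 1"
      using X X' that by (auto simp: chain_def norm_eq_1)
    have n2: "(norm (w i - w' i))\<^sup>2 = 2 - 2 * (w' i \<bullet> w i)"
      using * by (simp add: power2_norm_eq_inner inner_diff_left inner_diff_right inner_commute)
    have "(T' (Suc i) - T' i) * (norm (w i - w' i))\<^sup>2 / 2 = (T' (Suc i) - T' i) * (1 - w' i \<bullet> w i)"
      unfolding n2 by (simp add: field_simps)
    then show ?thesis by (simp add: * inner_diff_left inner_add_left algebra_simps)
  qed
  {
    case 0
    then show ?case using seg[of 0] by simp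
  next
    case (Suc j)
    let ?i = "Suc j" let ?k = "norm (w ?i - w j)"
    have c: "dist (c ?i) (p ?i) = r" "w ?i - w j = (?k / r) *\<^sub>R (p ?i - c ?i)"
      using chain_contact[OF X, of ?i] Suc.prems by simp_all
    have c': "dist (c ?i) (p' ?i) = r" using chain_contact[OF X', of ?i] Suc.prems by simp
    \<comment> \<open>Both points lie on the circle of radius \<open>r\<close> about
      \<open>c ?i\<close>; for vectors of equal length \<open>(norm (a - b))\<^sup>2\<close> equals
      \<open>2 * ((a - b) \<bullet> a)\<close>.\<close>
    have "(norm (p ?i - p' ?i))\<^sup>2 = 2 * ((p ?i - p' ?i) \<bullet> (p ?i - c ?i))"
    proof -
      have "(p ?i - c ?i) \<bullet> (p ?i - c ?i) = r\<^sup>2" "(p' ?i - c ?i) \<bullet> (p' ?i - c ?i) = r\<^sup>2"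
        using c(1) c' by (simp_all add: dist_norm norm_minus_commute power2_norm_eq_inner flip: power2_norm_eq_inner)
      then show ?thesis
        unfolding power2_norm_eq_inner by (simp add: inner_diff_left inner_diff_right inner_commute algebra_simps)
    qed
    then have "?k * (norm (p ?i - p' ?i))\<^sup>2 / (2 * r) = (p ?i - p' ?i) \<bullet> ((?k / r) *\<^sub>R (p ?i - c ?i))"
      by simp
    also have "\<dots> = (p ?i - p' ?i) \<bullet> w ?i - (p ?i - p' ?i) \<bullet> w j"
      unfolding c(2)[symmetric] by (rule inner_diff_right)
    finally have "?k * (norm (p ?i - p' ?i))\<^sup>2 / (2 * r) = (p ?i - p' ?i) \<bullet> w ?i - (p ?i - p' ?i) \<bullet> w j" .
    moreover have "(\<Sum>i=1..?i. norm (w i - w (i - 1)) * (norm (p i - p' i))\<^sup>2 / (2 * r))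
        = (\<Sum>i=1..j. norm (w i - w (i - 1)) * (norm (p i - p' i))\<^sup>2 / (2 * r))
          + ?k * (norm (p ?i - p' ?i))\<^sup>2 / (2 * r)" by simp
    ultimately show ?case using Suc.IH Suc.prems seg[of ?i] unfolding sum.atMost_Suc by linarith
  }
qed

lemma chain_mono:
  assumes "chain K T p w c" "i \<le> j" "j \<le> Suc K" shows "T i \<le> T j"
  using assms(2,3)
proof (induction j rule: dec_induct)
  case (step m)
  then have "T m \<le> T (Suc m)" using assms(1) by (auto simp: chain_def)
  then show ?case using step by simp
qed simp

text \<open>Dropping the nonnegative sums in \<open>chain_identity\<close>, taken up to the leg
  before \<open>i\<close>, bounds the time difference by position errors at the two ends, whatever
  the number of collisions. The lower bound uses this to keep two orbits with a common initial word
  synchronous.\<close>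

lemma chain_time_le:
  assumes X: "chain K T p w c" and X': "chain K T' p' w' c" and "T 0 = 0" "T' 0 = 0"
    and i: "1 \<le> i" "i \<le> Suc K"
  shows "T i - T' i \<le> norm (p 0 - p' 0) + norm (p i - p' i)"
proof -
  obtain j where j: "i = Suc j" "j \<le> K" using i by (cases i) auto
  have "0 \<le> (\<Sum>i\<le>j. (T' (Suc i) - T' i) * (norm (w i - w' i))\<^sup>2 / 2)"
    using X' j by (intro sum_nonneg) (auto simp: chain_def)
  moreover have "0 \<le> (\<Sum>i=1..j. norm (w i - w (i - 1)) * (norm (p i - p' i))\<^sup>2 / (2 * r))"
    using r_pos by (intro sum_nonneg) auto
  moreover have "(p (Suc j) - p' (Suc j)) \<bullet> w j \<le> norm (p (Suc j) - p' (Suc j))"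
    "- ((p 0 - p' 0) \<bullet> w 0) \<le> norm (p 0 - p' 0)"
    using abs_inner_unit[of "w j" "p (Suc j) - p' (Suc j)"] abs_inner_unit[of "w 0" "p 0 - p' 0"]
      X j unfolding chain_def by (smt (verit) le0)+
  ultimately show ?thesis using chain_identity[OF X X' j(2)] assms(3,4) unfolding j(1) by linarith
qed

lemma chain_time:
  assumes X: "chain K T p w c" and X': "chain K T' p' w' c" and "T 0 = 0" "T' 0 = 0"
    and i: "1 \<le> i" "i \<le> Suc K"
  shows "\<bar>T i - T' i\<bar> \<le> norm (p 0 - p' 0) + norm (p i - p' i)"
  using chain_time_le[OF X X' assms(3,4) i] chain_time_le[OF X' X assms(4,3) i]
  by (simp add: norm_minus_commute)

text \<open>The factor \<open>max 0 (t - T i)\<close> lets the sum run over all collisions,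
  whichever leg contains \<open>t\<close>, so that two chains can be subtracted term by term. The
  directions \<open>D\<close> are arbitrary because the formula is also applied to a hybrid of two
  chains.\<close>

lemma position_formula:
  fixes R D :: "nat \<Rightarrow> point"
  assumes "chain K T p w c" "l \<le> K" "T l \<le> t" "t \<le> T (Suc l)"
    and R: "\<And>i. i < l \<Longrightarrow> R (Suc i) = R i + (T (Suc i) - T i) *\<^sub>R D i"
  shows "R l + (t - T l) *\<^sub>R D l =
    R 0 + (t - T 0) *\<^sub>R D 0 + (\<Sum>i=1..K. max 0 (t - T i) *\<^sub>R (D i - D (i - 1)))"
proof -
  have "(\<Sum>i=1..K. max 0 (t - T i) *\<^sub>R (D i - D (i - 1))) = (\<Sum>i=1..l. max 0 (t - T i) *\<^sub>R (D i - D (i - 1)))"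
  proof (rule sum.mono_neutral_right)
    show "\<forall>i\<in>{1..K} - {1..l}. max 0 (t - T i) *\<^sub>R (D i - D (i - 1)) = 0"
    proof
      fix i assume "i \<in> {1..K} - {1..l}"
      then have "T (Suc l) \<le> T i" by (intro chain_mono[OF assms(1)]) auto
      then show "max 0 (t - T i) *\<^sub>R (D i - D (i - 1)) = 0" using assms(4) by simp
    qed
  qed (use assms in auto)
  also have "\<dots> = (\<Sum>i=1..l. (t - T i) *\<^sub>R (D i - D (i - 1)))"
  proof (rule sum.cong)
    fix i assume "i \<in> {1..l}"
    then have "T i \<le> T l" using assms(2) by (intro chain_mono[OF assms(1)]) auto
    then show "max 0 (t - T i) *\<^sub>R (D i - D (i - 1)) = (t - T i) *\<^sub>R (D i - D (i - 1))" using assms(3) by simp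
  qed simp
  finally show ?thesis using broken_line[of l R T D t, OF R] by simp
qed

end

text \<open>The chains share their centres and duration, and their phase points are close at both
  ends. The bound \<open>d\<close> concerns only legs between two collisions; the first and the last
  leg may be arbitrarily short.\<close>

locale chain_pair = scatterers +
  fixes K :: nat and T T' :: "nat \<Rightarrow> real" and p p' w w' c :: "nat \<Rightarrow> point" and H \<delta> d :: real
  assumes X: "chain K T p w c" and X': "chain K T' p' w' c"
    and T0: "T 0 = 0" "T' 0 = 0" and TH: "T (Suc K) = H" "T' (Suc K) = H"
    and ends: "norm (p 0 - p' 0) \<le> \<delta>" "norm (p (Suc K) - p' (Suc K)) \<le> \<delta>"
      "norm (w 0 - w' 0) \<le> \<delta>" "norm (w K - w' K) \<le> \<delta>"
    and d: "0 < d" "\<And>i. \<lbrakk>1 \<le> i; i < K\<rbrakk> \<Longrightarrow> d \<le> T' (Suc i) - T' i"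
begin

abbreviation kick :: "nat \<Rightarrow> real" where "kick i \<equiv> norm (w i - w (i - 1))"

text \<open>On the two outer legs velocities are close by assumption, which gives
  \<open>\<delta>\<close>; on the others a single term of \<open>sums_le\<close>, with duration at
  least \<open>d\<close>, gives the square root.\<close>

definition \<mu> :: real where "\<mu> = max \<delta> (sqrt (4 * \<delta> / d))"

lemma \<delta>_nonneg: "0 \<le> \<delta>" using ends(1) norm_ge_zero order_trans by blast

lemma sums_le:
  "(\<Sum>i\<le>K. (T' (Suc i) - T' i) * (norm (w i - w' i))\<^sup>2 / 2)
     + (\<Sum>i=1..K. kick i * (norm (p i - p' i))\<^sup>2 / (2 * r)) \<le> 2 * \<delta>"
proof -
  have "(p (Suc K) - p' (Suc K)) \<bullet> w K \<le> norm (p (Suc K) - p' (Suc K))"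
    "- ((p 0 - p' 0) \<bullet> w 0) \<le> norm (p 0 - p' 0)"
    using abs_inner_unit[of "w K" "p (Suc K) - p' (Suc K)"] abs_inner_unit[of "w 0" "p 0 - p' 0"]
      X unfolding chain_def by (smt (verit) le0 order_refl)+
  then show ?thesis unfolding chain_identity[OF X X' order_refl] using T0 TH ends by linarith
qed

lemma velocity_term_nonneg: "i \<le> K \<Longrightarrow> 0 \<le> (T' (Suc i) - T' i) * (norm (w i - w' i))\<^sup>2 / 2"
  using X' by (auto simp: chain_def)

lemma kick_term_nonneg: "0 \<le> kick i * (norm (p i - p' i))\<^sup>2 / (2 * r)"
  using r_pos by auto

lemma velocity_close:
  assumes "i \<le> K" shows "norm (w i - w' i) \<le> \<mu>"
proof (cases "i = 0 \<or> i = K")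
  case True
  then show ?thesis using ends by (auto simp: \<mu>_def)
next
  case False
  then have i: "1 \<le> i" "i < K" using assms by auto
  have "(T' (Suc i) - T' i) * (norm (w i - w' i))\<^sup>2 / 2 \<le> (\<Sum>i\<le>K. (T' (Suc i) - T' i) * (norm (w i - w' i))\<^sup>2 / 2)"
    using assms velocity_term_nonneg by (intro member_le_sum) auto
  also have "\<dots> \<le> 2 * \<delta>"
    using sums_le sum_nonneg[of "{1..K}" "\<lambda>i. kick i * (norm (p i - p' i))\<^sup>2 / (2 * r)"] kick_term_nonneg
    by force
  finally have "(T' (Suc i) - T' i) * (norm (w i - w' i))\<^sup>2 \<le> 4 * \<delta>" by simp
  moreover have "d * (norm (w i - w' i))\<^sup>2 \<le> (T' (Suc i) - T' i) * (norm (w i - w' i))\<^sup>2"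
    using d(2)[OF i] by (intro mult_right_mono) auto
  ultimately have "(norm (w i - w' i))\<^sup>2 \<le> 4 * \<delta> / d" using d(1) by (simp add: field_simps)
  then have "norm (w i - w' i) \<le> sqrt (4 * \<delta> / d)" by (rule real_le_rsqrt)
  then show ?thesis by (simp add: \<mu>_def)
qed

lemma kick_close:
  assumes "1 \<le> i" "i \<le> K" shows "kick i * (norm (p i - p' i))\<^sup>2 \<le> 4 * r * \<delta>"
proof -
  have "kick i * (norm (p i - p' i))\<^sup>2 / (2 * r) \<le> (\<Sum>i=1..K. kick i * (norm (p i - p' i))\<^sup>2 / (2 * r))"
    using assms kick_term_nonneg by (intro member_le_sum) auto
  also have "\<dots> \<le> 2 * \<delta>"
    using sums_le sum_nonneg[of "{..K}" "\<lambda>i. (T' (Suc i) - T' i) * (norm (w i - w' i))\<^sup>2 / 2"] velocity_term_nonneg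
    by force
  finally show ?thesis using r_pos by (simp add: field_simps)
qed

lemma time_close: "\<lbrakk>1 \<le> i; i \<le> K\<rbrakk> \<Longrightarrow> \<bar>T i - T' i\<bar> \<le> \<delta> + norm (p i - p' i)"
  using chain_time[OF X X' T0, of i] ends(1) by simp

lemma kick_le_2: "1 \<le> i \<Longrightarrow> i \<le> K \<Longrightarrow> kick i \<le> 2"
  using X norm_triangle_ineq4[of "w i" "w (i - 1)"] by (auto simp: chain_def)

text \<open>A nearly grazing collision can happen at noticeably different times on the two chains.
  Its kick is then small, and only the product of kick and time difference enters the
  position.\<close>

lemma kick_time:
  assumes "1 \<le> i" "i \<le> K" shows "kick i * \<bar>T i - T' i\<bar> \<le> 2 * \<delta> + sqrt (8 * r * \<delta>)"
proof -
  have "(kick i * norm (p i - p' i))\<^sup>2 = kick i * (kick i * (norm (p i - p' i))\<^sup>2)"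
    by (simp add: power2_eq_square)
  also have "\<dots> \<le> 2 * (4 * r * \<delta>)"
    using kick_le_2[OF assms] kick_close[OF assms] by (intro mult_mono[of "kick i" 2]) auto
  finally have "kick i * norm (p i - p' i) \<le> sqrt (8 * r * \<delta>)" by (intro real_le_rsqrt) simp
  moreover have "kick i * \<delta> \<le> 2 * \<delta>" using kick_le_2[OF assms] \<delta>_nonneg by (intro mult_right_mono)
  moreover have "kick i * \<bar>T i - T' i\<bar> \<le> kick i * (\<delta> + norm (p i - p' i))"
    using time_close[OF assms] by (intro mult_left_mono) auto
  ultimately show ?thesis by (simp add: algebra_simps)
qed

lemma position_close:
  assumes l: "l \<le> K" "T l \<le> t" "t \<le> T (Suc l)" and l': "l' \<le> K" "T' l' \<le> t" "t \<le> T' (Suc l')"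
  shows "norm (p l + (t - T l) *\<^sub>R w l - (p' l' + (t - T' l') *\<^sub>R w' l'))
    \<le> \<delta> + H * \<mu> + real K * (2 * \<delta> + sqrt (8 * r * \<delta>))"
proof -
  have step: "p (Suc i) = p i + (T (Suc i) - T i) *\<^sub>R w i" "p' (Suc i) = p' i + (T' (Suc i) - T' i) *\<^sub>R w' i"
    "T' i \<le> T' (Suc i)" if "i \<le> K" for i
    using X X' that by (auto simp: chain_def)
  \<comment> \<open>A hybrid path with the directions of the first chain and the collision times of
    the second. Apart from the initial point it differs from the second only in velocities and from
    the first only in times.\<close>
  define R where "R = rec_nat (p 0) (\<lambda>i x. x + (T' (Suc i) - T' i) *\<^sub>R w i)"
  have R: "R 0 = p 0" "R (Suc i) = R i + (T' (Suc i) - T' i) *\<^sub>R w i" for i by (simp_all add: R_def)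
  have Rclose: "norm (R i - p' i) \<le> \<delta> + (T' i - T' 0) * \<mu>" if "i \<le> K" for i
    using that
  proof (induction i)
    case (Suc i)
    have "R (Suc i) - p' (Suc i) = (R i - p' i) + (T' (Suc i) - T' i) *\<^sub>R (w i - w' i)"
      using step(2)[of i] R(2)[of i] Suc.prems by (simp add: scaleR_diff_right)
    then have "norm (R (Suc i) - p' (Suc i)) \<le> norm (R i - p' i) + (T' (Suc i) - T' i) * norm (w i - w' i)"
      using norm_triangle_ineq[of "R i - p' i" "(T' (Suc i) - T' i) *\<^sub>R (w i - w' i)"] step(3)[of i] Suc.prems by simp
    also have "\<dots> \<le> (\<delta> + (T' i - T' 0) * \<mu>) + (T' (Suc i) - T' i) * \<mu>"
      using Suc step(3)[of i] velocity_close[of i] by (intro add_mono mult_left_mono) auto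
    finally show ?case by (simp add: algebra_simps)
  qed (use R ends in simp)
  let ?x = "p l + (t - T l) *\<^sub>R w l" let ?y = "R l' + (t - T' l') *\<^sub>R w l'"
  let ?x' = "p' l' + (t - T' l') *\<^sub>R w' l'"
  have yx: "?y - ?x' = (R l' - p' l') + (t - T' l') *\<^sub>R (w l' - w' l')" by (simp add: algebra_simps)
  have "norm (?y - ?x') \<le> norm (R l' - p' l') + (t - T' l') * norm (w l' - w' l')"
    unfolding yx using norm_triangle_ineq[of "R l' - p' l'" "(t - T' l') *\<^sub>R (w l' - w' l')"] l' by simp
  also have "\<dots> \<le> (\<delta> + (T' l' - T' 0) * \<mu>) + (t - T' l') * \<mu>"
    using Rclose[OF l'(1)] velocity_close[OF l'(1)] l' by (intro add_mono mult_left_mono) auto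
  also have "\<dots> = \<delta> + t * \<mu>" using T0 by (simp add: algebra_simps)
  also have "\<dots> \<le> \<delta> + H * \<mu>"
  proof -
    have "t \<le> H" using l'(3) chain_mono[OF X', of "Suc l'" "Suc K"] l'(1) TH by auto
    moreover have "0 \<le> \<mu>" using \<delta>_nonneg by (simp add: \<mu>_def)
    ultimately show ?thesis by (simp add: mult_right_mono)
  qed
  finally have 1: "norm (?y - ?x') \<le> \<delta> + H * \<mu>" .
  have x: "?x = p 0 + (t - T 0) *\<^sub>R w 0 + (\<Sum>i=1..K. max 0 (t - T i) *\<^sub>R (w i - w (i - 1)))"
    using step l by (intro position_formula[OF X]) auto
  have y: "?y = p 0 + (t - T' 0) *\<^sub>R w 0 + (\<Sum>i=1..K. max 0 (t - T' i) *\<^sub>R (w i - w (i - 1)))"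
    using R l' position_formula[OF X', of l' t R w] by simp
  have "?x - ?y = (\<Sum>i=1..K. (max 0 (t - T i) - max 0 (t - T' i)) *\<^sub>R (w i - w (i - 1)))"
    unfolding x y using T0 by (simp add: scaleR_diff_left sum_subtractf)
  also have "norm \<dots> \<le> (\<Sum>i=1..K. norm ((max 0 (t - T i) - max 0 (t - T' i)) *\<^sub>R (w i - w (i - 1))))"
    by (rule norm_sum)
  also have "\<dots> \<le> (\<Sum>i=1..K. 2 * \<delta> + sqrt (8 * r * \<delta>))"
  proof (rule sum_mono)
    fix i assume i: "i \<in> {1..K}"
    have "norm ((max 0 (t - T i) - max 0 (t - T' i)) *\<^sub>R (w i - w (i - 1))) \<le> \<bar>T i - T' i\<bar> * kick i"
      unfolding norm_scaleR by (intro mult_right_mono) (auto simp: max_def)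
    then show "norm ((max 0 (t - T i) - max 0 (t - T' i)) *\<^sub>R (w i - w (i - 1))) \<le> 2 * \<delta> + sqrt (8 * r * \<delta>)"
      using kick_time[of i] i by (simp add: mult.commute)
  qed
  also have "\<dots> = real K * (2 * \<delta> + sqrt (8 * r * \<delta>))" by simp
  finally have 2: "norm (?x - ?y) \<le> real K * (2 * \<delta> + sqrt (8 * r * \<delta>))" .
  have "norm (?x - ?x') \<le> norm (?x - ?y) + norm (?y - ?x')"
    using dist_triangle[of ?x ?x' ?y] unfolding dist_norm .
  then show ?thesis using 1 2 by linarith
qed

lemma big_kick:
  assumes i: "1 \<le> i" "i \<le> K" and \<eta>: "0 < \<eta>" "\<eta> < kick i"
  shows "norm (p i - p' i) \<le> sqrt (4 * r * \<delta> / \<eta>)"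
proof -
  have "\<eta> * (norm (p i - p' i))\<^sup>2 \<le> kick i * (norm (p i - p' i))\<^sup>2" using \<eta> by (intro mult_right_mono) auto
  then have "(norm (p i - p' i))\<^sup>2 \<le> 4 * r * \<delta> / \<eta>"
    using kick_close[OF i] \<eta> by (simp add: field_simps)
  then show ?thesis by (rule real_le_rsqrt)
qed

text \<open>Near a large kick the orbits may be on different sides of it, so the velocity is
  compared with those before and after the collision; the position is close to the collision point
  either way.\<close>

lemma close_at_big_kick:
  assumes i: "1 \<le> i" "i \<le> K" and \<eta>: "0 < \<eta>" "\<eta> < kick i"
    and \<rho>: "\<rho> = sqrt (4 * r * \<delta> / \<eta>)" and near: "\<bar>t - T i\<bar> \<le> \<delta> + \<rho>" and small: "2 * (\<delta> + \<rho>) < d"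
    and l': "l' \<le> K" "T' l' \<le> t" "t < T' (Suc l')"
  shows "norm (p' l' + (t - T' l') *\<^sub>R w' l' - p i) \<le> 2 * (\<delta> + \<rho>) + \<rho>"
    and "norm (w' l' - w (i - 1)) \<le> \<mu> \<or> norm (w' l' - w i) \<le> \<mu>"
proof -
  have e: "norm (p i - p' i) \<le> \<rho>" using big_kick[OF i \<eta>] \<rho> by simp
  then have "\<bar>T i - T' i\<bar> \<le> \<delta> + \<rho>" using time_close[OF i] by linarith
  then have near': "\<bar>t - T' i\<bar> \<le> 2 * (\<delta> + \<rho>)" 
    using near abs_triangle_ineq[of "t - T i" "T i - T' i"] by simp
  \<comment> \<open>A leg between two collisions lasts longer than the uncertainty
    \<open>2 * (\<delta> + \<rho>)\<close> of the collision time, so \<open>t\<close> cannot lie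
    beyond the two legs that meet at collision \<open>i\<close>.\<close>
  have "\<not> l' > i"
  proof
    assume "l' > i"
    then have "T' (Suc i) \<le> T' l'" using l' by (intro chain_mono[OF X']) auto
    then show False using d(2)[of i] i l' \<open>l' > i\<close> near' small by auto
  qed
  moreover have "\<not> Suc l' < i"
  proof
    assume *: "Suc l' < i"
    then have "T' (Suc l') \<le> T' (i - 1)" using i by (intro chain_mono[OF X']) auto
    moreover have "d \<le> T' (Suc (i - 1)) - T' (i - 1)" using * i by (intro d(2)) auto
    ultimately show False using i l' near' small by auto
  qed
  ultimately have cases: "l' = i \<or> l' = i - 1" using i by auto
  have x': "p' l' + (t - T' l') *\<^sub>R w' l' = p' i + (t - T' i) *\<^sub>R w' l'"
  proof (cases "l' = i")
    case False
    then have "Suc l' = i" using cases i by auto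
    then have "p' i = p' l' + (T' i - T' l') *\<^sub>R w' l'" using X' l' by (auto simp: chain_def)
    then show ?thesis by (simp add: algebra_simps)
  qed simp
  have "norm (w' l') = 1" using X' l' by (auto simp: chain_def)
  then have "norm ((t - T' i) *\<^sub>R w' l') \<le> 2 * (\<delta> + \<rho>)" using near' by simp
  then have "norm ((t - T' i) *\<^sub>R w' l' - (p i - p' i)) \<le> 2 * (\<delta> + \<rho>) + \<rho>"
    using e norm_triangle_ineq4[of "(t - T' i) *\<^sub>R w' l'" "p i - p' i"] by linarith
  then show "norm (p' l' + (t - T' l') *\<^sub>R w' l' - p i) \<le> 2 * (\<delta> + \<rho>) + \<rho>"
    unfolding x' by (simp add: algebra_simps)
  show "norm (w' l' - w (i - 1)) \<le> \<mu> \<or> norm (w' l' - w i) \<le> \<mu>"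
    using cases velocity_close[OF l'(1)] by (metis norm_minus_commute)
qed

text \<open>If the orbits are on different legs at time \<open>t\<close>, then \<open>t\<close>
  separates the two times of every collision in between. None of these can have a large kick, so the
  directions differ by at most \<open>K\<close> kicks of size at most \<open>\<eta>\<close>.\<close>

lemma close_away_from_big_kicks:
  assumes \<eta>: "0 < \<eta>" and \<rho>: "\<rho> = sqrt (4 * r * \<delta> / \<eta>)"
    and away: "\<And>i. \<lbrakk>1 \<le> i; i \<le> K; \<eta> < kick i\<rbrakk> \<Longrightarrow> \<delta> + \<rho> < \<bar>t - T i\<bar>"
    and l: "l \<le> K" "T l \<le> t" "t < T (Suc l)" and l': "l' \<le> K" "T' l' \<le> t" "t < T' (Suc l')"
  shows "norm (w l - w' l') \<le> real K * \<eta> + \<mu>"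
proof -
  have small: "kick i \<le> \<eta>" if i: "1 \<le> i" "i \<le> K" "\<bar>t - T i\<bar> \<le> \<bar>T i - T' i\<bar>" for i
  proof (rule ccontr)
    assume "\<not> ?thesis"
    then have k: "\<eta> < kick i" by simp
    have "\<bar>T i - T' i\<bar> \<le> \<delta> + \<rho>" using time_close[OF i(1,2)] big_kick[OF i(1,2) \<eta> k] \<rho> by linarith
    then show False using away[OF i(1,2) k] i(3) by linarith
  qed
  have bound: "norm (w b - w a) \<le> real K * \<eta>" if "a \<le> b" "b \<le> K"
    "\<And>i. \<lbrakk>a < i; i \<le> b\<rbrakk> \<Longrightarrow> \<bar>t - T i\<bar> \<le> \<bar>T i - T' i\<bar>" for a b
  proof -
    have "norm (w b - w a) \<le> (\<Sum>i=Suc a..b. kick i)" using telescope_bound that by blast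
    also have "\<dots> \<le> (\<Sum>i=Suc a..b. \<eta>)" using that small by (intro sum_mono) auto
    also have "\<dots> = real (b - a) * \<eta>" by simp
    also have "\<dots> \<le> real K * \<eta>" using that \<eta> by (intro mult_right_mono) auto
    finally show ?thesis .
  qed
  have "norm (w l - w l') \<le> real K * \<eta>"
  proof (cases "l \<le> l'")
    case True
    have "norm (w l' - w l) \<le> real K * \<eta>"
    proof (rule bound[OF True l'(1)])
      fix i assume i: "l < i" "i \<le> l'"
      have "T' i \<le> T' l'" "T (Suc l) \<le> T i" using i l' by (auto intro: chain_mono[OF X'] chain_mono[OF X])
      then show "\<bar>t - T i\<bar> \<le> \<bar>T i - T' i\<bar>" using l l' by linarith
    qed
    then show ?thesis by (simp add: norm_minus_commute)
  next
    case False
    show ?thesis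
    proof (rule bound)
      fix i assume i: "l' < i" "i \<le> l"
      have "T i \<le> T l" "T' (Suc l') \<le> T' i" using i l by (auto intro: chain_mono[OF X'] chain_mono[OF X])
      then show "\<bar>t - T i\<bar> \<le> \<bar>T i - T' i\<bar>" using l l' by linarith
    qed (use False l in auto)
  qed
  then show ?thesis using velocity_close[OF l'(1)] norm_triangle_ineq[of "w l - w l'" "w l' - w' l'"] by simp
qed

end

section \<open>Collision sequences\<close>

context scatterers begin

definition center :: "point \<Rightarrow> point" where
  "center q = (SOME c. c \<in> C \<and> dist c q = r)"

text \<open>Grazing contacts leave \<open>u t = v t\<close> and are omitted, so nearby orbits need
  not agree about them. The interval is open on the left and closed on the right so that consecutive
  windows share no collision and miss none.\<close>

definition breaks :: "(real \<Rightarrow> point) \<Rightarrow> (real \<Rightarrow> point) \<Rightarrow> real \<Rightarrow> real \<Rightarrow> real set" where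
  "breaks u v a b = {t. a < t \<and> t \<le> b \<and> u t \<noteq> v t}"

definition code :: "(real \<Rightarrow> point) \<Rightarrow> (real \<Rightarrow> point) \<Rightarrow> (real \<Rightarrow> point) \<Rightarrow> real \<Rightarrow> real \<Rightarrow> point list" where
  "code q u v a b = map (\<lambda>t. center (q t)) (sorted_list_of_set (breaks u v a b))"

lemma center_eq: "\<lbrakk>c \<in> C; dist c q = r\<rbrakk> \<Longrightarrow> center q = c"
  unfolding center_def by (rule some_equality) (auto intro: contact_unique)

text \<open>The inequalities are strict because a tangential reflection would leave the velocity
  unchanged.\<close>

lemma collision:
  assumes "admissible q u v" "u \<noteq> v"
  shows "center q \<in> C" "dist (center q) q = r" "(q - center q) \<bullet> u < 0" "(q - center q) \<bullet> v > 0"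
    "v = reflect (center q) q u" "v - u = (norm (v - u) / r) *\<^sub>R (q - center q)"
proof -
  have "\<exists>c\<in>C. dist c q = r" using assms unfolding admissible_def by metis
  then obtain c where "c \<in> C" "dist c q = r" ..
  then have c: "center q \<in> C" "dist (center q) q = r" using center_eq by auto
  then show "center q \<in> C" "dist (center q) q = r" by auto
  have *: "(q - center q) \<bullet> u \<le> 0" "v = reflect (center q) q u"
    using assms c unfolding admissible_def by blast+
  show "v = reflect (center q) q u" by (rule *)
  have "(q - center q) \<bullet> u \<noteq> 0" using reflect_tangent * assms(2) by metis
  then show neg: "(q - center q) \<bullet> u < 0" using * by simp
  then show "(q - center q) \<bullet> v > 0" unfolding *(2) using inner_reflect contact_ne[OF c(2)] by simp
  have n: "norm (q - center q) = r" using c by (simp add: dist_norm norm_minus_commute)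
  have d: "v - u = (- 2 * ((q - center q) \<bullet> u) / r\<^sup>2) *\<^sub>R (q - center q)"
    unfolding *(2) by (rule reflect_diff[OF c(2) r_pos])
  have "norm (v - u) = (- 2 * ((q - center q) \<bullet> u) / r\<^sup>2) * r"
    unfolding d norm_scaleR n using neg r_pos by (simp add: divide_nonpos_pos)
  then have "norm (v - u) / r = - 2 * ((q - center q) \<bullet> u) / r\<^sup>2" using r_pos by simp
  then show "v - u = (norm (v - u) / r) *\<^sub>R (q - center q)" using d by simp
qed

lemma trajectory_admissible: "trajectory q u v \<Longrightarrow> admissible (q t) (u t) (v t)"
  by (simp add: trajectory_def)

lemma trajectory_right:
  assumes "trajectory q u v"
  obtains \<epsilon> where "\<epsilon> > 0"
    "\<And>s. \<lbrakk>0 < s; s < \<epsilon>\<rbrakk> \<Longrightarrow> q (t + s) = q t + s *\<^sub>R v t \<and> u (t + s) = v t \<and> v (t + s) = v t"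
proof -
  obtain \<epsilon> where "\<epsilon> > 0" "\<forall>s\<in>{0<..<\<epsilon>}. q (t + s) = q t + s *\<^sub>R v t \<and> u (t + s) = v t \<and> v (t + s) = v t"
    using assms unfolding trajectory_def motion_right_def by blast
  then show thesis by (intro that[of \<epsilon>]) simp_all
qed

lemma trajectory_left:
  assumes "trajectory q u v"
  obtains \<epsilon> where "\<epsilon> > 0"
    "\<And>s. \<lbrakk>0 < s; s < \<epsilon>\<rbrakk> \<Longrightarrow> q (t - s) = q t - s *\<^sub>R u t \<and> u (t - s) = u t \<and> v (t - s) = u t"
proof -
  obtain \<epsilon> where "\<epsilon> > 0" "\<forall>s\<in>{0<..<\<epsilon>}. q (t - s) = q t - s *\<^sub>R u t \<and> u (t - s) = u t \<and> v (t - s) = u t"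
    using assms unfolding trajectory_def motion_left_def by blast
  then show thesis by (intro that[of \<epsilon>]) simp_all
qed

lemma finite_breaks:
  assumes X: "trajectory q u v" shows "finite (breaks u v a b)"
proof -
  have "\<not> z islimpt {t. u t \<noteq> v t}" for z
  proof -
    obtain \<epsilon>1 where 1: "\<epsilon>1 > 0" "\<And>s. \<lbrakk>0 < s; s < \<epsilon>1\<rbrakk> \<Longrightarrow> q (z + s) = q z + s *\<^sub>R v z \<and> u (z + s) = v z \<and> v (z + s) = v z"
      using trajectory_right[OF X, of z] by blast
    obtain \<epsilon>2 where 2: "\<epsilon>2 > 0" "\<And>s. \<lbrakk>0 < s; s < \<epsilon>2\<rbrakk> \<Longrightarrow> q (z - s) = q z - s *\<^sub>R u z \<and> u (z - s) = u z \<and> v (z - s) = u z"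
      using trajectory_left[OF X, of z] by blast
    have "u t = v t" if "t \<noteq> z" "dist t z < min \<epsilon>1 \<epsilon>2" for t
    proof (cases "t > z")
      case True
      then show ?thesis using 1(2)[of "t - z"] that by (auto simp: dist_real_def)
    next
      case False
      then show ?thesis using 2(2)[of "z - t"] that by (auto simp: dist_real_def)
    qed
    moreover have "0 < min \<epsilon>1 \<epsilon>2" using 1 2 by simp
    ultimately show ?thesis unfolding islimpt_approachable by blast
  qed
  then have "finite ({a..b} \<inter> {t. u t \<noteq> v t})" by (intro finite_not_islimpt_in_compact) auto
  then show ?thesis by (rule finite_subset[rotated]) (auto simp: breaks_def)
qed

lemma straight:
  assumes X: "trajectory q u v" and ab: "a < b" and nb: "\<And>t. \<lbrakk>a < t; t < b\<rbrakk> \<Longrightarrow> u t = v t"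
  shows "\<lbrakk>a \<le> t; t \<le> b\<rbrakk> \<Longrightarrow> q t = q a + (t - a) *\<^sub>R v a" "\<lbrakk>a \<le> t; t < b\<rbrakk> \<Longrightarrow> v t = v a" "u b = v a"
proof -
  \<comment> \<open>The velocity and the position extrapolated to time 0 determine a free motion;
    this pair is locally constant, hence constant on the open interval.\<close>
  define f where "f t = (v t, q t - t *\<^sub>R v t)" for t
  have loc: "\<forall>z\<in>{a<..<b}. eventually (\<lambda>t. f z = f t) (at z within {a<..<b})"
  proof
    fix z assume z: "z \<in> {a<..<b}"
    obtain \<epsilon>1 where 1: "\<epsilon>1 > 0" "\<And>s. \<lbrakk>0 < s; s < \<epsilon>1\<rbrakk> \<Longrightarrow> q (z + s) = q z + s *\<^sub>R v z \<and> u (z + s) = v z \<and> v (z + s) = v z"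
      using trajectory_right[OF X, of z] by blast
    obtain \<epsilon>2 where 2: "\<epsilon>2 > 0" "\<And>s. \<lbrakk>0 < s; s < \<epsilon>2\<rbrakk> \<Longrightarrow> q (z - s) = q z - s *\<^sub>R u z \<and> u (z - s) = u z \<and> v (z - s) = u z"
      using trajectory_left[OF X, of z] by blast
    have "f z = f t" if t: "t \<noteq> z" "dist t z < min \<epsilon>1 \<epsilon>2" for t
    proof (cases "t > z")
      case True
      then have "q t = q z + (t - z) *\<^sub>R v z" "v t = v z" using 1(2)[of "t - z"] t by (auto simp: dist_real_def)
      then show ?thesis by (simp add: f_def scaleR_diff_left)
    next
      case False
      then have "q t = q z - (z - t) *\<^sub>R u z" "v t = u z" using 2(2)[of "z - t"] t by (auto simp: dist_real_def)
      then show ?thesis using nb z by (simp add: f_def scaleR_diff_left)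
    qed
    then show "eventually (\<lambda>t. f z = f t) (at z within {a<..<b})"
      unfolding eventually_at using 1 2 by (intro exI[of _ "min \<epsilon>1 \<epsilon>2"]) auto
  qed
  have const: "f s = f t" if "a < s" "s < b" "a < t" "t < b" for s t
    using connected_local_const[OF _ _ _ loc, of s t] that by simp
  obtain \<epsilon> where \<epsilon>: "\<epsilon> > 0" "\<And>s. \<lbrakk>0 < s; s < \<epsilon>\<rbrakk> \<Longrightarrow> q (a + s) = q a + s *\<^sub>R v a \<and> u (a + s) = v a \<and> v (a + s) = v a"
    using trajectory_right[OF X, of a] by blast
  define s where "s = min \<epsilon> (b - a) / 2"
  have s: "0 < s" "s < \<epsilon>" "a + s < b" using \<epsilon> ab by (auto simp: s_def min_def field_simps)
  have fa: "f (a + s) = (v a, q a - a *\<^sub>R v a)" using \<epsilon>(2)[OF s(1,2)] by (simp add: f_def scaleR_add_left)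
  have inner: "v t = v a" "q t = q a + (t - a) *\<^sub>R v a" if "a < t" "t < b" for t
  proof -
    have "f t = (v a, q a - a *\<^sub>R v a)" using const[of t "a + s"] that s fa by simp
    then show *: "v t = v a" and "q t = q a + (t - a) *\<^sub>R v a"
      by (auto simp: f_def scaleR_diff_left algebra_simps)
  qed
  obtain \<epsilon>' where \<epsilon>': "\<epsilon>' > 0" "\<And>s. \<lbrakk>0 < s; s < \<epsilon>'\<rbrakk> \<Longrightarrow> q (b - s) = q b - s *\<^sub>R u b \<and> u (b - s) = u b \<and> v (b - s) = u b"
    using trajectory_left[OF X, of b] by blast
  define s' where "s' = min \<epsilon>' (b - a) / 2"
  have s': "0 < s'" "s' < \<epsilon>'" "a < b - s'" using \<epsilon>' ab by (auto simp: s'_def min_def field_simps)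
  show ub: "u b = v a" using \<epsilon>'(2)[OF s'(1,2)] inner[of "b - s'"] s' by simp
  have qb: "q b = q a + (b - a) *\<^sub>R v a"
    using \<epsilon>'(2)[OF s'(1,2)] inner[of "b - s'"] s' ub by (simp add: scaleR_diff_left algebra_simps)
  show "q t = q a + (t - a) *\<^sub>R v a" if "a \<le> t" "t \<le> b"
    using that inner[of t] qb by (cases "t = a \<or> t = b") auto
  show "v t = v a" if "a \<le> t" "t < b" using that inner[of t] by (cases "t = a") auto
qed

lemma flight_between_disks:
  assumes c: "c \<in> C" "dist c p = r" "c' \<in> C" "dist c' (p + l *\<^sub>R v) = r" and v: "norm v = 1"
    and out: "(p - c) \<bullet> v > 0" and l: "l > 0"
  shows "c' \<noteq> c" "h \<le> l"
proof -
  have "(dist c (p + l *\<^sub>R v))\<^sup>2 > r\<^sup>2"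
    unfolding dist_ray_sq[OF v] c(2) using out l by (simp add: add_pos_pos)
  then show ne: "c' \<noteq> c" using c(4) by auto
  have "g \<le> dist c c'" using separated ne c by blast
  also have "\<dots> \<le> dist c p + dist p (p + l *\<^sub>R v) + dist (p + l *\<^sub>R v) c'"
    by (meson add_mono dist_triangle order_refl order_trans)
  also have "\<dots> = 2 * r + l" using c v l by (simp add: dist_norm norm_minus_commute)
  finally show "h \<le> l" by (simp add: h_def)
qed

text \<open>The times 0 and \<open>H\<close> are artificial end points. A collision at
  \<open>H\<close> is counted and makes the last leg degenerate, one at 0 is not counted; in both
  cases \<open>v\<close> is the velocity after it.\<close>

lemma trajectory_chain:
  assumes X: "trajectory q u v" and H: "0 \<le> H"
  defines "ts \<equiv> sorted_list_of_set (breaks u v 0 H)"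
  defines "K \<equiv> length ts"
  defines "T \<equiv> \<lambda>i. if i = 0 then 0 else if i \<le> K then ts ! (i - 1) else H"
  shows "chain K T (\<lambda>i. q (T i)) (\<lambda>i. v (T i)) (\<lambda>i. code q u v 0 H ! (i - 1))"
    and "T 0 = 0" "T (Suc K) = H"
    and "\<And>i. \<lbrakk>1 \<le> i; i < K\<rbrakk> \<Longrightarrow> h \<le> T (Suc i) - T i"
    and "\<And>t l. \<lbrakk>l \<le> K; T l \<le> t; t < T (Suc l)\<rbrakk> \<Longrightarrow> q t = q (T l) + (t - T l) *\<^sub>R v (T l) \<and> v t = v (T l)"
    and "\<And>i. \<lbrakk>1 \<le> i; i \<le> K\<rbrakk> \<Longrightarrow> u (T i) = v (T (i - 1))"
    and "v (T K) = v H"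
    and "\<And>t. \<lbrakk>0 \<le> t; t < H\<rbrakk> \<Longrightarrow> \<exists>l\<le>K. T l \<le> t \<and> t < T (Suc l)"
    and "\<And>i. \<lbrakk>1 \<le> i; i \<le> K\<rbrakk> \<Longrightarrow> center (q (T i)) = code q u v 0 H ! (i - 1) \<and> u (T i) \<noteq> v (T i)"
proof -
  have fin: "finite (breaks u v 0 H)" by (rule finite_breaks[OF X])
  have set: "set ts = breaks u v 0 H" and sorted: "sorted_wrt (<) ts" using fin by (auto simp: ts_def)
  have lt: "ts ! i < ts ! j" if "i < j" "j < K" for i j
    using sorted_wrt_nth_less[OF sorted that(1)] that by (simp add: K_def)
  have lele: "ts ! i \<le> ts ! j" if "i \<le> j" "j < K" for i j
    using lt[of i j] that by (cases "i = j") auto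
  have elem: "ts ! i \<in> breaks u v 0 H" if "i < K" for i using set that nth_mem by (auto simp: K_def)
  have ex_nth: "\<exists>m<K. t = ts ! m" if "t \<in> breaks u v 0 H" for t
    using that unfolding set[symmetric] in_set_conv_nth K_def by metis
  have Tb: "T i \<in> breaks u v 0 H" if "1 \<le> i" "i \<le> K" for i using that elem[of "i - 1"] by (auto simp: T_def)
  show T0: "T 0 = 0" and TH: "T (Suc K) = H" by (auto simp: T_def)
  have less: "T i < T (Suc i)" if "i < K" for i
  proof (cases "i = 0")
    case True
    then show ?thesis using Tb[of 1] that by (simp add: T0 breaks_def)
  next
    case False
    then show ?thesis using that lt[of "i - 1" i] by (simp add: T_def)
  qed
  have le: "T i \<le> T (Suc i)" if "i \<le> K" for i
  proof (cases "i = K")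
    case True
    then show ?thesis using TH Tb[of K] T0 H by (cases "K = 0") (auto simp: breaks_def)
  next
    case False
    then show ?thesis using less[of i] that by simp
  qed
  have nobreak: "u t = v t" if i: "i \<le> K" and t: "T i < t" "t < T (Suc i)" for i t
  proof (rule ccontr)
    assume ne: "u t \<noteq> v t"
    have "0 \<le> T i" using Tb[of i] i T0 by (cases "i = 0") (auto simp: breaks_def)
    moreover have "T (Suc i) \<le> H" using Tb[of "Suc i"] i TH by (cases "i = K") (auto simp: breaks_def)
    ultimately have "t \<in> breaks u v 0 H" using ne t by (auto simp: breaks_def)
    then obtain m where m: "m < K" "t = ts ! m" using ex_nth by blast
    have "\<not> m < i"
    proof
      assume "m < i"
      then have "ts ! m \<le> ts ! (i - 1)" using lele[of m "i - 1"] i by simp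
      then show False using t m \<open>m < i\<close> i by (auto simp: T_def)
    qed
    moreover have "\<not> i \<le> m"
    proof
      assume "i \<le> m"
      then have "ts ! i \<le> ts ! m" using lele[of i m] m by simp
      then show False using t m \<open>i \<le> m\<close> by (auto simp: T_def)
    qed
    ultimately show False by simp
  qed
  have str: "q t = q (T i) + (t - T i) *\<^sub>R v (T i)" if "i \<le> K" "T i \<le> t" "t \<le> T (Suc i)" for i t
  proof (cases "T i < T (Suc i)")
    case True
    from straight(1)[OF X True] nobreak that show ?thesis by blast
  next
    case False
    then have "t = T i" using that by simp
    then show ?thesis by simp
  qed
  have strv: "v t = v (T i)" if "i \<le> K" "T i \<le> t" "t < T (Suc i)" for i t
    by (rule straight(2)[OF X, of "T i" "T (Suc i)" t]) (use nobreak that in auto)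
  have stru: "u (T (Suc i)) = v (T i)" if "i \<le> K" "T i < T (Suc i)" for i
    using straight(3)[OF X that(2)] nobreak that by blast
  show "q t = q (T l) + (t - T l) *\<^sub>R v (T l) \<and> v t = v (T l)" if "l \<le> K" "T l \<le> t" "t < T (Suc l)" for t l
    using str[OF that(1,2) less_imp_le[OF that(3)]] strv[OF that] by (rule conjI)
  show uT: "u (T i) = v (T (i - 1))" if "1 \<le> i" "i \<le> K" for i
    using stru[of "i - 1"] less[of "i - 1"] that by simp
  have code: "code q u v 0 H ! (i - 1) = center (q (T i))" if "1 \<le> i" "i \<le> K" for i
    using that unfolding code_def ts_def[symmetric] by (simp add: T_def K_def)
  have coll: "u (T i) \<noteq> v (T i)" if "1 \<le> i" "i \<le> K" for i using Tb[OF that] by (simp add: breaks_def)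
  show "center (q (T i)) = code q u v 0 H ! (i - 1) \<and> u (T i) \<noteq> v (T i)" if "1 \<le> i" "i \<le> K" for i
    using code[OF that] coll[OF that] by (metis (no_types))
  show "v (T K) = v H"
  proof (cases "T K < H")
    case True
    then have "u H = v (T K)" using stru[of K] TH by simp
    moreover have "u H = v H"
    proof (rule ccontr)
      assume "u H \<noteq> v H"
      then have "H \<in> breaks u v 0 H" using True le[of 0] Tb[of K] T0 by (cases "K = 0") (auto simp: breaks_def)
      then obtain m where m: "m < K" "H = ts ! m" using ex_nth by blast
      then have "H \<le> ts ! (K - 1)" using lele[of m "K - 1"] by simp
      then show False using True m by (auto simp: T_def)
    qed
    ultimately show ?thesis by simp
  next
    case False
    then show ?thesis using le[of K] TH by simp
  qed
  show "chain K T (\<lambda>i. q (T i)) (\<lambda>i. v (T i)) (\<lambda>i. code q u v 0 H ! (i - 1))"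
    unfolding chain_def
  proof (intro conjI allI impI)
    fix i assume i: "i \<le> K"
    show "T i \<le> T (Suc i)" by (rule le[OF i])
    show "q (T (Suc i)) = q (T i) + (T (Suc i) - T i) *\<^sub>R v (T i)" using str[OF i le[OF i]] by simp
    show "norm (v (T i)) = 1" using trajectory_admissible[OF X] unfolding admissible_def by blast
  next
    fix i assume "1 \<le> i \<and> i \<le> K"
    then have i: "1 \<le> i" "i \<le> K" by auto
    note * = collision[OF trajectory_admissible[OF X] coll[OF i]]
    show "code q u v 0 H ! (i - 1) \<in> C" "dist (code q u v 0 H ! (i - 1)) (q (T i)) = r"
      unfolding code[OF i] using * by auto
    show "v (T i) - v (T (i - 1)) =
        (norm (v (T i) - v (T (i - 1))) / r) *\<^sub>R (q (T i) - code q u v 0 H ! (i - 1))"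
      unfolding code[OF i] uT[OF i, symmetric] by (rule *)
  qed
  show "h \<le> T (Suc i) - T i" if i: "1 \<le> i" "i < K" for i
  proof -
    have i': "1 \<le> Suc i" "Suc i \<le> K" using i by auto
    note 1 = collision[OF trajectory_admissible[OF X] coll[OF i(1) less_imp_le[OF i(2)]]]
    note 2 = collision[OF trajectory_admissible[OF X] coll[OF i']]
    have "q (T i) + (T (Suc i) - T i) *\<^sub>R v (T i) = q (T (Suc i))" using str[of i "T (Suc i)"] le[of i] i by simp
    moreover have "norm (v (T i)) = 1" using trajectory_admissible[OF X] unfolding admissible_def by blast
    ultimately show ?thesis using flight_between_disks(2)[OF 1(1,2) 2(1), of "T (Suc i) - T i" "v (T i)"]
      1(4) 2(2) less[OF i(2)] by simp
  qed
  show "\<exists>l\<le>K. T l \<le> t \<and> t < T (Suc l)" if t: "0 \<le> t" "t < H" for t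
  proof -
    define S where "S = {l. l \<le> K \<and> T l \<le> t}"
    have S: "finite S" "0 \<in> S" using t T0 by (auto simp: S_def)
    then have m: "Max S \<in> S" using Max_in by blast
    have "t < T (Suc (Max S))"
    proof (cases "Max S = K")
      case False
      then have "Suc (Max S) \<le> K" using m by (auto simp: S_def)
      moreover have "Suc (Max S) \<notin> S" using Max_ge[OF S(1)] by (meson not_less_eq_eq order_refl)
      ultimately show ?thesis by (auto simp: S_def)
    qed (use t TH in simp)
    then show ?thesis using m by (auto simp: S_def)
  qed
qed

lemma code_append:
  assumes X: "trajectory q u v" and "a \<le> b" "b \<le> c"
  shows "code q u v a c = code q u v a b @ code q u v b c"
proof -
  let ?s = sorted_list_of_set
  have "?s (breaks u v a c) = ?s (breaks u v a b) @ ?s (breaks u v b c)"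
  proof (rule sorted_distinct_set_unique)
    have "sorted_wrt (<) (?s (breaks u v a b) @ ?s (breaks u v b c))"
      unfolding sorted_wrt_append using finite_breaks[OF X] by (force simp: breaks_def)
    then show "sorted (?s (breaks u v a b) @ ?s (breaks u v b c))"
      "distinct (?s (breaks u v a b) @ ?s (breaks u v b c))" by (auto simp: strict_sorted_iff)
    show "set (?s (breaks u v a c)) = set (?s (breaks u v a b) @ ?s (breaks u v b c))"
      using finite_breaks[OF X] assms by (auto simp: breaks_def)
  qed auto
  then show ?thesis by (simp add: code_def)
qed

lemma code_shift:
  assumes X: "trajectory q u v"
  shows "code (\<lambda>t. q (t + a)) (\<lambda>t. u (t + a)) (\<lambda>t. v (t + a)) b c = code q u v (b + a) (c + a)"
proof -
  let ?s = sorted_list_of_set and ?B = "breaks (\<lambda>t. u (t + a)) (\<lambda>t. v (t + a)) b c"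
  have img: "breaks u v (b + a) (c + a) = (\<lambda>t. t + a) ` ?B"
  proof (intro set_eqI iffI)
    fix t assume "t \<in> breaks u v (b + a) (c + a)"
    then have "t - a \<in> ?B" by (auto simp: breaks_def)
    then show "t \<in> (\<lambda>t. t + a) ` ?B" by (intro image_eqI[of _ _ "t - a"]) auto
  qed (auto simp: breaks_def)
  have "?B = (\<lambda>t. t - a) ` breaks u v (b + a) (c + a)" unfolding img by (simp add: image_image)
  then have fin: "finite ?B" using finite_breaks[OF X] by simp
  have "?s (breaks u v (b + a) (c + a)) = map (\<lambda>t. t + a) (?s ?B)"
  proof (rule sorted_distinct_set_unique)
    have "sorted_wrt (<) (map (\<lambda>t. t + a) (?s ?B))" by (simp add: sorted_wrt_map)
    then show "sorted (map (\<lambda>t. t + a) (?s ?B))" "distinct (map (\<lambda>t. t + a) (?s ?B))"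
      by (auto simp: strict_sorted_iff)
    show "set (?s (breaks u v (b + a) (c + a))) = set (map (\<lambda>t. t + a) (?s ?B))"
      using finite_breaks[OF X] fin img by simp
  qed auto
  then show ?thesis by (simp add: code_def)
qed

end

section \<open>Shadowing a class of orbits by one phase point\<close>

context scatterers begin

text \<open>The order of the quantifiers matters: \<open>y\<close>, \<open>w1\<close> and
  \<open>w2\<close> serve all orbits with the same code and nearby ends. As \<open>w1\<close> and
  \<open>w2\<close> represent the same state at \<open>y\<close>, the whole class can be placed in
  one element of a cover at time \<open>t\<close>.\<close>

lemma trajectory_shadow:
  assumes X: "trajectory q u v" and H: "0 \<le> H" and t: "0 \<le> t" "t < H"
    and K: "K = length (code q u v 0 H)" and \<mu>: "\<mu> = max \<delta> (sqrt (4 * \<delta> / h))"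
    and \<eta>: "0 < \<eta>" and \<rho>: "\<rho> = sqrt (4 * r * \<delta> / \<eta>)" and \<delta>: "0 \<le> \<delta>"
    and small: "\<delta> + H * \<mu> + real K * (2 * \<delta> + sqrt (8 * r * \<delta>)) \<le> \<epsilon>" "real K * \<eta> + \<mu> \<le> \<epsilon>"
      "2 * (\<delta> + \<rho>) + \<rho> \<le> \<epsilon>" "2 * (\<delta> + \<rho>) < h"
  shows "\<exists>y w1 w2. y \<in> table \<and> norm w1 = 1 \<and>
    (w2 = w1 \<or> (\<exists>c\<in>C. dist c y = r \<and> w2 = reflect c y w1)) \<and>
    (\<forall>q' u' v'. trajectory q' u' v' \<and> code q' u' v' 0 H = code q u v 0 H \<and>
       norm (q 0 - q' 0) \<le> \<delta> \<and> norm (v 0 - v' 0) \<le> \<delta> \<and> norm (q H - q' H) \<le> \<delta> \<and> norm (v H - v' H) \<le> \<delta> \<longrightarrow>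
       norm (q' t - y) \<le> \<epsilon> \<and> (norm (v' t - w1) \<le> \<epsilon> \<or> norm (v' t - w2) \<le> \<epsilon>))"
proof -
  define T where "T i = (if i = 0 then 0 else if i \<le> K then sorted_list_of_set (breaks u v 0 H) ! (i - 1) else H)" for i
  have Klen: "K = length (sorted_list_of_set (breaks u v 0 H))" by (simp add: K code_def)
  note ch = trajectory_chain[OF X H, folded Klen, folded T_def]
  have mates: "q (T i) \<in> table" "norm (v (T (i - 1))) = 1"
      "\<exists>c\<in>C. dist c (q (T i)) = r \<and> v (T i) = reflect c (q (T i)) (v (T (i - 1)))"
    if i: "1 \<le> i" "i \<le> K" for i
  proof -
    have adm: "admissible (q (T i)) (u (T i)) (v (T i))" by (rule trajectory_admissible[OF X])
    have ne: "u (T i) \<noteq> v (T i)" using ch(9)[OF i] by (rule conjunct2)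
    note col = collision[OF adm ne]
    show "q (T i) \<in> table" using adm unfolding admissible_def by (rule conjunct1)
    show "norm (v (T (i - 1))) = 1"
      using trajectory_admissible[OF X, of "T (i - 1)"] unfolding admissible_def by blast
    show "\<exists>c\<in>C. dist c (q (T i)) = r \<and> v (T i) = reflect c (q (T i)) (v (T (i - 1)))"
      unfolding ch(6)[OF i, symmetric] by (intro bexI[where x="center (q (T i))"] conjI) (rule col)+
  qed
  have pair: "\<exists>T' l l'. chain_pair C r g K T T' (\<lambda>i. q (T i)) (\<lambda>i. q' (T' i)) (\<lambda>i. v (T i)) (\<lambda>i. v' (T' i))
       (\<lambda>i. code q u v 0 H ! (i - 1)) H \<delta> h \<and>
      l \<le> K \<and> T l \<le> t \<and> t < T (Suc l) \<and> l' \<le> K \<and> T' l' \<le> t \<and> t < T' (Suc l') \<and>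
      q t = q (T l) + (t - T l) *\<^sub>R v (T l) \<and> v t = v (T l) \<and>
      q' t = q' (T' l') + (t - T' l') *\<^sub>R v' (T' l') \<and> v' t = v' (T' l')"
    if X': "trajectory q' u' v'" and code: "code q' u' v' 0 H = code q u v 0 H"
      and ends: "norm (q 0 - q' 0) \<le> \<delta>" "norm (v 0 - v' 0) \<le> \<delta>" "norm (q H - q' H) \<le> \<delta>" "norm (v H - v' H) \<le> \<delta>"
    for q' u' v'
  proof -
    define T' where "T' i = (if i = 0 then 0 else if i \<le> K then sorted_list_of_set (breaks u' v' 0 H) ! (i - 1) else H)" for i
    have "length (code q' u' v' 0 H) = K" using code K by simp
    then have Klen': "K = length (sorted_list_of_set (breaks u' v' 0 H))" by (simp add: code_def)
    note ch' = trajectory_chain[OF X' H, folded Klen', folded T'_def]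
    have cp: "chain_pair C r g K T T' (\<lambda>i. q (T i)) (\<lambda>i. q' (T' i)) (\<lambda>i. v (T i)) (\<lambda>i. v' (T' i))
       (\<lambda>i. code q u v 0 H ! (i - 1)) H \<delta> h"
    proof unfold_locales
      show "chain K T (\<lambda>i. q (T i)) (\<lambda>i. v (T i)) (\<lambda>i. code q u v 0 H ! (i - 1))" by (rule ch(1))
      show "chain K T' (\<lambda>i. q' (T' i)) (\<lambda>i. v' (T' i)) (\<lambda>i. code q u v 0 H ! (i - 1))"
        using ch'(1) unfolding code .
      show "h \<le> T' (Suc i) - T' i" if "1 \<le> i" "i < K" for i using ch'(4) that .
    qed (use ch(2,3,7) ch'(2,3,7) ends h_pos in auto)
    obtain l where l: "l \<le> K" "T l \<le> t" "t < T (Suc l)" using ch(8)[OF t] by blast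
    obtain l' where l': "l' \<le> K" "T' l' \<le> t" "t < T' (Suc l')" using ch'(8)[OF t] by blast
    show ?thesis using cp l l' ch(5)[OF l] ch'(5)[OF l'] by blast
  qed
  \<comment> \<open>If a large kick of the reference orbit happens near \<open>t\<close>, its
    collision point with the velocities before and after is used; otherwise the reference orbit at
    time \<open>t\<close>, with \<open>w1 = w2\<close>.\<close>
  show ?thesis
  proof (cases "\<exists>i. 1 \<le> i \<and> i \<le> K \<and> \<eta> < norm (v (T i) - v (T (i - 1))) \<and> \<bar>t - T i\<bar> \<le> \<delta> + \<rho>")
    case True
    then obtain i where i: "1 \<le> i" "i \<le> K" "\<eta> < norm (v (T i) - v (T (i - 1)))" "\<bar>t - T i\<bar> \<le> \<delta> + \<rho>" by blast
    have "norm (q' t - q (T i)) \<le> \<epsilon> \<and> (norm (v' t - v (T (i - 1))) \<le> \<epsilon> \<or> norm (v' t - v (T i)) \<le> \<epsilon>)"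
      if X': "trajectory q' u' v' \<and> code q' u' v' 0 H = code q u v 0 H \<and>
       norm (q 0 - q' 0) \<le> \<delta> \<and> norm (v 0 - v' 0) \<le> \<delta> \<and> norm (q H - q' H) \<le> \<delta> \<and> norm (v H - v' H) \<le> \<delta>" for q' u' v'
    proof -
      from X' pair[of q' u' v'] obtain T' l' where
        cp: "chain_pair C r g K T T' (\<lambda>i. q (T i)) (\<lambda>i. q' (T' i)) (\<lambda>i. v (T i)) (\<lambda>i. v' (T' i))
          (\<lambda>i. code q u v 0 H ! (i - 1)) H \<delta> h"
        and l': "l' \<le> K" "T' l' \<le> t" "t < T' (Suc l')"
        and eq: "q' t = q' (T' l') + (t - T' l') *\<^sub>R v' (T' l')" "v' t = v' (T' l')" by blast
      have mu: "chain_pair.\<mu> \<delta> h = \<mu>" unfolding chain_pair.\<mu>_def[OF cp] \<mu> ..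
      have "0 \<le> real K * \<eta>" using \<eta> by simp
      then have "\<mu> \<le> \<epsilon>" using small(2) by linarith
      then show ?thesis
        using chain_pair.close_at_big_kick[OF cp i(1,2) \<eta> i(3) \<rho> i(4) small(4) l'] small(3)
        unfolding eq mu by linarith
    qed
    then show ?thesis using mates[OF i(1,2)]
      by (intro exI[of _ "q (T i)"] exI[of _ "v (T (i - 1))"] exI[of _ "v (T i)"]) blast
  next
    case False
    have "norm (q' t - q t) \<le> \<epsilon> \<and> norm (v' t - v t) \<le> \<epsilon>"
      if X': "trajectory q' u' v' \<and> code q' u' v' 0 H = code q u v 0 H \<and>
       norm (q 0 - q' 0) \<le> \<delta> \<and> norm (v 0 - v' 0) \<le> \<delta> \<and> norm (q H - q' H) \<le> \<delta> \<and> norm (v H - v' H) \<le> \<delta>" for q' u' v'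
    proof -
      from X' pair[of q' u' v'] obtain T' l l' where
        cp: "chain_pair C r g K T T' (\<lambda>i. q (T i)) (\<lambda>i. q' (T' i)) (\<lambda>i. v (T i)) (\<lambda>i. v' (T' i))
          (\<lambda>i. code q u v 0 H ! (i - 1)) H \<delta> h"
        and l: "l \<le> K" "T l \<le> t" "t < T (Suc l)" and l': "l' \<le> K" "T' l' \<le> t" "t < T' (Suc l')"
        and eq: "q t = q (T l) + (t - T l) *\<^sub>R v (T l)" "v t = v (T l)"
          "q' t = q' (T' l') + (t - T' l') *\<^sub>R v' (T' l')" "v' t = v' (T' l')" by blast
      have mu: "chain_pair.\<mu> \<delta> h = \<mu>" unfolding chain_pair.\<mu>_def[OF cp] \<mu> ..
      have "norm (q t - q' t) \<le> \<epsilon>"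
        using chain_pair.position_close[OF cp l(1,2) less_imp_le[OF l(3)] l'(1,2) less_imp_le[OF l'(3)]] small(1)
        unfolding eq mu by linarith
      moreover have "norm (v t - v' t) \<le> \<epsilon>"
        using chain_pair.close_away_from_big_kicks[OF cp \<eta> \<rho> _ l l'] False small(2)
        unfolding eq mu by force
      ultimately show ?thesis by (simp add: norm_minus_commute)
    qed
    moreover have "q t \<in> table" "norm (v t) = 1"
      using trajectory_admissible[OF X, of t] unfolding admissible_def by blast+
    ultimately show ?thesis by (intro exI[of _ "q t"] exI[of _ "v t"]) blast
  qed
qed

text \<open>A precision polynomial in \<open>N\<close>, which bounds the duration and the number of
  collisions, is enough, with \<open>s\<close> independent of \<open>N\<close>. The fourth power
  makes \<open>sqrt \<delta> = s / N\<^sup>2\<close>, which absorbs the factor \<open>N\<close> from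
  summing over collisions as well as the loss from dividing by \<open>\<eta>\<close>.\<close>

lemma shadow_parameters:
  assumes \<epsilon>: "0 < \<epsilon>"
  shows "\<exists>s>0. s \<le> 1 \<and> (\<forall>N K H \<delta> \<mu> \<eta> \<rho>. 1 \<le> N \<and> real K \<le> N \<and> 0 \<le> H \<and> H \<le> N \<and> \<delta> = s\<^sup>2 / N ^ 4 \<and>
     \<mu> = max \<delta> (sqrt (4 * \<delta> / h)) \<and> \<eta> = \<epsilon> / (2 * N) \<and> \<rho> = sqrt (4 * r * \<delta> / \<eta>) \<longrightarrow>
     \<delta> + H * \<mu> + real K * (2 * \<delta> + sqrt (8 * r * \<delta>)) \<le> \<epsilon> \<and> real K * \<eta> + \<mu> \<le> \<epsilon> \<and>
     2 * (\<delta> + \<rho>) + \<rho> \<le> \<epsilon> \<and> 2 * (\<delta> + \<rho>) < h)"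
proof -
  define B where "B = 1 + 2 / sqrt h"
  define E where "E = sqrt (8 * r)"
  define F where "F = sqrt (8 * r / \<epsilon>)"
  \<comment> \<open>Collects the coefficients of \<open>s\<close> in all the estimates
    below.\<close>
  define Z where "Z = 4 + B + E + F"
  define s where "s = min 1 (min \<epsilon> h / (4 * Z))"
  have pos: "1 \<le> B" "0 \<le> E" "0 \<le> F" using h_pos r_pos \<epsilon> by (auto simp: B_def E_def F_def)
  then have Z: "4 \<le> Z" by (simp add: Z_def)
  have s: "0 < s" "s \<le> 1" using Z h_pos \<epsilon> by (auto simp: s_def)
  have "s \<le> min \<epsilon> h / (4 * Z)" by (simp add: s_def)
  then have "4 * (s * Z) \<le> min \<epsilon> h" using Z by (simp add: field_simps)
  then have sZ: "4 * (s * Z) \<le> \<epsilon>" "4 * (s * Z) \<le> h" by auto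
  have expand: "s * Z = 4 * s + s * B + s * E + s * F" by (simp add: Z_def algebra_simps)
  have nn: "0 < s" "0 \<le> s * E" "0 \<le> s * F" "s \<le> s * B" using s pos by auto
  have main: "\<delta> + H * \<mu> + real K * (2 * \<delta> + sqrt (8 * r * \<delta>)) \<le> \<epsilon> \<and> real K * \<eta> + \<mu> \<le> \<epsilon> \<and>
     2 * (\<delta> + \<rho>) + \<rho> \<le> \<epsilon> \<and> 2 * (\<delta> + \<rho>) < h"
    if N: "1 \<le> N" and K: "real K \<le> N" and H: "0 \<le> H" "H \<le> N" and \<delta>: "\<delta> = s\<^sup>2 / N ^ 4"
      and \<mu>: "\<mu> = max \<delta> (sqrt (4 * \<delta> / h))" and \<eta>: "\<eta> = \<epsilon> / (2 * N)" and \<rho>: "\<rho> = sqrt (4 * r * \<delta> / \<eta>)"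
    for N K H \<delta> \<mu> \<eta> \<rho>
  proof -
    \<comment> \<open>\<open>x\<close> is the square root of \<open>\<delta>\<close>; every error
      term is bounded by a constant times \<open>x\<close> or \<open>N * x\<close>.\<close>
    define x where "x = s / N\<^sup>2"
    have NN: "N \<le> N\<^sup>2" "1 \<le> N\<^sup>2" using N by (auto simp: power2_eq_square mult_le_cancel_left1 intro: order_trans)
    have x: "0 < x" "x \<le> s" "N * x \<le> s"
    proof -
      show "0 < x" using s N by (simp add: x_def)
      show "N * x \<le> s" using NN N s by (simp add: x_def field_simps power2_eq_square)
      show "x \<le> s" using NN N s by (simp add: x_def field_simps)
    qed
    have \<delta>x: "\<delta> = x\<^sup>2" by (simp add: \<delta> x_def power_divide flip: power_mult)
    have x1: "x \<le> 1" using x s by linarith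
    have \<delta>le: "\<delta> \<le> x" unfolding \<delta>x power2_eq_square using x x1 by (simp add: mult_le_one mult_left_le)
    have sq: "sqrt \<delta> = x" using x by (simp add: \<delta>x)
    have "sqrt (4 * \<delta> / h) = (2 / sqrt h) * x" by (simp add: real_sqrt_mult real_sqrt_divide sq)
    moreover have "0 \<le> (2 / sqrt h) * x" using x h_pos by simp
    moreover have Bx: "B * x = x + (2 / sqrt h) * x" by (simp add: B_def algebra_simps)
    ultimately have \<mu>le: "\<mu> \<le> B * x"
      unfolding \<mu> Bx max.bounded_iff using \<delta>le x(1) by (intro conjI) linarith+
    have \<mu>0: "0 \<le> \<mu>" unfolding \<mu> by (simp add: le_max_iff_disj \<delta>x)
    have e8: "sqrt (8 * r * \<delta>) = E * x" by (simp add: E_def real_sqrt_mult sq)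
    have "H * \<mu> \<le> N * (B * x)" using H \<mu>le \<mu>0 N by (intro mult_mono) auto
    also have "\<dots> = B * (N * x)" by simp
    also have "\<dots> \<le> B * s" using x pos by (intro mult_left_mono) auto
    finally have 1: "H * \<mu> \<le> s * B" by (simp add: mult.commute)
    have "real K * (2 * \<delta> + sqrt (8 * r * \<delta>)) \<le> N * (2 * x + E * x)"
      unfolding e8 using K \<delta>le x pos \<delta>x N by (intro mult_mono add_mono) auto
    also have "\<dots> = (2 + E) * (N * x)" by (simp add: algebra_simps)
    also have "\<dots> \<le> (2 + E) * s" using x pos by (intro mult_left_mono) auto
    finally have 2: "real K * (2 * \<delta> + sqrt (8 * r * \<delta>)) \<le> 2 * s + s * E" by (simp add: algebra_simps)
    have a1: "\<delta> + H * \<mu> + real K * (2 * \<delta> + sqrt (8 * r * \<delta>)) \<le> \<epsilon>"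
      using 1 2 \<delta>le x sZ expand nn by linarith
    have "real K * \<eta> \<le> N * (\<epsilon> / (2 * N))" unfolding \<eta> using K \<epsilon> N by (intro mult_right_mono) auto
    also have "\<dots> = \<epsilon> / 2" using N by simp
    finally have "real K * \<eta> \<le> \<epsilon> / 2" .
    moreover have "B * x \<le> B * s" using x(2) pos by (intro mult_left_mono) auto
    then have "\<mu> \<le> s * B" unfolding mult.commute[of s B] using \<mu>le by linarith
    ultimately have a2: "real K * \<eta> + \<mu> \<le> \<epsilon>" using sZ expand nn by linarith
    have "4 * r * \<delta> / \<eta> = (8 * r / \<epsilon>) * (N * x\<^sup>2)" using N \<epsilon> by (simp add: \<eta> \<delta>x field_simps)
    also have "\<dots> \<le> (8 * r / \<epsilon>) * (N * x)\<^sup>2"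
      using r_pos \<epsilon> NN x by (intro mult_left_mono) (auto simp: power_mult_distrib mult_right_mono)
    finally have "\<rho> \<le> sqrt ((8 * r / \<epsilon>) * (N * x)\<^sup>2)" unfolding \<rho> by simp
    also have "\<dots> = F * (N * x)" using N x by (simp only: F_def real_sqrt_mult) simp
    also have "\<dots> \<le> F * s" using x pos by (intro mult_left_mono) auto
    finally have \<rho>le: "\<rho> \<le> s * F" by (simp add: mult.commute)
    have \<delta>s: "\<delta> \<le> s" using \<delta>le x(2) by simp
    have Zs: "4 * s + 4 * (s * F) \<le> 4 * (s * Z)" using expand nn by argo
    have "2 * (\<delta> + \<rho>) + \<rho> \<le> \<epsilon>" using \<rho>le \<delta>s sZ(1) Zs nn(1,3) by argo
    moreover have "2 * (\<delta> + \<rho>) < h" using \<rho>le \<delta>s sZ(2) Zs nn(1,3) by argo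
    moreover note a1 a2
    ultimately show ?thesis by blast
  qed
  show ?thesis using s main by blast
qed

end

section \<open>A Lebesgue number for pairs of mates\<close>

context disk_row begin

lemma closed_subset_table_compact: "compact S \<Longrightarrow> compact ((table \<inter> S) \<times> sphere (0::point) 1)"
  using closed_table by (intro compact_Times closed_Int_compact) auto

lemma lifted_eq: "\<Lambda> = table \<times> sphere 0 1"
  by (simp add: lifted_phase_space_def table_eq)

lemma state_translate: "(q, v) \<in> \<Lambda> \<Longrightarrow> state (q + lattice_vec a b) v = state q v"
  using state_eq_iff[of q v "q + lattice_vec a b" v] by (auto simp: lifted_eq translate_table mates_def)

lemma continuous_on_reflect:
  "continuous_on {z. fst z \<noteq> c} (\<lambda>z. reflect c (fst z) (snd z))"
  unfolding reflect_def sgn_div_norm by (intro continuous_intros) auto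

text \<open>A usual Lebesgue number treats one representative at a time, whereas here one cover
  element must contain the states near either of two mates. The Lebesgue lemma is therefore applied
  to a compact set of pairs in the square of the phase space.\<close>

lemma lebesgue_pairs:
  assumes cover: "\<U> \<in> open_covers (phase_space n r)"
  shows "\<exists>\<kappa>>0. \<forall>q v v'. q \<in> table \<and> norm v = 1 \<and> mates q v v' \<longrightarrow>
    (\<exists>A\<in>\<U>. \<forall>x y. (x, y) \<in> \<Lambda> \<and> dist x q < \<kappa> \<and> (dist y v < \<kappa> \<or> dist y v' < \<kappa>) \<longrightarrow> state x y \<in> A)"
proof -
  \<comment> \<open>Squares suffice because the preimage of a cover element contains with a phase
    point all its mates.\<close>
  define G where "G = {T \<times> T | T. open T \<and> (\<exists>A\<in>\<U>. \<forall>x y. (x, y) \<in> \<Lambda> \<and> (x, y) \<in> T \<longrightarrow> state x y \<in> A)}"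
  define ct where "ct i = (real i / real n, 0::real)" for i
  \<comment> \<open>One unit square for the diagonal, and below one boundary circle per disk for
    genuine reflections; lattice translations reach everything else.\<close>
  define D where "D = (\<lambda>z. (z, z)) ` ((table \<inter> cbox (0, 0) (1, 1)) \<times> sphere (0::point) 1)"
  define R where "R i = (\<lambda>z. (z, (fst z, reflect (ct i) (fst z) (snd z)))) `
     ((table \<inter> sphere (ct i) r) \<times> sphere (0::point) 1)" for i
  define Z where "Z = D \<union> (\<Union>i<n. R i)"
  have ct: "ct i \<in> C" if "i < n" for i
    unfolding ct_def disk_centers_def using that by (intro CollectI exI[of _ i] exI[of _ 0]) auto
  have "compact D" unfolding D_def
    by (intro compact_continuous_image closed_subset_table_compact continuous_intros compact_cbox)
  moreover have "compact (R i)" if "i < n" for i unfolding R_def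
  proof (rule compact_continuous_image[OF _ closed_subset_table_compact[OF compact_sphere]])
    show "continuous_on ((table \<inter> sphere (ct i) r) \<times> sphere 0 1) (\<lambda>z. (z, fst z, reflect (ct i) (fst z) (snd z)))"
      using r_pos by (intro continuous_intros continuous_on_subset[OF continuous_on_reflect]) auto
  qed
  ultimately have "compact Z" unfolding Z_def by (intro compact_Un compact_UN) auto
  moreover have "Z \<subseteq> \<Union>G"
  proof
    fix z assume z: "z \<in> Z"
    have "\<exists>q v v'. z = ((q, v), (q, v')) \<and> (q, v) \<in> \<Lambda> \<and> (q, v') \<in> \<Lambda> \<and> mates q v v'"
    proof (cases "z \<in> D")
      case True
      then show ?thesis by (auto simp: D_def lifted_eq mates_def)
    next
      case False
      then obtain i where i: "i < n" "z \<in> R i" using z by (auto simp: Z_def)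
      then obtain q v where qv: "z = ((q, v), (q, reflect (ct i) q v))" "q \<in> table" "dist (ct i) q = r" "norm v = 1"
        by (auto simp: R_def)
      then have "norm (reflect (ct i) q v) = 1" using norm_reflect contact_ne by metis
      then show ?thesis using qv ct[OF i(1)] by (auto simp: lifted_eq mates_def)
    qed
    then obtain q v v' where qv: "z = ((q, v), (q, v'))" "(q, v) \<in> \<Lambda>" "(q, v') \<in> \<Lambda>" "mates q v v'" by blast
    have eq: "state q v' = state q v"
      using state_eq_iff[OF qv(2,3)] qv(4) by (metis add_0_right lattice_vec_0)
    have "state q v \<in> topspace (phase_space n r)" using topspace_phase_space qv by blast
    then obtain A where A: "A \<in> \<U>" "state q v \<in> A" using cover unfolding open_covers_def by blast
    have "openin (phase_space n r) A" using A cover unfolding open_covers_def by blast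
    then have "openin (top_of_set \<Lambda>) {x \<in> \<Lambda>. phase_rel n r `` {x} \<in> A}"
      unfolding phase_space_def openin_quotient_topology by simp
    then obtain T where T: "open T" "{x \<in> \<Lambda>. phase_rel n r `` {x} \<in> A} = \<Lambda> \<inter> T"
      unfolding openin_open by blast
    have TA: "(x, y) \<in> T \<longleftrightarrow> state x y \<in> A" if "(x, y) \<in> \<Lambda>" for x y
      using T(2) that unfolding state_def by blast
    then have "T \<times> T \<in> G" unfolding G_def using T(1) A(1) by blast
    moreover have "z \<in> T \<times> T" using qv TA eq A by simp
    ultimately show "z \<in> \<Union>G" by blast
  qed
  moreover have "open S" if "S \<in> G" for S using that by (auto simp: G_def intro: open_Times)
  ultimately obtain \<epsilon> where \<epsilon>: "0 < \<epsilon>" "\<And>z. z \<in> Z \<Longrightarrow> \<exists>S\<in>G. ball z \<epsilon> \<subseteq> S"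
    using Heine_Borel_lemma by metis
  have base: "\<exists>A\<in>\<U>. \<forall>x y. (x, y) \<in> \<Lambda> \<and> dist x q < \<epsilon>/2 \<and> (dist y v < \<epsilon>/2 \<or> dist y v' < \<epsilon>/2) \<longrightarrow> state x y \<in> A"
    if z: "((q, v), (q, v')) \<in> Z" for q v v'
  proof -
    obtain S where "S \<in> G" "ball ((q, v), (q, v')) \<epsilon> \<subseteq> S" using \<epsilon>(2)[OF z] by blast
    then obtain T A where T: "ball ((q, v), (q, v')) \<epsilon> \<subseteq> T \<times> T" "A \<in> \<U>"
      "\<And>x y. (x, y) \<in> \<Lambda> \<Longrightarrow> (x, y) \<in> T \<Longrightarrow> state x y \<in> A" by (auto simp: G_def)
    have sub: "(x, y) \<in> T" if "dist x q < \<epsilon>/2" "dist y v < \<epsilon>/2 \<or> dist y v' < \<epsilon>/2" for x y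
      using that(2)
    proof
      assume "dist y v < \<epsilon>/2"
      then have "dist (x, y) (q, v) < \<epsilon>"
        using that(1) sqrt_sum_squares_le_sum_abs[of "dist x q" "dist y v"] by (simp add: dist_Pair_Pair)
      then have "((x, y), (q, v')) \<in> ball ((q, v), (q, v')) \<epsilon>"
        using dist_Pair_Pair[of "(q, v)" "(q, v')" "(x, y)" "(q, v')"] by (simp add: dist_commute)
      then show ?thesis using T(1) by blast
    next
      assume "dist y v' < \<epsilon>/2"
      then have "dist (x, y) (q, v') < \<epsilon>"
        using that(1) sqrt_sum_squares_le_sum_abs[of "dist x q" "dist y v'"] by (simp add: dist_Pair_Pair)
      then have "((q, v), (x, y)) \<in> ball ((q, v), (q, v')) \<epsilon>"
        using dist_Pair_Pair[of "(q, v)" "(q, v')" "(q, v)" "(x, y)"] by (simp add: dist_commute)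
      then show ?thesis using T(1) by blast
    qed
    show ?thesis using T(2,3) sub by blast
  qed
  have "\<exists>A\<in>\<U>. \<forall>x y. (x, y) \<in> \<Lambda> \<and> dist x q < \<epsilon>/2 \<and> (dist y v < \<epsilon>/2 \<or> dist y v' < \<epsilon>/2) \<longrightarrow> state x y \<in> A"
    if q: "q \<in> table" "norm v = 1" and m: "mates q v v'" for q v v'
  proof -
    \<comment> \<open>A diagonal pair is moved into the unit square, a reflected pair along with its
      disk, whose contact points may lie outside that square.\<close>
    have "\<exists>a b. ((q + lattice_vec a b, v), (q + lattice_vec a b, v')) \<in> Z"
    proof (cases "v' = v")
      case True
      let ?q = "q + lattice_vec (- \<lfloor>fst q\<rfloor>) (- \<lfloor>snd q\<rfloor>)"
      have "fst ?q = fst q - real_of_int \<lfloor>fst q\<rfloor>" "snd ?q = snd q - real_of_int \<lfloor>snd q\<rfloor>"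
        by (simp_all add: lattice_vec_def)
      then have "0 \<le> fst ?q" "fst ?q \<le> 1" "0 \<le> snd ?q" "snd ?q \<le> 1" by linarith+
      then have "?q \<in> cbox (0, 0) (1, 1)" by (auto simp: cbox_Pair_eq mem_Times_iff)
      then have "((?q, v), (?q, v')) \<in> D" unfolding D_def True
        using q by (intro image_eqI[of _ _ "(?q, v)"]) (auto simp: translate_table)
      then show ?thesis unfolding Z_def by blast
    next
      case False
      then obtain c where c: "c \<in> C" "dist c q = r" "v' = reflect c q v" using m unfolding mates_def by blast
      then obtain i a b where i: "c = (real i / real n + real_of_int a, real_of_int b)" "i < n"
        unfolding disk_centers_def by blast
      have ceq: "ct i = c + lattice_vec (- a) (- b)" by (simp add: ct_def i lattice_vec_def)
      let ?q = "q + lattice_vec (- a) (- b)"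
      have "dist (ct i) ?q = r" using c by (simp add: ceq)
      moreover have "reflect (ct i) ?q v = v'" unfolding ceq reflect_translate using c by simp
      ultimately have "((?q, v), (?q, v')) \<in> R i" unfolding R_def
        using q by (intro image_eqI[of _ _ "(?q, v)"]) (auto simp: translate_table)
      then show ?thesis unfolding Z_def using i(2) by blast
    qed
    then obtain a b where "((q + lattice_vec a b, v), (q + lattice_vec a b, v')) \<in> Z" by blast
    from base[OF this] obtain A where A: "A \<in> \<U>"
      "\<And>x y. (x, y) \<in> \<Lambda> \<Longrightarrow> dist x (q + lattice_vec a b) < \<epsilon>/2 \<Longrightarrow> dist y v < \<epsilon>/2 \<or> dist y v' < \<epsilon>/2 \<Longrightarrow> state x y \<in> A"
      by blast
    have "state x y \<in> A" if "(x, y) \<in> \<Lambda>" "dist x q < \<epsilon>/2" "dist y v < \<epsilon>/2 \<or> dist y v' < \<epsilon>/2" for x y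
      using A(2)[of "x + lattice_vec a b" y] that state_translate[OF that(1)]
      by (auto simp: lifted_eq translate_table)
    then show ?thesis using A(1) by blast
  qed
  then show ?thesis using \<epsilon>(1) by (intro exI[of _ "\<epsilon>/2"]) auto
qed

end

section \<open>Counting collision sequences\<close>

context scatterers begin

lemma trajectory_speed:
  assumes X: "trajectory q u v" and t: "0 \<le> t"
  shows "norm (q t - q 0) \<le> t"
proof -
  define H where "H = t + 1"
  have H: "0 \<le> H" "t < H" using t by (auto simp: H_def)
  define K where "K = length (sorted_list_of_set (breaks u v 0 H))"
  define T where "T i = (if i = 0 then 0 else if i \<le> K then sorted_list_of_set (breaks u v 0 H) ! (i - 1) else H)" for i
  note ch = trajectory_chain[OF X H(1), folded K_def, folded T_def]
  have *: "norm (q (T i) - q 0) \<le> T i" if "i \<le> K" for i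
    using that
  proof (induction i)
    case (Suc i)
    have i: "i \<le> K" using Suc by simp
    note st = chain_step[OF ch(1) i]
    have "norm (q (T (Suc i)) - q 0) = norm ((q (T i) - q 0) + (T (Suc i) - T i) *\<^sub>R v (T i))"
      unfolding st(2) by (simp add: algebra_simps)
    also have "\<dots> \<le> norm (q (T i) - q 0) + (T (Suc i) - T i)"
      using norm_triangle_ineq[of "q (T i) - q 0" "(T (Suc i) - T i) *\<^sub>R v (T i)"] st by simp
    finally show ?case using Suc by simp
  qed (simp add: ch(2))
  obtain l where l: "l \<le> K" "T l \<le> t" "t < T (Suc l)" using ch(8)[OF t H(2)] by blast
  have eq: "q t = q (T l) + (t - T l) *\<^sub>R v (T l)" using ch(5)[OF l] by (rule conjunct1)
  have "norm (q t - q 0) = norm ((q (T l) - q 0) + (t - T l) *\<^sub>R v (T l))"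
    unfolding eq by (simp add: algebra_simps)
  also have "\<dots> \<le> norm (q (T l) - q 0) + (t - T l)"
    using norm_triangle_ineq[of "q (T l) - q 0" "(t - T l) *\<^sub>R v (T l)"] l chain_step(3)[OF ch(1) l(1)] by simp
  finally show ?thesis using *[OF l(1)] by simp
qed

text \<open>Legs between collisions take at least \<open>h\<close>; the extra 1 accounts for the
  first collision.\<close>

lemma code_length:
  assumes X: "trajectory q u v" and H: "0 \<le> H"
  shows "real (length (code q u v 0 H)) \<le> H / h + 1"
proof -
  define K where "K = length (sorted_list_of_set (breaks u v 0 H))"
  define T where "T i = (if i = 0 then 0 else if i \<le> K then sorted_list_of_set (breaks u v 0 H) ! (i - 1) else H)" for i
  note ch = trajectory_chain[OF X H, folded K_def, folded T_def]
  have K: "length (code q u v 0 H) = K" by (simp add: code_def K_def)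
  have *: "real i * h \<le> T (Suc i) - T 1" if "i < K" for i
    using that
  proof (induction i)
    case (Suc i)
    then show ?case using ch(4)[of "Suc i"] by (simp add: algebra_simps)
  qed simp
  show ?thesis unfolding K
  proof (cases K)
    case (Suc i)
    have "T K \<le> H" "0 \<le> T 1"
      using chain_mono[OF ch(1), of K "Suc K"] chain_mono[OF ch(1), of 0 1] ch(2,3) by auto
    then have "real i * h \<le> H" using *[of i] Suc by simp
    then show "real K \<le> H / h + 1" using h_pos Suc by (simp add: field_simps)
  qed (use h_pos H in simp)
qed

text \<open>This prevents a particle from hitting three consecutive disks of a row in their order.\<close>

lemma no_passing:
  assumes c: "dist c p = r" and v: "l > 0" "(p - c) \<bullet> v > 0" "dist c' (p + l *\<^sub>R v) = r"
  shows "(c' - c) \<bullet> (p - c) > 0"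
proof -
  let ?e = "c' - (p + l *\<^sub>R v)"
  have n: "norm (p - c) = r" "norm ?e = r" using assms by (auto simp: dist_norm norm_minus_commute)
  have "\<bar>?e \<bullet> (p - c)\<bar> \<le> r * r" using Cauchy_Schwarz_ineq2[of ?e "p - c"] n by simp
  moreover have "(p - c) \<bullet> (p - c) = r * r" using n by (simp add: dot_square_norm power2_eq_square)
  moreover have "(c' - c) \<bullet> (p - c) = ?e \<bullet> (p - c) + (p - c) \<bullet> (p - c) + l * ((p - c) \<bullet> v)"
    by (simp add: inner_diff_left inner_diff_right inner_add_left inner_commute algebra_simps)
  moreover have "l * ((p - c) \<bullet> v) > 0" using v by simp
  ultimately show ?thesis by linarith
qed

end

section \<open>Collision words of time windows of length 3/4\<close>

context disk_row begin

lemma r_n: "1000 * (r * real n) \<le> 1" "1000 * r \<le> 1"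
proof -
  show *: "1000 * (r * real n) \<le> 1" using r_small n_pos by (simp add: field_simps)
  have "r * 1 \<le> r * real n" using n_pos r_pos' by (intro mult_left_mono) auto
  then show "1000 * r \<le> 1" using * by linarith
qed

text \<open>The flight is too short to change rows. If it skipped the next disk of the row, it would
  cross the vertical line through that centre at a height between its end heights, hence within the
  closed disk. The only way to stay in the table is to move horizontally at distance
  \<open>r\<close> from the axis of the row, and then the arrival would be tangential.\<close>

lemma row_neighbours:
  assumes c: "c \<in> C" "dist c p = r" and c': "c' \<in> C" "dist c' (p + l *\<^sub>R v) = r"
    and v: "norm v = 1" "(p - c) \<bullet> v > 0" "(p + l *\<^sub>R v - c') \<bullet> v < 0" and l: "0 < l" "l < 3/4"
    and seg: "\<And>s. \<lbrakk>0 \<le> s; s \<le> l\<rbrakk> \<Longrightarrow> p + s *\<^sub>R v \<in> table"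
  shows "\<exists>\<sigma>\<in>{-1, 1::int}. c' = c + (real_of_int \<sigma> / real n, 0)"
proof -
  obtain k b where k: "c = (real_of_int k / real n, real_of_int b)" using c(1) disk_centers_eq[OF n_pos] by auto
  obtain k' b' where k': "c' = (real_of_int k' / real n, real_of_int b')" using c'(1) disk_centers_eq[OF n_pos] by auto
  let ?p' = "p + l *\<^sub>R v"
  have fst: "\<bar>fst p - fst c\<bar> \<le> r" "\<bar>fst ?p' - fst c'\<bar> \<le> r"
    using dist_fst_le[of c p] dist_fst_le[of c' ?p'] c(2) c'(2) by (auto simp: dist_real_def abs_minus_commute)
  have snd: "\<bar>snd p - snd c\<bar> \<le> r" "\<bar>snd ?p' - snd c'\<bar> \<le> r"
    using dist_snd_le[of c p] dist_snd_le[of c' ?p'] c(2) c'(2) by (auto simp: dist_real_def abs_minus_commute)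
  have "\<bar>snd v\<bar> \<le> 1" using norm_snd_le[where x = "fst v" and y = "snd v"] v by simp
  then have "\<bar>l * snd v\<bar> \<le> l" using l by (simp add: abs_mult mult_left_le)
  then have "\<bar>snd c - snd c'\<bar> < 1" using snd l r_n by simp
  then have b: "b' = b" using k k' by simp
  have ne: "c' \<noteq> c" by (rule flight_between_disks(1)[OF c c' v(1,2) l(1)])
  define \<sigma> :: int where "\<sigma> = (if k' > k then 1 else -1)"
  have kk: "k' \<noteq> k" using ne k k' b by auto
  have "k' = k + \<sigma>"
  proof (rule ccontr)
    assume "k' \<noteq> k + \<sigma>"
    then have far: "\<sigma> * (k' - (k + \<sigma>)) \<ge> 1" using kk by (auto simp: \<sigma>_def)
    define c2 where "c2 = (real_of_int (k + \<sigma>) / real n, real_of_int b)"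
    have c2: "c2 \<in> C" unfolding disk_centers_eq[OF n_pos] c2_def by blast
    have \<sigma>: "\<sigma> = 1 \<or> \<sigma> = - 1" by (simp add: \<sigma>_def)
    define A where "A = real_of_int \<sigma> * (fst p - fst c2)"
    define B where "B = real_of_int \<sigma> * (fst ?p' - fst c2)"
    have gap: "r < 1 / real n" using two_r r_pos' by linarith
    have "real_of_int \<sigma> * (fst c - fst c2) = - 1 / real n"
      using \<sigma> by (auto simp: k c2_def add_divide_distrib diff_divide_distrib)
    moreover have "real_of_int \<sigma> * (fst c' - fst c2) \<ge> 1 / real n"
    proof -
      have "real_of_int \<sigma> * (fst c' - fst c2) = real_of_int (\<sigma> * (k' - (k + \<sigma>))) / real n"
        by (simp add: k' c2_def diff_divide_distrib[symmetric])
      moreover have "1 \<le> real_of_int (\<sigma> * (k' - (k + \<sigma>)))" using far by linarith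
      ultimately show ?thesis using n_pos by (simp only:) (intro divide_right_mono, auto)
    qed
    ultimately have AB: "A < 0" "0 < B" using fst \<sigma> gap unfolding A_def B_def by auto
    \<comment> \<open>The fraction of the flight at which it crosses the vertical line through
      \<open>c2\<close>.\<close>
    define \<tau> where "\<tau> = - A / (B - A)"
    have \<tau>: "0 < \<tau>" "\<tau> < 1" "(1 - \<tau>) * A + \<tau> * B = 0" using AB by (auto simp: \<tau>_def field_simps)
    define x where "x = p + (\<tau> * l) *\<^sub>R v"
    have xt: "x \<in> table" unfolding x_def using \<tau> l by (intro seg) (auto simp: mult_le_cancel_right1)
    have fx: "fst x = (1 - \<tau>) * fst p + \<tau> * fst ?p'" and sx: "snd x = (1 - \<tau>) * snd p + \<tau> * snd ?p'"
      by (auto simp: x_def algebra_simps)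
    have "real_of_int \<sigma> * (fst x - fst c2) = (1 - \<tau>) * A + \<tau> * B"
      unfolding fx A_def B_def by (simp add: algebra_simps)
    then have "fst x = fst c2" using \<tau>(3) \<sigma> by auto
    then have dx: "dist c2 x = \<bar>snd x - real_of_int b\<bar>"
      by (cases x) (simp add: c2_def dist_Pair_Pair dist_real_def abs_minus_commute)
    define a where "a = snd p - real_of_int b"
    define a' where "a' = snd ?p' - real_of_int b"
    have ab: "\<bar>a\<bar> \<le> r" "\<bar>a'\<bar> \<le> r" using snd k k' b by (auto simp: a_def a'_def)
    have xa: "snd x - real_of_int b = (1 - \<tau>) * a + \<tau> * a'" unfolding sx a_def a'_def by (simp add: algebra_simps)
    have "r \<le> \<bar>(1 - \<tau>) * a + \<tau> * a'\<bar>" using xt c2 dx xa by (auto simp: in_table_iff)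
    moreover have "(1 - \<tau>) * a \<le> (1 - \<tau>) * \<bar>a\<bar>" "\<tau> * a' \<le> \<tau> * \<bar>a'\<bar>" using \<tau> by (auto intro: mult_left_mono)
    \<comment> \<open>A convex combination with positive weights of numbers of modulus at most
      \<open>r\<close> reaches modulus \<open>r\<close> only if both are equal and extremal.\<close>
    ultimately have eq: "a = a' \<and> \<bar>a'\<bar> = r"
    proof -
      have up: "(1 - \<tau>) * y \<le> (1 - \<tau>) * r" "\<tau> * y \<le> \<tau> * r" if "y \<le> r" for y
        using that \<tau> by (auto intro: mult_left_mono)
      have strict: "(1 - \<tau>) * y < (1 - \<tau>) * r" "\<tau> * y < \<tau> * r" if "y < r" for y
        using that \<tau> by auto
      have rr: "(1 - \<tau>) * r + \<tau> * r = r" by (simp add: algebra_simps)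
      show ?thesis
      proof (cases "(1 - \<tau>) * a + \<tau> * a' \<ge> 0")
        case True
        then have ge: "r \<le> (1 - \<tau>) * a + \<tau> * a'" using \<open>r \<le> \<bar>_\<bar>\<close> by simp
        have "\<not> a < r" using strict(1)[of a] up(2)[of a'] ge rr ab by linarith
        moreover have "\<not> a' < r" using strict(2)[of a'] up(1)[of a] ge rr ab by linarith
        ultimately show ?thesis using ab r_pos' by linarith
      next
        case False
        then have ge: "r \<le> (1 - \<tau>) * (- a) + \<tau> * (- a')" using \<open>r \<le> \<bar>_\<bar>\<close> by simp
        have "\<not> - a < r" using strict(1)[of "- a"] up(2)[of "- a'"] ge rr ab by linarith
        moreover have "\<not> - a' < r" using strict(2)[of "- a'"] up(1)[of "- a"] ge rr ab by linarith
        ultimately show ?thesis using ab r_pos' by linarith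
      qed
    qed
    then have "l * snd v = 0" by (simp add: a_def a'_def)
    then have sv: "snd v = 0" using l by simp
    have "(fst ?p' - fst c')\<^sup>2 + (snd ?p' - snd c')\<^sup>2 = r\<^sup>2"
    proof -
      have "dist c' ?p' = sqrt ((fst ?p' - fst c')\<^sup>2 + (snd ?p' - snd c')\<^sup>2)"
        by (cases c', cases ?p') (simp add: dist_Pair_Pair dist_real_def power2_commute)
      then show ?thesis using c'(2) by (metis real_sqrt_pow2 sum_power2_ge_zero)
    qed
    moreover have "(snd ?p' - snd c')\<^sup>2 = r\<^sup>2" using eq b k' by (metis a'_def power2_abs snd_conv)
    ultimately have "fst ?p' - fst c' = 0" by simp
    then have "(?p' - c') \<bullet> v = 0" using sv by (simp add: inner_prod_def)
    then show False using v(3) by simp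
  qed
  moreover have "\<sigma> \<in> {-1, 1}" by (simp add: \<sigma>_def)
  ultimately show ?thesis using k k' b by (intro bexI[of _ \<sigma>]) (auto simp: add_divide_distrib)
qed

definition cell :: "point \<Rightarrow> int \<times> int" where
  "cell q = (\<lfloor>fst q\<rfloor>, \<lfloor>snd q\<rfloor>)"

text \<open>Words are counted in the lift, with the unit square of the start prescribed; without it
  the first disk could be any of infinitely many.\<close>

definition words :: "nat \<Rightarrow> int \<times> int \<Rightarrow> point list set" where
  "words M a = {code q u v 0 (3/4 * real M) | q u v. trajectory q u v \<and> cell (q 0) = a}"

definition row_word :: "point \<Rightarrow> int \<Rightarrow> nat \<Rightarrow> point list" where
  "row_word c \<sigma> k = map (\<lambda>i. if even i then c else c + (real_of_int \<sigma> / real n, 0)) [0..<k]"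

text \<open>Large enough for every centre within distance 1 of a point of the unit square
  \<open>a\<close>, hence for every possible first disk of a window.\<close>

definition near_centers :: "int \<times> int \<Rightarrow> point set" where
  "near_centers a = (\<lambda>(k, b). (real_of_int k / real n, real_of_int b)) `
     ({int n * (fst a - 1)..int n * (fst a + 2)} \<times> {snd a - 1..snd a + 2})"

lemma near_centersI:
  assumes "c \<in> C" "dist c q \<le> 1" "cell q = a"
  shows "c \<in> near_centers a"
proof -
  obtain k b where k: "c = (real_of_int k / real n, real_of_int b)" using assms(1) disk_centers_eq[OF n_pos] by auto
  have d: "\<bar>fst c - fst q\<bar> \<le> 1" "\<bar>snd c - snd q\<bar> \<le> 1"
    using dist_fst_le[of c q] dist_snd_le[of c q] assms(2) by (auto simp: dist_real_def)
  have f: "real_of_int (fst a) \<le> fst q" "fst q < real_of_int (fst a) + 1"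
    "real_of_int (snd a) \<le> snd q" "snd q < real_of_int (snd a) + 1"
    using assms(3) by (auto simp: cell_def)
  have "real_of_int (fst a) - 1 \<le> real_of_int k / real n" "real_of_int k / real n \<le> real_of_int (fst a) + 2"
    using d f k by auto
  then have "real_of_int (int n * (fst a - 1)) \<le> real_of_int k" "real_of_int k \<le> real_of_int (int n * (fst a + 2))"
    using n_pos by (auto simp: field_simps)
  then have "int n * (fst a - 1) \<le> k" "k \<le> int n * (fst a + 2)" by (simp_all only: of_int_le_iff)
  moreover have "snd a - 1 \<le> b" "b \<le> snd a + 2" using d f k by auto
  ultimately show ?thesis unfolding near_centers_def k by (intro image_eqI[of _ _ "(k, b)"]) auto
qed

lemma card_near_centers: "finite (near_centers a)" "card (near_centers a) \<le> 16 * n"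
proof -
  let ?S = "{int n * (fst a - 1)..int n * (fst a + 2)} \<times> {snd a - 1..snd a + 2}"
  show "finite (near_centers a)" by (simp add: near_centers_def)
  have "card (near_centers a) \<le> card ?S" unfolding near_centers_def by (intro card_image_le) auto
  also have "\<dots> = nat (3 * int n + 1) * 4"
    unfolding card_cartesian_product card_atLeastAtMost_int by (simp add: algebra_simps)
  also have "\<dots> \<le> 16 * n" using n_pos by simp
  finally show "card (near_centers a) \<le> 16 * n" .
qed

text \<open>Consecutive disks are neighbours by \<open>row_neighbours\<close>, and
  \<open>no_passing\<close> excludes going on in the same direction, so a word alternates between
  two disks.\<close>

lemma words_1: "words 1 a \<subseteq> (\<lambda>(c, \<sigma>, k). row_word c \<sigma> k) ` (near_centers a \<times> {-1, 1} \<times> {0..n})"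
proof
  fix w assume "w \<in> words 1 a"
  then obtain q u v where X: "trajectory q u v" and a: "cell (q 0) = a" and w: "w = code q u v 0 (3/4)"
    by (auto simp: words_def)
  define H :: real where "H = 3/4"
  define K where "K = length (sorted_list_of_set (breaks u v 0 H))"
  define T where "T i = (if i = 0 then 0 else if i \<le> K then sorted_list_of_set (breaks u v 0 H) ! (i - 1) else H)" for i
  have H: "0 \<le> H" by (simp add: H_def)
  note ch = trajectory_chain[OF X H, folded K_def, folded T_def]
  have len: "length w = K" by (simp add: w code_def K_def H_def)
  define c where "c i = code q u v 0 H ! (i - 1)" for i
  have T_ge: "0 \<le> T i" and T_le: "T i \<le> H" if "i \<le> Suc K" for i
    using chain_mono[OF ch(1), of 0 i] chain_mono[OF ch(1), of i "Suc K"] that ch(2,3) by auto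
  have con: "c i \<in> C" "dist (c i) (q (T i)) = r" "(q (T i) - c i) \<bullet> v (T (i - 1)) < 0" "(q (T i) - c i) \<bullet> v (T i) > 0"
    if i: "1 \<le> i" "i \<le> K" for i
  proof -
    have adm: "admissible (q (T i)) (u (T i)) (v (T i))" by (rule trajectory_admissible[OF X])
    have ci: "center (q (T i)) = c i" and ne: "u (T i) \<noteq> v (T i)"
      using ch(9)[OF i] unfolding c_def by blast+
    note col = collision[OF adm ne, unfolded ci]
    show "c i \<in> C" "dist (c i) (q (T i)) = r" "(q (T i) - c i) \<bullet> v (T i) > 0" using col by blast+
    show "(q (T i) - c i) \<bullet> v (T (i - 1)) < 0" using col(3) ch(6)[OF i] by simp
  qed
  have step: "q (T (Suc i)) = q (T i) + (T (Suc i) - T i) *\<^sub>R v (T i)" "norm (v (T i)) = 1" if "i \<le> K" for i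
    using chain_step[OF ch(1) that] by blast+
  have len_pos: "0 < T (Suc i) - T i" if "1 \<le> i" "i < K" for i using ch(4)[OF that] h_pos by linarith
  have nb: "\<exists>\<sigma>\<in>{-1, 1::int}. c (Suc i) = c i + (real_of_int \<sigma> / real n, 0)" if i: "1 \<le> i" "i < K" for i
  proof (rule row_neighbours)
    show "c i \<in> C" "dist (c i) (q (T i)) = r" "(q (T i) - c i) \<bullet> v (T i) > 0" using con i by auto
    show "c (Suc i) \<in> C" using con[of "Suc i"] i by simp
    have e: "q (T i) + (T (Suc i) - T i) *\<^sub>R v (T i) = q (T (Suc i))" using step i by simp
    show "dist (c (Suc i)) (q (T i) + (T (Suc i) - T i) *\<^sub>R v (T i)) = r"
      "(q (T i) + (T (Suc i) - T i) *\<^sub>R v (T i) - c (Suc i)) \<bullet> v (T i) < 0"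
      unfolding e using con[of "Suc i"] i by simp_all
    show "norm (v (T i)) = 1" using step i by simp
    show "0 < T (Suc i) - T i" by (rule len_pos[OF i])
    have "0 < T i" using con ch(2) i T_ge[of i] chain_mono[OF ch(1), of 1 i]
    proof -
      have "T 1 \<in> breaks u v 0 H"
      proof -
        have "finite (breaks u v 0 H)" by (rule finite_breaks[OF X])
        then have "sorted_list_of_set (breaks u v 0 H) ! 0 \<in> breaks u v 0 H"
          using i K_def nth_mem[of 0 "sorted_list_of_set (breaks u v 0 H)"] by simp
        then show ?thesis using i by (simp add: T_def)
      qed
      then have "0 < T 1" by (simp add: breaks_def)
      then show ?thesis using chain_mono[OF ch(1), of 1 i] i by simp
    qed
    then show "T (Suc i) - T i < 3 / 4" using T_le[of "Suc i"] i by (simp add: H_def)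
    show "q (T i) + s *\<^sub>R v (T i) \<in> table" if s: "0 \<le> s" "s \<le> T (Suc i) - T i" for s
    proof (cases "s = T (Suc i) - T i")
      case True
      then show ?thesis using e trajectory_admissible[OF X, of "T (Suc i)"] by (simp add: admissible_def)
    next
      case False
      then have "q (T i + s) = q (T i) + (T i + s - T i) *\<^sub>R v (T i) \<and> v (T i + s) = v (T i)"
        using s i by (intro ch(5)) auto
      then have "q (T i) + s *\<^sub>R v (T i) = q (T i + s)" by simp
      then show ?thesis using trajectory_admissible[OF X, of "T i + s"] by (simp add: admissible_def)
    qed
  qed
  have alt: "c (Suc (Suc i)) = c i" if i: "1 \<le> i" "Suc i < K" for i
  proof -
    obtain \<sigma> where \<sigma>: "\<sigma> \<in> {-1, 1}" "c (Suc i) = c i + (real_of_int \<sigma> / real n, 0)" using nb[of i] i Suc_lessD by blast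
    obtain \<sigma>' where \<sigma>': "\<sigma>' \<in> {-1, 1}" "c (Suc (Suc i)) = c (Suc i) + (real_of_int \<sigma>' / real n, 0)" using nb[of "Suc i"] i le_SucI by blast
    let ?j = "Suc i"
    \<comment> \<open>\<open>no_passing\<close> is applied at the middle collision forwards and,
      with reversed velocity, backwards: the displacements to the previous and to the next disk both
      have positive product with the normal. If these disks lay on opposite sides, the displacements
      would add up to 0.\<close>
    have "(c (Suc ?j) - c ?j) \<bullet> (q (T ?j) - c ?j) > 0"
    proof (rule no_passing[where l = "T (Suc ?j) - T ?j" and v = "v (T ?j)"])
      show "dist (c ?j) (q (T ?j)) = r" "(q (T ?j) - c ?j) \<bullet> v (T ?j) > 0" using con[of ?j] i by auto
      show "0 < T (Suc ?j) - T ?j" using len_pos[of ?j] i by simp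
      show "dist (c (Suc ?j)) (q (T ?j) + (T (Suc ?j) - T ?j) *\<^sub>R v (T ?j)) = r"
        using con[of "Suc ?j"] step(1)[of ?j] i by simp
    qed
    moreover have "(c i - c ?j) \<bullet> (q (T ?j) - c ?j) > 0"
    proof (rule no_passing[where l = "T ?j - T i" and v = "- v (T i)"])
      show "dist (c ?j) (q (T ?j)) = r" "(q (T ?j) - c ?j) \<bullet> (- v (T i)) > 0" using con[of ?j] i by auto
      show "0 < T ?j - T i" using len_pos[of i] i by simp
      have "q (T ?j) + (T ?j - T i) *\<^sub>R (- v (T i)) = q (T i)" using step(1)[of i] i by simp
      then show "dist (c i) (q (T ?j) + (T ?j - T i) *\<^sub>R (- v (T i))) = r"
        using con[of i] i by simp
    qed
    ultimately have pos: "((c (Suc ?j) - c ?j) + (c i - c ?j)) \<bullet> (q (T ?j) - c ?j) > 0"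
      by (simp add: inner_add_left)
    have "(c (Suc ?j) - c ?j) + (c i - c ?j) = (real_of_int (\<sigma>' - \<sigma>) / real n, 0)"
      unfolding \<sigma>'(2) \<sigma>(2) by (simp add: diff_divide_distrib)
    then have "\<sigma>' \<noteq> \<sigma>" using pos by (auto simp: zero_prod_def[symmetric])
    then have "\<sigma>' = - \<sigma>" using \<sigma> \<sigma>' by auto
    then show ?thesis unfolding \<sigma>'(2) \<sigma>(2) by (simp add: zero_prod_def)
  qed
  \<comment> \<open>The window is shorter than \<open>n * h\<close>, which is close to 1, so at most
    \<open>n\<close> collisions fit into it.\<close>
  have Kn: "K \<le> n"
  proof -
    have "real n * h = 1 - 2 * (r * real n)" using n_pos by (simp add: h_def field_simps)
    then have "H < real n * h" using r_n by (simp add: H_def)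
    then have "H / h < real n" using h_pos by (simp add: field_simps)
    then have "real K < real n + 1" using code_length[OF X H] len w unfolding H_def by simp
    then show ?thesis by linarith
  qed
  have "w \<in> (\<lambda>(c, \<sigma>, k). row_word c \<sigma> k) ` (near_centers a \<times> {-1, 1} \<times> {0..n})"
  proof (cases "K = 0")
    case True
    then have "w = []" using len by simp
    moreover have "(real_of_int (int n * fst a) / real n, real_of_int (snd a)) \<in> near_centers a"
      unfolding near_centers_def by (intro image_eqI[of _ _ "(int n * fst a, snd a)"]) (auto intro!: mult_left_mono)
    ultimately show ?thesis
      by (intro image_eqI[of _ _ "((real_of_int (int n * fst a) / real n, real_of_int (snd a)), 1, 0)"])
        (auto simp: row_word_def)
  next
    case False
    then have K1: "1 \<le> K" by simp
    have "dist (c 1) (q 0) \<le> dist (c 1) (q (T 1)) + dist (q (T 1)) (q 0)" by (rule dist_triangle)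
    also have "\<dots> \<le> r + T 1" using con(2)[OF order_refl K1] trajectory_speed[OF X T_ge[of 1]] by (simp add: dist_norm)
    also have "\<dots> \<le> 1" using T_le[of 1] r_n by (simp add: H_def)
    finally have c1: "c 1 \<in> near_centers a" using con(1)[OF order_refl K1] a by (intro near_centersI)
    \<comment> \<open>A word with a single letter determines no direction; it is given the direction
      1.\<close>
    obtain \<sigma> where \<sigma>: "\<sigma> \<in> {-1, 1::int}" "1 < K \<longrightarrow> c 2 = c 1 + (real_of_int \<sigma> / real n, 0)"
    proof (cases "1 < K")
      case True
      then have "\<exists>\<sigma>\<in>{-1, 1::int}. c 2 = c 1 + (real_of_int \<sigma> / real n, 0)"
        using nb[of 1] by (simp only: numeral_2_eq_2 One_nat_def)
      then show thesis using that by blast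
    qed (use that[of 1] in simp)
    have ci: "c (Suc i) = (if even i then c 1 else c 1 + (real_of_int \<sigma> / real n, 0))" if "i < K" for i
      using that
    proof (induction i rule: less_induct)
      case (less i)
      show ?case
      proof (cases "i < 2")
        case True
        then have "i = 0 \<or> i = 1" by auto
        then show ?thesis using less.prems \<sigma>(2) by (auto simp: numeral_2_eq_2)
      next
        case False
        then obtain j where j: "i = Suc (Suc j)" by (metis add_2_eq_Suc le_Suc_ex not_less)
        then have "c (Suc i) = c (Suc j)" using alt[of "Suc j"] less.prems by simp
        then show ?thesis using less.IH[of j] less.prems j by simp
      qed
    qed
    have "w = row_word (c 1) \<sigma> K"
    proof (rule nth_equalityI)
      show "length w = length (row_word (c 1) \<sigma> K)" by (simp add: len row_word_def)
      fix i assume "i < length w"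
      then show "w ! i = row_word (c 1) \<sigma> K ! i" using ci[of i] len by (simp add: row_word_def w c_def H_def)
    qed
    then show ?thesis using c1 \<sigma>(1) Kn by (intro image_eqI[of _ _ "(c 1, \<sigma>, K)"]) auto
  qed
  then show "w \<in> (\<lambda>(c, \<sigma>, k). row_word c \<sigma> k) ` (near_centers a \<times> {-1, 1} \<times> {0..n})" .
qed

lemma card_words_1: "finite (words 1 a)" "card (words 1 a) \<le> 64 * n\<^sup>2"
proof -
  let ?S = "near_centers a \<times> {-1, 1::int} \<times> {0..n}"
  have fin: "finite ?S" using card_near_centers by simp
  then show "finite (words 1 a)" using words_1 finite_subset by blast
  have "card (words 1 a) \<le> card ?S" using surj_card_le[OF fin words_1] .
  also have "\<dots> = card (near_centers a) * (2 * Suc n)" by (simp add: card_cartesian_product)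
  also have "\<dots> \<le> (16 * n) * (2 * (2 * n))" using card_near_centers n_pos by (intro mult_mono) auto
  also have "\<dots> = 64 * n\<^sup>2" by (simp add: power2_eq_square)
  finally show "card (words 1 a) \<le> 64 * n\<^sup>2" .
qed

text \<open>In one window the particle moves by at most 3/4, so it ends in the initial square or in
  one of the eight around it. These nine squares and the 64 of \<open>card_words_1\<close> give the
  factor 576.\<close>

lemma words_Suc:
  "words (Suc M) a \<subseteq> (\<Union>b\<in>{fst a - 1..fst a + 1} \<times> {snd a - 1..snd a + 1}. (\<lambda>(x, y). x @ y) ` (words 1 a \<times> words M b))"
proof
  fix w assume "w \<in> words (Suc M) a"
  then obtain q u v where X: "trajectory q u v" and a: "cell (q 0) = a" and w: "w = code q u v 0 (3/4 * real (Suc M))"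
    by (auto simp: words_def)
  define q' u' v' where "q' t = q (t + 3/4)" and "u' t = u (t + 3/4)" and "v' t = v (t + 3/4)" for t
  have X': "trajectory q' u' v'" unfolding q'_def u'_def v'_def by (rule shift_trajectory[OF X])
  have e: "3/4 * real (Suc M) = 3/4 * real M + 3/4" by simp
  have "w = code q u v 0 (3/4) @ code q u v (3/4) (3/4 * real M + 3/4)"
    unfolding w e by (rule code_append[OF X]) auto
  moreover have "code q' u' v' 0 (3/4 * real M) = code q u v (0 + 3/4) (3/4 * real M + 3/4)"
    unfolding q'_def u'_def v'_def by (rule code_shift[OF X])
  ultimately have w': "w = code q u v 0 (3/4) @ code q' u' v' 0 (3/4 * real M)" by simp
  have "code q u v 0 (3/4) \<in> words 1 a" unfolding words_def using X a by force
  moreover have "code q' u' v' 0 (3/4 * real M) \<in> words M (cell (q' 0))" unfolding words_def using X' by blast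
  moreover have "cell (q' 0) \<in> {fst a - 1..fst a + 1} \<times> {snd a - 1..snd a + 1}"
  proof -
    have "dist (q' 0) (q 0) \<le> 3/4" unfolding q'_def dist_norm using trajectory_speed[OF X, of "3/4"] by simp
    then have "\<bar>fst (q' 0) - fst (q 0)\<bar> \<le> 3/4" "\<bar>snd (q' 0) - snd (q 0)\<bar> \<le> 3/4"
      using dist_fst_le[of "q' 0" "q 0"] dist_snd_le[of "q' 0" "q 0"] unfolding dist_real_def by linarith+
    then have "\<lfloor>fst (q 0)\<rfloor> - 1 \<le> \<lfloor>fst (q' 0)\<rfloor>" "\<lfloor>fst (q' 0)\<rfloor> \<le> \<lfloor>fst (q 0)\<rfloor> + 1"
      "\<lfloor>snd (q 0)\<rfloor> - 1 \<le> \<lfloor>snd (q' 0)\<rfloor>" "\<lfloor>snd (q' 0)\<rfloor> \<le> \<lfloor>snd (q 0)\<rfloor> + 1" by linarith+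
    then show ?thesis using a by (auto simp: cell_def)
  qed
  ultimately show "w \<in> (\<Union>b\<in>{fst a - 1..fst a + 1} \<times> {snd a - 1..snd a + 1}. (\<lambda>(x, y). x @ y) ` (words 1 a \<times> words M b))"
    unfolding w' by (intro UN_I[of "cell (q' 0)"]
        image_eqI[of _ _ "(code q u v 0 (3/4), code q' u' v' 0 (3/4 * real M))"]) auto
qed

lemma card_words: "finite (words M a) \<and> card (words M a) \<le> (576 * n\<^sup>2) ^ M"
proof (induction M arbitrary: a)
  case 0
  have "breaks u v 0 0 = {}" for u v by (auto simp: breaks_def)
  then have "words 0 a \<subseteq> {[]}" by (auto simp: words_def code_def)
  then show ?case using finite_subset card_mono[of "{[]}" "words 0 a"] by fastforce
next
  case (Suc M)
  let ?N = "{fst a - 1..fst a + 1} \<times> {snd a - 1..snd a + 1}"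
  let ?A = "\<lambda>b. (\<lambda>(x, y). x @ y) ` (words 1 a \<times> words M b)"
  have fin: "finite (\<Union>b\<in>?N. ?A b)" using Suc card_words_1 by blast
  have "card (words (Suc M) a) \<le> card (\<Union>b\<in>?N. ?A b)" using words_Suc fin by (rule card_mono[rotated])
  also have "\<dots> \<le> (\<Sum>b\<in>?N. card (?A b))" by (rule card_UN_le) simp
  also have "\<dots> \<le> (\<Sum>b\<in>?N. 64 * n\<^sup>2 * (576 * n\<^sup>2) ^ M)"
  proof (rule sum_mono)
    fix b
    have "card (?A b) \<le> card (words 1 a \<times> words M b)" using Suc card_words_1 by (intro card_image_le) blast
    also have "\<dots> \<le> 64 * n\<^sup>2 * (576 * n\<^sup>2) ^ M"
      unfolding card_cartesian_product using Suc card_words_1 by (intro mult_mono) auto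
    finally show "card (?A b) \<le> 64 * n\<^sup>2 * (576 * n\<^sup>2) ^ M" .
  qed
  also have "\<dots> = (576 * n\<^sup>2) ^ Suc M" by (simp add: card_cartesian_product)
  finally show ?case using finite_subset[OF words_Suc fin] by simp
qed

end

section \<open>The upper bound\<close>

lemma ln_mult_powers: "\<lbrakk>0 < a; 0 < b\<rbrakk> \<Longrightarrow> ln (a ^ i * b ^ j) = real i * ln a + real j * ln (b::real)"
  by (simp add: ln_mult_pos ln_realpow)

lemma upper_rate_limit:
  fixes A s L :: real
  assumes "0 < A" "0 < s"
  shows "(\<lambda>m::nat. ((4 / 3 * real m + 1) * L + 8 * ln (15 * (A * (4 / 3 * real m + 1)) ^ 5 / s\<^sup>2)) / real m)
    \<longlonglongrightarrow> 4 / 3 * L"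
  using assms by real_asymp

context disk_row begin

text \<open>The mesh is \<open>\<delta> / 2\<close> in each coordinate, so that two points of one
  cell are at distance at most \<open>\<delta>\<close>.\<close>

definition grid :: "real \<Rightarrow> point \<Rightarrow> int \<times> int" where
  "grid \<delta> z = (\<lfloor>2 * fst z / \<delta>\<rfloor>, \<lfloor>2 * snd z / \<delta>\<rfloor>)"

lemma grid_close:
  assumes "grid \<delta> z = grid \<delta> z'" "0 < \<delta>" shows "norm (z - z') \<le> \<delta>"
proof -
  have *: "\<bar>x - y\<bar> \<le> \<delta> / 2" if "\<lfloor>2 * x / \<delta>\<rfloor> = \<lfloor>2 * y / \<delta>\<rfloor>" for x y
  proof -
    have "\<bar>2 * x / \<delta> - 2 * y / \<delta>\<bar> \<le> 1" using that by linarith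
    moreover have "\<bar>2 * x / \<delta> - 2 * y / \<delta>\<bar> = \<bar>2 * x - 2 * y\<bar> / \<delta>"
      using assms(2) by (simp add: abs_divide flip: diff_divide_distrib)
    ultimately have "\<bar>2 * x - 2 * y\<bar> \<le> 1 * \<delta>" by (simp only: pos_divide_le_eq[OF assms(2)])
    then show ?thesis by linarith
  qed
  have "norm (z - z') \<le> \<bar>fst z - fst z'\<bar> + \<bar>snd z - snd z'\<bar>"
    using sqrt_sum_squares_le_sum_abs[of "fst z - fst z'" "snd z - snd z'"] by (simp add: norm_prod_def)
  then show ?thesis using *[of "fst z" "fst z'"] *[of "snd z" "snd z'"] assms(1) by (simp add: grid_def)
qed

lemma grid_range:
  assumes "\<bar>fst z\<bar> \<le> B" "\<bar>snd z\<bar> \<le> B" "0 < \<delta>"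
  shows "grid \<delta> z \<in> {- \<lceil>2 * B / \<delta>\<rceil>..\<lceil>2 * B / \<delta>\<rceil>} \<times> {- \<lceil>2 * B / \<delta>\<rceil>..\<lceil>2 * B / \<delta>\<rceil>}"
proof -
  have "\<lfloor>2 * x / \<delta>\<rfloor> \<in> {- \<lceil>2 * B / \<delta>\<rceil>..\<lceil>2 * B / \<delta>\<rceil>}" if "\<bar>x\<bar> \<le> B" for x
  proof -
    have "2 * x / \<delta> \<le> 2 * B / \<delta>" "- (2 * B / \<delta>) \<le> 2 * x / \<delta>"
      using that assms(3) by (simp_all add: field_simps)
    then show ?thesis by (simp, linarith)
  qed
  then show ?thesis using assms by (auto simp: grid_def)
qed

text \<open>Orbits are grouped by their collision word and by the grid cells of position and
  velocity at both ends. By \<open>trajectory_shadow\<close> and \<open>lebesgue_pairs\<close> a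
  group stays in one cover element at each integer time below \<open>m\<close>, so it lies in one
  element of the join. The eighth power comes from the eight coordinates of two phase
  points.\<close>

lemma finite_subcover:
  assumes cover: "\<U> \<in> open_covers (phase_space n r)"
  shows "\<exists>A>0. \<exists>s>0. \<forall>m. \<exists>\<V>\<subseteq>dynamical_join (phase_space n r) (billiard_flow n r 1) \<U> m.
    finite \<V> \<and> \<Union>\<V> = topspace (phase_space n r) \<and>
    real (card \<V>) \<le> (576 * (real n)\<^sup>2) ^ (4 * m div 3 + 1) * (15 * (A * real (4 * m div 3 + 1)) ^ 5 / s\<^sup>2) ^ 8"
proof -
  let ?X = "phase_space n r" and ?f = "billiard_flow n r 1"
  from lebesgue_pairs[OF cover] obtain \<kappa> where \<kappa>: "\<kappa> > 0"
    and leb0: "\<forall>q v v'. q \<in> table \<and> norm v = 1 \<and> mates q v v' \<longrightarrow>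
    (\<exists>A\<in>\<U>. \<forall>x y. (x, y) \<in> \<Lambda> \<and> dist x q < \<kappa> \<and> (dist y v < \<kappa> \<or> dist y v' < \<kappa>) \<longrightarrow> state x y \<in> A)"
    by (elim exE conjE)
  have leb: "\<exists>A\<in>\<U>. \<forall>x y. (x, y) \<in> \<Lambda> \<and> dist x q < \<kappa> \<and> (dist y v < \<kappa> \<or> dist y v' < \<kappa>) \<longrightarrow> state x y \<in> A"
    if "q \<in> table" "norm v = 1" "mates q v v'" for q v v'
    by (rule leb0[rule_format]) (intro conjI that)
  define \<epsilon> where "\<epsilon> = \<kappa> / 2"
  have \<epsilon>: "0 < \<epsilon>" "\<epsilon> < \<kappa>" using \<kappa> by (auto simp: \<epsilon>_def)
  from shadow_parameters[OF \<epsilon>(1)] obtain s where s: "s > 0" "s \<le> 1" and par: "\<forall>N K H \<delta> \<mu> \<eta> \<rho>. 1 \<le> N \<and> real K \<le> N \<and> 0 \<le> H \<and> H \<le> N \<and>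
     \<delta> = s\<^sup>2 / N ^ 4 \<and> \<mu> = max \<delta> (sqrt (4 * \<delta> / h)) \<and> \<eta> = \<epsilon> / (2 * N) \<and> \<rho> = sqrt (4 * r * \<delta> / \<eta>) \<longrightarrow>
     \<delta> + H * \<mu> + real K * (2 * \<delta> + sqrt (8 * r * \<delta>)) \<le> \<epsilon> \<and> real K * \<eta> + \<mu> \<le> \<epsilon> \<and>
     2 * (\<delta> + \<rho>) + \<rho> \<le> \<epsilon> \<and> 2 * (\<delta> + \<rho>) < h"
    by (elim exE conjE)
  \<comment> \<open>Chosen so that \<open>N = A * M\<close> bounds both the duration and, by
    \<open>code_length\<close>, the number of collisions.\<close>
  define A where "A = 1 / h + 2"
  have A: "2 \<le> A" using h_pos by (simp add: A_def)
  have "\<exists>\<V>\<subseteq>dynamical_join ?X ?f \<U> m. finite \<V> \<and> \<Union>\<V> = topspace ?X \<and>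
    real (card \<V>) \<le> (576 * (real n)\<^sup>2) ^ (4 * m div 3 + 1) * (15 * (A * real (4 * m div 3 + 1)) ^ 5 / s\<^sup>2) ^ 8" for m
  proof -
    \<comment> \<open>The least number of windows of length 3/4 whose total length exceeds
      \<open>m\<close>.\<close>
    define M where "M = 4 * m div 3 + 1"
    define H where "H = 3/4 * real M"
    define N where "N = A * real M"
    define \<delta> where "\<delta> = s\<^sup>2 / N ^ 4"
    have "4 * m < 3 * M" unfolding M_def by presburger
    then have mH: "real m < H" unfolding H_def by linarith
    have M1: "1 \<le> real M" by (simp add: M_def)
    have H0: "0 \<le> H" "H \<le> real M" by (auto simp: H_def)
    have NM: "2 * real M \<le> N" using A M1 unfolding N_def by (intro mult_right_mono) auto
    then have N: "1 \<le> N" "H \<le> N" using M1 H0 by auto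
    have \<delta>: "0 < \<delta>" using s N by (simp add: \<delta>_def)
    have KN: "real (length (code q u v 0 H)) \<le> N" if "trajectory q u v" for q u v
    proof -
      have "H / h \<le> real M / h" using H0 h_pos by (simp add: divide_right_mono)
      moreover have "N = real M / h + 2 * real M" by (simp add: N_def A_def algebra_simps)
      ultimately show ?thesis using code_length[OF that H0(1)] M1 by linarith
    qed
    define P where "P = (\<lambda>x (q, u, v). trajectory q u v \<and> x = state (q 0) (v 0) \<and> cell (q 0) = (0, 0))"
    have "\<forall>x\<in>topspace ?X. \<exists>y. P x y"
    proof
      fix x assume "x \<in> topspace ?X"
      then obtain q u v where "trajectory q u v" "x = state (q 0) (v 0)" "\<lfloor>fst (q 0)\<rfloor> = 0" "\<lfloor>snd (q 0)\<rfloor> = 0"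
        using state_trajectory by blast
      then show "\<exists>y. P x y" by (intro exI[of _ "(q, u, v)"]) (simp add: P_def cell_def)
    qed
    then obtain Y where Y: "\<forall>x\<in>topspace ?X. P x (Y x)" by (rule bchoice[THEN exE])
    define Q where "Q x = fst (Y x)" for x
    define U where "U x = fst (snd (Y x))" for x
    define V where "V x = snd (snd (Y x))" for x
    have tr: "trajectory (Q x) (U x) (V x)" "x = state (Q x 0) (V x 0)" "cell (Q x 0) = (0, 0)"
      if "x \<in> topspace ?X" for x
      using bspec[OF Y that] unfolding P_def Q_def U_def V_def by (auto split: prod.splits)
    define \<Phi> where "\<Phi> x = (code (Q x) (U x) (V x) 0 H, grid \<delta> (Q x 0), grid \<delta> (V x 0), grid \<delta> (Q x H), grid \<delta> (V x H))" for x
    have common: "\<exists>B\<in>\<U>. \<forall>x'\<in>topspace ?X. \<Phi> x' = \<Phi> x \<longrightarrow> (?f ^^ k) x' \<in> B"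
      if x: "x \<in> topspace ?X" and k: "k < m" for x k
    proof -
      let ?K = "length (code (Q x) (U x) (V x) 0 H)"
      define \<eta> where "\<eta> = \<epsilon> / (2 * N)"
      have \<eta>: "0 < \<eta>" using \<epsilon> N by (simp add: \<eta>_def)
      have t: "0 \<le> real k" "real k < H" using k mH by auto
      note pp = par[rule_format, of N ?K H \<delta> _ \<eta>, OF conjI[OF N(1) conjI[OF KN[OF tr(1)[OF x]] conjI[OF H0(1) conjI[OF N(2)
          conjI[OF \<delta>_def conjI[OF refl conjI[OF \<eta>_def refl]]]]]]]]
      from trajectory_shadow[OF tr(1)[OF x] H0(1) t refl refl \<eta> refl less_imp_le[OF \<delta>], of \<epsilon>] pp
      obtain y w1 w2 where y: "y \<in> table" "norm w1 = 1" "w2 = w1 \<or> (\<exists>c\<in>C. dist c y = r \<and> w2 = reflect c y w1)"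
        and sh: "\<And>q' u' v'. \<lbrakk>trajectory q' u' v'; code q' u' v' 0 H = code (Q x) (U x) (V x) 0 H;
          norm (Q x 0 - q' 0) \<le> \<delta>; norm (V x 0 - v' 0) \<le> \<delta>; norm (Q x H - q' H) \<le> \<delta>; norm (V x H - v' H) \<le> \<delta>\<rbrakk> \<Longrightarrow>
          norm (q' (real k) - y) \<le> \<epsilon> \<and> (norm (v' (real k) - w1) \<le> \<epsilon> \<or> norm (v' (real k) - w2) \<le> \<epsilon>)"
        by blast
      have "mates y w1 w2" using y(3) unfolding mates_def .
      from leb[OF y(1,2) this] obtain B where B: "B \<in> \<U>"
        "\<And>x y'. \<lbrakk>(x, y') \<in> \<Lambda>; dist x y < \<kappa>; dist y' w1 < \<kappa> \<or> dist y' w2 < \<kappa>\<rbrakk> \<Longrightarrow> state x y' \<in> B" by blast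
      have "(?f ^^ k) x' \<in> B" if x': "x' \<in> topspace ?X" "\<Phi> x' = \<Phi> x" for x'
      proof -
        have eqs: "code (Q x') (U x') (V x') 0 H = code (Q x) (U x) (V x) 0 H"
          "grid \<delta> (Q x 0) = grid \<delta> (Q x' 0)" "grid \<delta> (V x 0) = grid \<delta> (V x' 0)"
          "grid \<delta> (Q x H) = grid \<delta> (Q x' H)" "grid \<delta> (V x H) = grid \<delta> (V x' H)"
          using x'(2) by (simp_all add: \<Phi>_def)
        from sh[OF tr(1)[OF x'(1)] eqs(1) grid_close[OF eqs(2) \<delta>] grid_close[OF eqs(3) \<delta>] grid_close[OF eqs(4) \<delta>] grid_close[OF eqs(5) \<delta>]]
        have "dist (Q x' (real k)) y < \<kappa>" "dist (V x' (real k)) w1 < \<kappa> \<or> dist (V x' (real k)) w2 < \<kappa>"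
          using \<epsilon> unfolding dist_norm by linarith+
        then have "state (Q x' (real k)) (V x' (real k)) \<in> B"
          using admissible_lifted[OF trajectory_admissible[OF tr(1)[OF x'(1)]]] by (intro B(2))
        moreover have "(?f ^^ k) x' = state (Q x' (real k)) (V x' (real k))"
          using flow_iterate[OF tr(1)[OF x'(1)], of k] tr(2)[OF x'(1)] by simp
        ultimately show ?thesis by simp
      qed
      then show ?thesis using B(1) by blast
    qed
    define B where "B x k = (SOME B. B \<in> \<U> \<and> (\<forall>x'\<in>topspace ?X. \<Phi> x' = \<Phi> x \<longrightarrow> (?f ^^ k) x' \<in> B))" for x k
    have B: "B x k \<in> \<U>" "\<And>x'. \<lbrakk>x' \<in> topspace ?X; \<Phi> x' = \<Phi> x\<rbrakk> \<Longrightarrow> (?f ^^ k) x' \<in> B x k"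
      if "x \<in> topspace ?X" "k < m" for x k
      using someI_ex[of "\<lambda>B. B \<in> \<U> \<and> (\<forall>x'\<in>topspace ?X. \<Phi> x' = \<Phi> x \<longrightarrow> (?f ^^ k) x' \<in> B)"] common[OF that]
      unfolding B_def by blast+
    \<comment> \<open>A representative makes the chosen cover elements depend on the class only, so
      that the subcover has at most as many elements as there are classes.\<close>
    define rep where "rep \<gamma> = (SOME x. x \<in> topspace ?X \<and> \<Phi> x = \<gamma>)" for \<gamma>
    have rep: "rep (\<Phi> x) \<in> topspace ?X" "\<Phi> (rep (\<Phi> x)) = \<Phi> x" if "x \<in> topspace ?X" for x
      using someI[of "\<lambda>y. y \<in> topspace ?X \<and> \<Phi> y = \<Phi> x" x] that unfolding rep_def by auto
    define E where "E \<gamma> = {x \<in> topspace ?X. \<forall>k<m. (?f ^^ k) x \<in> B (rep \<gamma>) k}" for \<gamma>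
    define \<V> where "\<V> = E ` \<Phi> ` topspace ?X"
    have sub: "\<V> \<subseteq> dynamical_join ?X ?f \<U> m"
    proof
      fix W assume "W \<in> \<V>"
      then obtain x where "x \<in> topspace ?X" "W = E (\<Phi> x)" by (auto simp: \<V>_def)
      then have "W = {x' \<in> topspace ?X. \<forall>k<m. (?f ^^ k) x' \<in> B (rep (\<Phi> x)) k}" "\<forall>k<m. B (rep (\<Phi> x)) k \<in> \<U>"
        using B(1)[OF rep(1)] by (auto simp: E_def)
      then show "W \<in> dynamical_join ?X ?f \<U> m" unfolding dynamical_join_def by blast
    qed
    have un: "\<Union>\<V> = topspace ?X"
    proof
      show "\<Union>\<V> \<subseteq> topspace ?X" by (auto simp: \<V>_def E_def)
      show "topspace ?X \<subseteq> \<Union>\<V>"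
      proof
        fix x assume x: "x \<in> topspace ?X"
        then have "x \<in> E (\<Phi> x)" using B(2)[OF rep(1)[OF x] _ x] rep(2)[OF x] by (simp add: E_def)
        then show "x \<in> \<Union>\<V>" using x by (auto simp: \<V>_def)
      qed
    qed
    \<comment> \<open>Coordinates of positions stay within \<open>M + 2\<close> and those of
      velocities within 1, so one range of grid indices serves all eight.\<close>
    define b where "b = \<lceil>2 * (real M + 2) / \<delta>\<rceil>"
    let ?G = "{-b..b} \<times> {-b..b}"
    have range: "\<Phi> ` topspace ?X \<subseteq> words M (0, 0) \<times> ?G \<times> ?G \<times> ?G \<times> ?G"
    proof
      fix \<gamma> assume "\<gamma> \<in> \<Phi> ` topspace ?X"
      then obtain x where x: "x \<in> topspace ?X" "\<gamma> = \<Phi> x" by blast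
      note X = tr(1)[OF x(1)]
      have w: "code (Q x) (U x) (V x) 0 H \<in> words M (0, 0)" unfolding words_def H_def using X tr(3)[OF x(1)] by blast
      have "\<lfloor>fst (Q x 0)\<rfloor> = 0" "\<lfloor>snd (Q x 0)\<rfloor> = 0" using tr(3)[OF x(1)] by (auto simp: cell_def)
      then have q0: "\<bar>fst (Q x 0)\<bar> \<le> 1" "\<bar>snd (Q x 0)\<bar> \<le> 1" by linarith+
      have "dist (Q x H) (Q x 0) \<le> real M" using trajectory_speed[OF X H0(1)] H0(2) by (simp add: dist_norm)
      then have qH: "\<bar>fst (Q x H)\<bar> \<le> real M + 2" "\<bar>snd (Q x H)\<bar> \<le> real M + 2"
        using dist_fst_le[of "Q x H" "Q x 0"] dist_snd_le[of "Q x H" "Q x 0"] q0 unfolding dist_real_def by linarith+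
      have v: "\<bar>fst (V x t)\<bar> \<le> 1" "\<bar>snd (V x t)\<bar> \<le> 1" for t
      proof -
        have "norm (V x t) = 1" using trajectory_admissible[OF X, of t] by (simp add: admissible_def)
        then show "\<bar>fst (V x t)\<bar> \<le> 1" "\<bar>snd (V x t)\<bar> \<le> 1"
          using norm_fst_le[where x = "fst (V x t)" and y = "snd (V x t)"]
            norm_snd_le[where x = "fst (V x t)" and y = "snd (V x t)"] by auto
      qed
      have g: "grid \<delta> z \<in> ?G" if "\<bar>fst z\<bar> \<le> real M + 2" "\<bar>snd z\<bar> \<le> real M + 2" for z
        unfolding b_def using grid_range[OF that \<delta>] .
      have "grid \<delta> (Q x 0) \<in> ?G" using q0 by (intro g) auto
      moreover have "grid \<delta> (Q x H) \<in> ?G" using qH by (rule g)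
      moreover have "grid \<delta> (V x t) \<in> ?G" for t by (intro g) (rule order_trans[OF v(1)] order_trans[OF v(2)], simp)+
      ultimately show "\<gamma> \<in> words M (0, 0) \<times> ?G \<times> ?G \<times> ?G \<times> ?G"
        unfolding x(2) \<Phi>_def using w by blast
    qed
    have finw: "finite (words M (0, 0))" and cardw: "card (words M (0, 0)) \<le> (576 * n\<^sup>2) ^ M" using card_words by auto
    then have finS: "finite (words M (0, 0) \<times> ?G \<times> ?G \<times> ?G \<times> ?G)" by simp
    then have fin: "finite (\<Phi> ` topspace ?X)" using range finite_subset by blast
    have "card \<V> \<le> card (\<Phi> ` topspace ?X)" unfolding \<V>_def by (rule card_image_le[OF fin])
    also have "\<dots> \<le> card (words M (0, 0) \<times> ?G \<times> ?G \<times> ?G \<times> ?G)" by (rule card_mono[OF finS range])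
    also have "\<dots> = card (words M (0, 0)) * (nat (2 * b + 1)) ^ 8"
      by (simp add: card_cartesian_product power_numeral_reduce algebra_simps)
    also have "\<dots> \<le> (576 * n\<^sup>2) ^ M * (nat (2 * b + 1)) ^ 8" using cardw by simp
    finally have "real (card \<V>) \<le> real ((576 * n\<^sup>2) ^ M * (nat (2 * b + 1)) ^ 8)" by (simp only: of_nat_le_iff)
    also have "\<dots> = (576 * (real n)\<^sup>2) ^ M * real (nat (2 * b + 1)) ^ 8" by simp
    also have "\<dots> \<le> (576 * (real n)\<^sup>2) ^ M * (15 * N ^ 5 / s\<^sup>2) ^ 8"
    proof (intro mult_left_mono power_mono)
      have "0 \<le> 2 * (real M + 2) / \<delta>" using \<delta> by simp
      then have "0 \<le> b" unfolding b_def by linarith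
      then have "real (nat (2 * b + 1)) = 2 * real_of_int b + 1" by simp
      also have "\<dots> \<le> 4 * (real M + 2) / \<delta> + 3" unfolding b_def by linarith
      also have "\<dots> \<le> 12 * N / \<delta> + 3"
        using NM M1 \<delta> by (intro add_mono divide_right_mono) auto
      also have "12 * N / \<delta> = 12 * N ^ 5 / s\<^sup>2" by (simp add: \<delta>_def power_numeral_reduce)
      also have "3 \<le> 3 * N ^ 5 / s\<^sup>2"
      proof -
        have "s\<^sup>2 \<le> 1" using s by (simp add: power_le_one)
        moreover have "1 \<le> N ^ 5" using N by (simp add: one_le_power)
        ultimately have "s\<^sup>2 \<le> N ^ 5" by linarith
        then show ?thesis using s by (simp add: field_simps)
      qed
      finally show "real (nat (2 * b + 1)) \<le> 15 * N ^ 5 / s\<^sup>2" by (simp add: add_divide_distrib[symmetric])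
    qed auto
    finally have "real (card \<V>) \<le> (576 * (real n)\<^sup>2) ^ M * (15 * N ^ 5 / s\<^sup>2) ^ 8" .
    then show ?thesis using sub un fin unfolding M_def N_def \<V>_def by blast
  qed
  moreover have "A > 0" using A by simp
  ultimately show ?thesis using s(1) by blast
qed

lemma entropy_upper: "h_top n r \<le> ereal (4 / 3 * ln (576 * (real n)\<^sup>2))"
  unfolding h_top_def topological_entropy_def
proof (rule SUP_least)
  let ?X = "phase_space n r" and ?f = "billiard_flow n r 1" and ?L = "ln (576 * (real n)\<^sup>2)"
  fix \<U> assume cover: "\<U> \<in> open_covers ?X"
  obtain A s where A: "A > 0" "s > 0" and V: "\<And>m. \<exists>\<V>\<subseteq>dynamical_join ?X ?f \<U> m.
    finite \<V> \<and> \<Union>\<V> = topspace ?X \<and>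
    real (card \<V>) \<le> (576 * (real n)\<^sup>2) ^ (4 * m div 3 + 1) * (15 * (A * real (4 * m div 3 + 1)) ^ 5 / s\<^sup>2) ^ 8"
    using finite_subcover[OF cover] by blast
  define B where "B m = ((4 / 3 * real m + 1) * ?L + 8 * ln (15 * (A * (4 / 3 * real m + 1)) ^ 5 / s\<^sup>2)) / real m" for m
  have n1: "1 \<le> (real n)\<^sup>2" using n_pos by (simp add: one_le_power)
  have "cover_entropy ?X (dynamical_join ?X ?f \<U> m) / ereal (real m) \<le> ereal (B m)" if m: "0 < m" for m
  proof -
    let ?M = "4 * m div 3 + 1"
    obtain \<V> where \<V>: "\<V> \<subseteq> dynamical_join ?X ?f \<U> m" "finite \<V>" "\<Union>\<V> = topspace ?X"
      "real (card \<V>) \<le> (576 * (real n)\<^sup>2) ^ ?M * (15 * (A * real ?M) ^ 5 / s\<^sup>2) ^ 8" using V[of m] by blast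
    have Mle: "real ?M \<le> 4 / 3 * real m + 1" by linarith
    have M1: "1 \<le> real ?M" by simp
    have pos: "0 < 15 * (A * real ?M) ^ 5 / s\<^sup>2" using A M1 by simp
    \<comment> \<open>A subcover must be nonempty for \<open>ln\<close> to be monotone on its
      cardinality; a position halfway between two rows provides a state.\<close>
    have "topspace ?X \<noteq> {}"
    proof -
      have "(1 / (2 * real n), 1/2) \<in> table"
      proof -
        have "r \<le> dist c (1 / (2 * real n), 1/2)" if "c \<in> C" for c
        proof -
          obtain k b where c: "c = (real_of_int k / real n, real_of_int b)" using \<open>c \<in> C\<close> disk_centers_eq[OF n_pos] by auto
          have "b \<le> 0 \<or> 1 \<le> b" by linarith
          then have "real_of_int b \<le> 0 \<or> 1 \<le> real_of_int b" by linarith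
          then have "1/2 \<le> \<bar>real_of_int b - 1/2\<bar>" by linarith
          also have "\<dots> \<le> dist c (1 / (2 * real n), 1/2)"
            using dist_snd_le[of c "(1 / (2 * real n), 1/2)"] by (simp add: c dist_real_def)
          finally show ?thesis using r_n by linarith
        qed
        then show ?thesis by (simp add: in_table_iff)
      qed
      then have "((1 / (2 * real n), 1/2), (1, 0)) \<in> \<Lambda>" by (simp add: lifted_eq norm_Pair)
      then show ?thesis unfolding topspace_phase_space by blast
    qed
    then have "\<V> \<noteq> {}" using \<V>(3) by (metis Union_empty)
    then have c1: "0 < real (card \<V>)" using \<V>(2) by (simp add: card_gt_0_iff)
    have "ln (real (card \<V>)) \<le> ln ((576 * (real n)\<^sup>2) ^ ?M * (15 * (A * real ?M) ^ 5 / s\<^sup>2) ^ 8)"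
      using \<V>(4) c1 by (intro ln_mono) auto
    also have "\<dots> = real ?M * ?L + 8 * ln (15 * (A * real ?M) ^ 5 / s\<^sup>2)"
      using ln_mult_powers[OF _ pos, of "576 * (real n)\<^sup>2" ?M 8] n_pos by (simp only: of_nat_numeral zero_less_mult_iff zero_less_power of_nat_0_less_iff zero_less_numeral simp_thms)
    also have "\<dots> \<le> (4 / 3 * real m + 1) * ?L + 8 * ln (15 * (A * (4 / 3 * real m + 1)) ^ 5 / s\<^sup>2)"
    proof (intro add_mono mult_right_mono mult_left_mono)
      show "real ?M \<le> 4 / 3 * real m + 1" by (rule Mle)
      have "1 \<le> 576 * (real n)\<^sup>2" using n1 by linarith
      then show "0 \<le> ?L" by simp
      have "15 * (A * real ?M) ^ 5 / s\<^sup>2 \<le> 15 * (A * (4 / 3 * real m + 1)) ^ 5 / s\<^sup>2"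
        using A Mle M1 by (intro divide_right_mono mult_left_mono power_mono) auto
      then show "ln (15 * (A * real ?M) ^ 5 / s\<^sup>2) \<le> ln (15 * (A * (4 / 3 * real m + 1)) ^ 5 / s\<^sup>2)"
        using pos by (intro ln_mono) auto
    qed simp
    finally have le: "ln (real (card \<V>)) \<le> (4 / 3 * real m + 1) * ?L + 8 * ln (15 * (A * (4 / 3 * real m + 1)) ^ 5 / s\<^sup>2)" .
    have "cover_entropy ?X (dynamical_join ?X ?f \<U> m) \<le> ereal (ln (real (card \<V>)))"
      unfolding cover_entropy_def using \<V> by (intro INF_lower) auto
    then have "cover_entropy ?X (dynamical_join ?X ?f \<U> m) / ereal (real m) \<le> ereal (ln (real (card \<V>))) / ereal (real m)"
      using m by (intro ereal_divide_right_mono) auto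
    also have "\<dots> = ereal (ln (real (card \<V>)) / real m)" using m by simp
    also have "\<dots> \<le> ereal (B m)" using le m by (simp add: B_def divide_right_mono)
    finally show ?thesis .
  qed
  then have ev: "eventually (\<lambda>m. cover_entropy ?X (dynamical_join ?X ?f \<U> m) / ereal (real m) \<le> ereal (B m)) sequentially"
    using eventually_gt_at_top[of 0] by (rule eventually_mono[rotated])
  have "B \<longlonglongrightarrow> 4 / 3 * ?L" unfolding B_def using upper_rate_limit[OF A] .
  then have lim: "limsup (\<lambda>m. ereal (B m)) = ereal (4 / 3 * ?L)" by (intro lim_imp_Limsup) auto
  show "limsup (\<lambda>m. cover_entropy ?X (dynamical_join ?X ?f \<U> m) / ereal (real m)) \<le> ereal (4 / 3 * ?L)"
    using Limsup_mono[OF ev] unfolding lim .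
qed

end

section \<open>Trajectories with a prescribed itinerary\<close>

lemma norm_scaleR_sgn: "norm z *\<^sub>R sgn z = (z::'a::real_normed_vector)"
  by (cases "z = 0") (simp_all add: sgn_div_norm)

text \<open>Scaling by \<open>norm x\<close> splits the difference into \<open>x - y\<close> and a
  radial part, each of length at most \<open>norm (x - y)\<close>.\<close>

lemma sgn_lipschitz:
  fixes x y :: "'a::real_normed_vector"
  assumes "x \<noteq> 0" shows "norm (sgn x - sgn y) \<le> 2 * norm (x - y) / norm x"
proof -
  have "norm x *\<^sub>R (sgn x - sgn y) = (x - y) + (norm y - norm x) *\<^sub>R sgn y"
    by (simp add: scaleR_diff_right scaleR_diff_left norm_scaleR_sgn)
  then have "norm x * norm (sgn x - sgn y) = norm ((x - y) + (norm y - norm x) *\<^sub>R sgn y)"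
    by (metis norm_scaleR abs_norm_cancel)
  also have "\<dots> \<le> norm (x - y) + \<bar>norm y - norm x\<bar> * norm (sgn y)"
    by (rule order_trans[OF norm_triangle_ineq]) simp
  also have "\<dots> \<le> norm (x - y) + norm (x - y) * 1"
    using norm_triangle_ineq3[of x y] by (intro add_mono mult_mono) (auto simp: norm_sgn)
  finally show ?thesis using assms by (simp add: field_simps)
qed

lemma abs_snd_le_norm: "\<bar>snd (x::point)\<bar> \<le> norm x"
  using norm_snd_le[where x = "fst x" and y = "snd x"] by simp

text \<open>The centres are at distance between 1 and \<open>sqrt 2\<close>, and at least
  \<open>sqrt (5/4) > 1118/1000\<close> for a horizontal offset of at least 1/2; passing to contact
  points costs at most \<open>2 * r \<le> 2/1000\<close>. The slope 3/5 lies below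
  \<open>998/1000\<close> divided by \<open>3/2\<close>.\<close>

lemma flight_bounds:
  fixes p p' c c' :: point
  assumes p: "dist c p \<le> r" "dist c' p' \<le> r" and r: "1000 * r \<le> 1"
    and c: "\<bar>snd c' - snd c\<bar> = 1" "\<bar>fst c' - fst c\<bar> \<le> 1"
  shows "norm (p' - p) \<le> 3/2" "998/1000 \<le> norm (p' - p)"
    "3/5 \<le> (snd c' - snd c) * snd (sgn (p' - p))"
    "1/2 \<le> \<bar>fst c' - fst c\<bar> \<Longrightarrow> 1116/1000 \<le> norm (p' - p)"
proof -
  have n: "norm (c' - c) = sqrt ((fst c' - fst c)\<^sup>2 + 1)"
    using c(1) by (simp add: norm_prod_def)
  have tri: "norm (p' - p) \<le> norm (c' - c) + 2 * r" "norm (c' - c) \<le> norm (p' - p) + 2 * r"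
  proof -
    have "dist p' p \<le> dist p' c' + dist c' c + dist c p" "dist c' c \<le> dist c' p' + dist p' p + dist p c"
      by (meson add_mono dist_triangle order_refl order_trans)+
    then show "norm (p' - p) \<le> norm (c' - c) + 2 * r" "norm (c' - c) \<le> norm (p' - p) + 2 * r"
      using p by (simp_all add: dist_commute flip: dist_norm)
  qed
  have "(fst c' - fst c)\<^sup>2 \<le> 1" using c(2) by (simp add: abs_square_le_1)
  then have "norm (c' - c) \<le> 1415/1000" unfolding n by (intro real_le_lsqrt) (auto simp: power2_eq_square)
  then show le: "norm (p' - p) \<le> 3/2" using tri r by linarith
  let ?\<tau> = "snd c' - snd c"
  have sn: "?\<tau> * ?\<tau> = 1" using c(1) by (metis abs_mult_self_eq mult_1)
  have d: "\<bar>snd p - snd c\<bar> \<le> r" "\<bar>snd p' - snd c'\<bar> \<le> r"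
    using dist_snd_le[of c p] dist_snd_le[of c' p'] p by (auto simp: dist_real_def abs_minus_commute)
  have "?\<tau> * (snd p' - snd p) = 1 + ?\<tau> * ((snd p' - snd c') - (snd p - snd c))"
    using sn by (simp add: algebra_simps)
  moreover have "\<bar>?\<tau> * ((snd p' - snd c') - (snd p - snd c))\<bar> \<le> 2 * r"
    unfolding abs_mult c(1) using d by simp
  ultimately have s: "998/1000 \<le> ?\<tau> * (snd p' - snd p)" using r by linarith
  moreover have "?\<tau> * (snd p' - snd p) \<le> \<bar>snd (p' - p)\<bar>"
    using c(1) by (metis abs_ge_self abs_mult mult_1 snd_diff)
  ultimately show ge: "998/1000 \<le> norm (p' - p)" using abs_snd_le_norm[of "p' - p"] by linarith
  have "?\<tau> * snd (sgn (p' - p)) = ?\<tau> * (snd p' - snd p) / norm (p' - p)"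
    by (simp add: sgn_div_norm divide_inverse)
  then have eq: "?\<tau> * snd (sgn (p' - p)) = ?\<tau> * (snd p' - snd p) / norm (p' - p)" .
  have "3/5 * norm (p' - p) \<le> ?\<tau> * (snd p' - snd p)" using s le by linarith
  moreover have "0 < norm (p' - p)" using ge by linarith
  ultimately have "3/5 \<le> ?\<tau> * (snd p' - snd p) / norm (p' - p)" by (simp only: pos_le_divide_eq)
  then show "3/5 \<le> ?\<tau> * snd (sgn (p' - p))" unfolding eq .
  show "1116/1000 \<le> norm (p' - p)" if "1/2 \<le> \<bar>fst c' - fst c\<bar>"
  proof -
    have "(1/2)\<^sup>2 \<le> \<bar>fst c' - fst c\<bar>\<^sup>2" using that by (intro power_mono) auto
    then have "(1118/1000)\<^sup>2 \<le> (fst c' - fst c)\<^sup>2 + 1" by (simp add: power2_eq_square)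
    then have "1118/1000 \<le> norm (c' - c)" unfolding n by (rule real_le_rsqrt)
    then show ?thesis using tri r by linarith
  qed
qed

locale itinerary =
  fixes c :: "nat \<Rightarrow> point" and r :: real
  assumes r: "0 < r" "1000 * r \<le> 1"
    and rows: "\<And>i. snd (c (Suc i)) - snd (c i) = (if even i then 1 else - 1)"
    and slope: "\<And>i. \<bar>fst (c (Suc i)) - fst (c i)\<bar> \<le> 1"
begin

text \<open>The bisector of the directions to the two neighbouring points. Specular reflection at
  \<open>p i\<close> means that the outward normal points along it.\<close>

definition kick_dir :: "(nat \<Rightarrow> point) \<Rightarrow> nat \<Rightarrow> point" where
  "kick_dir p i = sgn (p (i - 1) - p i) + sgn (p (Suc i) - p i)"

text \<open>The first point has no predecessor; it is pinned at the top of its disk, so all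
  itineraries with the same first disk start at the same position.\<close>

definition improve :: "(nat \<Rightarrow> point) \<Rightarrow> nat \<Rightarrow> point" where
  "improve p i = c i + r *\<^sub>R (if i = 0 then (0, 1) else sgn (kick_dir p i))"

lemma steps:
  assumes p: "\<And>i. dist (c i) (p i) \<le> r"
  shows "norm (p (Suc i) - p i) \<le> 3/2" "998/1000 \<le> norm (p (Suc i) - p i)"
    "3/5 \<le> (if even i then 1 else - 1) * snd (sgn (p (Suc i) - p i))"
  using flight_bounds[OF p[of i] p[of "Suc i"] r(2)] rows[of i] slope[of i] by auto

text \<open>Both neighbours lie in the other row, so the vertical components of the two unit vectors
  have the same sign and cannot cancel.\<close>

lemma kick_dir_ge:
  assumes p: "\<And>i. dist (c i) (p i) \<le> r" and i: "i \<noteq> 0"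
  shows "1 \<le> norm (kick_dir p i)"
proof -
  obtain j where j: "i = Suc j" using i by (cases i) auto
  let ?\<tau> = "(if even j then - 1 else 1) :: real"
  have "p j - p (Suc j) = - (p (Suc j) - p j)" by simp
  then have "sgn (p j - p (Suc j)) = - sgn (p (Suc j) - p j)" by (metis sgn_minus)
  then have "3/5 \<le> ?\<tau> * snd (sgn (p j - p (Suc j)))" using steps(3)[OF p, of j] by auto
  moreover have "3/5 \<le> ?\<tau> * snd (sgn (p (Suc (Suc j)) - p (Suc j)))" using steps(3)[OF p, of "Suc j"] by auto
  ultimately have "6/5 \<le> ?\<tau> * snd (kick_dir p i)" by (simp add: kick_dir_def j algebra_simps)
  also have "\<dots> \<le> \<bar>snd (kick_dir p i)\<bar>" by auto
  finally show ?thesis using abs_snd_le_norm[of "kick_dir p i"] by linarith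
qed

lemma improve_in:
  assumes p: "\<And>i. dist (c i) (p i) \<le> r" shows "dist (c i) (improve p i) = r"
proof -
  have "kick_dir p i \<noteq> 0" if "i \<noteq> 0" using kick_dir_ge[OF p that] by auto
  then show ?thesis using r by (simp add: improve_def dist_norm norm_sgn)
qed

text \<open>The normal depends on the points with Lipschitz constant at most 20, and it is
  multiplied by a radius of at most 1/1000. The error bound is uniform over all indices, which suits
  infinite itineraries.\<close>

lemma improve_contracts:
  assumes p: "\<And>i. dist (c i) (p i) \<le> r" and p': "\<And>i. dist (c i) (p' i) \<le> r"
    and e: "\<And>i. norm (p i - p' i) \<le> e"
  shows "norm (improve p i - improve p' i) \<le> e / 2"
proof (cases "i = 0")
  case True
  then show ?thesis using order_trans[OF norm_ge_zero e[of 0]] by (simp add: improve_def)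
next
  case False
  then obtain j where j: "i = Suc j" by (cases i) auto
  have e0: "0 \<le> e" using order_trans[OF norm_ge_zero e[of 0]] .
  have sg: "norm (sgn (p a - p b) - sgn (p' a - p' b)) \<le> 5 * e" if "998/1000 \<le> norm (p a - p b)" for a b
  proof -
    have "norm ((p a - p b) - (p' a - p' b)) = norm ((p a - p' a) - (p b - p' b))" by (simp add: algebra_simps)
    also have "\<dots> \<le> 2 * e" using norm_triangle_ineq4[of "p a - p' a" "p b - p' b"] e[of a] e[of b] by linarith
    finally have le: "norm ((p a - p b) - (p' a - p' b)) \<le> 2 * e" .
    have "p a - p b \<noteq> 0" using that by auto
    then have "norm (sgn (p a - p b) - sgn (p' a - p' b)) \<le> 2 * norm ((p a - p b) - (p' a - p' b)) / norm (p a - p b)"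
      by (rule sgn_lipschitz)
    also have "\<dots> \<le> 2 * (2 * e) / (998/1000)"
      using le that e0 by (intro frac_le) auto
    finally show ?thesis using e0 by simp
  qed
  have "998/1000 \<le> norm (p j - p i)" using steps(2)[OF p, of j] by (simp add: j norm_minus_commute)
  moreover have "998/1000 \<le> norm (p (Suc i) - p i)" using steps(2)[OF p, of i] .
  ultimately have "norm ((sgn (p j - p i) - sgn (p' j - p' i)) + (sgn (p (Suc i) - p i) - sgn (p' (Suc i) - p' i))) \<le> 5 * e + 5 * e"
    using sg by (intro order_trans[OF norm_triangle_ineq] add_mono) auto
  moreover have "kick_dir p i - kick_dir p' i = (sgn (p j - p i) - sgn (p' j - p' i)) + (sgn (p (Suc i) - p i) - sgn (p' (Suc i) - p' i))"
    by (simp add: kick_dir_def j)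
  ultimately have k: "norm (kick_dir p i - kick_dir p' i) \<le> 10 * e" by simp
  have k1: "1 \<le> norm (kick_dir p i)" by (rule kick_dir_ge[OF p False])
  then have "kick_dir p i \<noteq> 0" by auto
  then have "norm (sgn (kick_dir p i) - sgn (kick_dir p' i)) \<le> 2 * norm (kick_dir p i - kick_dir p' i) / norm (kick_dir p i)"
    by (rule sgn_lipschitz)
  also have "\<dots> \<le> 2 * (10 * e) / 1" using k k1 e0 by (intro frac_le) auto
  finally have s: "norm (sgn (kick_dir p i) - sgn (kick_dir p' i)) \<le> 20 * e" by simp
  have "improve p i - improve p' i = r *\<^sub>R (sgn (kick_dir p i) - sgn (kick_dir p' i))"
    using False by (simp add: improve_def scaleR_diff_right)
  then have "norm (improve p i - improve p' i) = r * norm (sgn (kick_dir p i) - sgn (kick_dir p' i))" using r by simp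
  also have "\<dots> \<le> (1/1000) * (20 * e)" using s r by (intro mult_mono) auto
  finally show ?thesis using e0 by simp
qed

lemma orbit_exists:
  "\<exists>p. (\<forall>i. dist (c i) (p i) = r) \<and> p 0 = c 0 + (0, r) \<and>
     (\<forall>i. i \<noteq> 0 \<longrightarrow> p i - c i = r *\<^sub>R sgn (kick_dir p i) \<and> kick_dir p i \<noteq> 0)"
proof -
  \<comment> \<open>The iteration starts at the centres, which lie in the closed disks;
    \<open>improve_in\<close> keeps it there.\<close>
  define x where "x k = (improve ^^ k) c" for k
  have x0: "x 0 = c" and xS: "x (Suc k) = improve (x k)" for k by (simp_all add: x_def)
  have ball: "dist (c i) (x k i) \<le> r" for k i
  proof (induction k arbitrary: i)
    case (Suc k)
    then show ?case using improve_in[of "x k"] by (simp add: xS)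
  qed (use r in \<open>simp add: x0\<close>)
  have geo: "norm (x (Suc k) i - x k i) \<le> r * (1/2) ^ k" for k i
  proof (induction k arbitrary: i)
    case 0
    then show ?case using improve_in[of c i] r by (simp add: x0 xS dist_norm norm_minus_commute)
  next
    case (Suc k)
    have "norm (improve (x (Suc k)) i - improve (x k) i) \<le> (r * (1/2) ^ k) / 2"
      by (rule improve_contracts[OF ball ball Suc])
    then show ?case by (simp add: xS)
  qed
  have "\<exists>l. (\<lambda>k. x k i) \<longlonglongrightarrow> l" for i
  proof -
    have "summable (\<lambda>k. x (Suc k) i - x k i)"
    proof (rule summable_comparison_test')
      show "summable (\<lambda>k. r * (1/2::real) ^ k)" by (intro summable_mult summable_geometric) simp
    qed (rule geo)
    then have "(\<lambda>k. \<Sum>j<k. x (Suc j) i - x j i) \<longlonglongrightarrow> (\<Sum>k. x (Suc k) i - x k i)"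
      by (rule summable_LIMSEQ)
    then have "(\<lambda>k. x k i - x 0 i) \<longlonglongrightarrow> (\<Sum>k. x (Suc k) i - x k i)"
      unfolding sum_lessThan_telescope[of "\<lambda>k. x k i"] .
    then have "(\<lambda>k. (x k i - x 0 i) + x 0 i) \<longlonglongrightarrow> (\<Sum>k. x (Suc k) i - x k i) + x 0 i"
      by (intro tendsto_add tendsto_const)
    then have "(\<lambda>k. x k i) \<longlonglongrightarrow> (\<Sum>k. x (Suc k) i - x k i) + x 0 i" by simp
    then show ?thesis by blast
  qed
  then obtain p where lim: "\<And>i. (\<lambda>k. x k i) \<longlonglongrightarrow> p i" by metis
  have pb: "dist (c i) (p i) \<le> r" for i
    by (rule LIMSEQ_le_const2[OF tendsto_dist[OF tendsto_const lim]]) (use ball in blast)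
  have kd: "kick_dir p i \<noteq> 0" if "i \<noteq> 0" for i using kick_dir_ge[OF pb that] by auto
  have eq: "p i = improve p i" for i
  proof (rule LIMSEQ_unique[OF LIMSEQ_Suc[OF lim]])
    show "(\<lambda>k. x (Suc k) i) \<longlonglongrightarrow> improve p i"
    proof (cases "i = 0")
      case False
      then obtain j where j: "i = Suc j" by (cases i) auto
      have "p j - p i \<noteq> 0" "p (Suc i) - p i \<noteq> 0"
        using steps(2)[OF pb, of j] steps(2)[OF pb, of i] by (auto simp: j norm_minus_commute)
      then have "(\<lambda>k. kick_dir (x k) i) \<longlonglongrightarrow> kick_dir p i"
        unfolding kick_dir_def j by (auto intro!: tendsto_intros lim)
      then show ?thesis using False kd by (auto simp: xS improve_def intro!: tendsto_intros)
    qed (simp add: xS improve_def)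
  qed
  have "dist (c i) (p i) = r" for i using improve_in[OF pb, of i] eq[of i] by simp
  moreover have "p 0 = c 0 + (0, r)" using eq[of 0] by (simp add: improve_def)
  moreover have "p i - c i = r *\<^sub>R sgn (kick_dir p i) \<and> kick_dir p i \<noteq> 0" if "i \<noteq> 0" for i
    using eq[of i] kd[OF that] that by (simp add: improve_def)
  ultimately show ?thesis by blast
qed

end

section \<open>Realizing a reflecting polygon as a billiard trajectory\<close>

context disk_row begin

text \<open>The fixed point obeys the reflection law at the prescribed disks; it remains to see that
  the flights enter no disk on the way. Within \<open>h\<close> of either end this is
  \<open>contact_leg\<close>, and in between the flight is out of reach of both rows.\<close>

lemma itinerary_trajectory:
  assumes it: "itinerary c r" and C: "\<And>i. c i \<in> C" and row0: "snd (c 0) = 0"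
  shows "\<exists>q u v p w T. trajectory q u v \<and> T 0 = 0 \<and> p 0 = c 0 + (0, r) \<and> q 0 = p 0 \<and>
    (\<forall>K. chain K T p w c) \<and> (\<forall>i. dist (c i) (p i) = r) \<and> (\<forall>i. w i = sgn (p (Suc i) - p i)) \<and>
    (\<forall>i. T (Suc i) - T i = norm (p (Suc i) - p i)) \<and>
    (\<forall>i t. T i \<le> t \<and> t < T (Suc i) \<longrightarrow> q t = p i + (t - T i) *\<^sub>R w i \<and> v t = w i)"
proof -
  interpret itinerary c r by (rule it)
  obtain p where p: "\<And>i. dist (c i) (p i) = r" "p 0 = c 0 + (0, r)"
    and kick: "\<And>i. i \<noteq> 0 \<Longrightarrow> p i - c i = r *\<^sub>R sgn (kick_dir p i)" "\<And>i. i \<noteq> 0 \<Longrightarrow> kick_dir p i \<noteq> 0"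
    using orbit_exists by blast
  have ple: "\<And>i. dist (c i) (p i) \<le> r" using p by simp
  define L where "L i = norm (p (Suc i) - p i)" for i
  define w where "w i = sgn (p (Suc i) - p i)" for i
  define T where "T k = (\<Sum>j<k. L j)" for k
  have L: "998/1000 \<le> L i" for i using steps(2)[OF ple] by (simp add: L_def)
  then have Lpos: "0 < L i" for i by (rule less_le_trans[rotated]) simp
  have w1: "norm (w i) = 1" for i using Lpos[of i] by (auto simp: w_def norm_sgn L_def)
  have step: "p (Suc i) = p i + L i *\<^sub>R w i" for i by (simp add: w_def L_def norm_scaleR_sgn)
  have up: "3/5 \<le> (if even i then 1 else - 1) * snd (w i)" for i using steps(3)[OF ple] by (simp add: w_def)
  have kd: "kick_dir p (Suc i) = w (Suc i) - w i" for i
  proof -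
    have "p i - p (Suc i) = - (p (Suc i) - p i)" by simp
    then have "sgn (p i - p (Suc i)) = - w i" unfolding w_def by (metis sgn_minus)
    then show ?thesis by (simp add: kick_dir_def w_def)
  qed
  have nD: "norm (w (Suc i) - w i) > 0" for i using kick(2)[of "Suc i"] by (simp add: kd)
  have pc: "p (Suc i) - c (Suc i) = (r / norm (w (Suc i) - w i)) *\<^sub>R (w (Suc i) - w i)" for i
    using kick(1)[of "Suc i"] by (simp add: kd sgn_div_norm divide_inverse)
  have wD: "w i \<bullet> (w (Suc i) - w i) = - (norm (w (Suc i) - w i))\<^sup>2 / 2" for i
  proof -
    have "w i \<bullet> w i = 1" "w (Suc i) \<bullet> w (Suc i) = 1" using w1 by (simp_all add: norm_eq_1)
    then show ?thesis by (simp add: power2_norm_eq_inner inner_diff_left inner_diff_right inner_commute)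
  qed
  have incoming: "(p (Suc i) - c (Suc i)) \<bullet> w i < 0" for i
    unfolding pc using wD[of i] nD[of i] r_pos' by (simp add: inner_commute power2_eq_square)
  have refl: "w (Suc i) = reflect (c (Suc i)) (p (Suc i)) (w i)" for i
  proof -
    have "reflect (c (Suc i)) (p (Suc i)) (w i) - w i =
        (- 2 * ((p (Suc i) - c (Suc i)) \<bullet> w i) / r\<^sup>2) *\<^sub>R (p (Suc i) - c (Suc i))"
      by (rule reflect_diff[OF p(1) r_pos'])
    also have "\<dots> = w (Suc i) - w i"
      unfolding pc using wD[of i] nD[of i] r_pos' by (simp add: inner_commute power2_eq_square)
    finally show ?thesis by simp
  qed
  have tab: "p i \<in> table" for i
    unfolding in_table_iff
  proof
    fix c' assume c': "c' \<in> C"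
    show "r \<le> dist c' (p i)"
    proof (cases "c' = c i")
      case False
      then have "1 / real n \<le> dist c' (c i)" using separated c' C by blast
      then show ?thesis using dist_triangle[of c' "c i" "p i"] p(1)[of i] two_r by (simp add: dist_commute)
    qed (use p in simp)
  qed
  \<comment> \<open>The starting point is a contact too; its incoming velocity is chosen so that
    reflection produces \<open>w 0\<close>.\<close>
  define U where "U i = (case i of 0 \<Rightarrow> reflect (c 0) (p 0) (w 0) | Suc j \<Rightarrow> w j)" for i
  have adm: "admissible (p i) (U i) (w i)" for i
  proof -
    have un: "c' = c i" if "c' \<in> C" "dist c' (p i) = r" for c' using contact_unique[OF that(1) C that(2) p(1)] .
    have "norm (U i) = 1 \<and> (p i - c i) \<bullet> U i \<le> 0 \<and> w i = reflect (c i) (p i) (U i)"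
    proof (cases i)
      case 0
      have ne: "p 0 \<noteq> c 0" using contact_ne p by blast
      have "(p 0 - c 0) \<bullet> w 0 = r * snd (w 0)" by (simp add: p(2) inner_prod_def)
      then have "(p 0 - c 0) \<bullet> w 0 \<ge> 0" using up[of 0] r_pos' by simp
      then show ?thesis using 0 w1 inner_reflect[OF ne] norm_reflect[OF ne] reflect_reflect[OF ne] by (simp add: U_def)
    next
      case (Suc j)
      then show ?thesis using w1 incoming[of j] refl[of j] by (simp add: U_def)
    qed
    then show ?thesis unfolding admissible_def using tab w1 un p(1) C by blast
  qed
  \<comment> \<open>With slope at least 3/5, a flight of length \<open>h\<close> moves at least
    \<open>2 * r\<close> away from the row, from \<open>- r\<close> at worst to
    \<open>r\<close>.\<close>
  have h_big: "2 * r \<le> 3/5 * h"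
  proof -
    have "1000 * r \<le> 1 / real n" using r_n n_pos by (simp add: field_simps)
    then have "1000 * r \<le> h + 2 * r" by (simp add: h_def)
    then show ?thesis using r_pos' by linarith
  qed
  have rowc: "snd (c i) = (if even i then 0 else 1)" for i
  proof (induction i)
    case (Suc i)
    then show ?case using rows[of i] by (auto split: if_splits)
  qed (use row0 in simp)
  have leg: "p i + s *\<^sub>R w i \<in> table" if s: "0 \<le> s" "s \<le> L i" for i s
  proof -
    consider "s \<le> h" | "L i - s \<le> h" | "h \<le> s" "h \<le> L i - s" by linarith
    then show ?thesis
    proof cases
      case 1
      then show ?thesis using contact_leg[OF adm C p(1) s(1)] by blast
    next
      case 2
      have "p (Suc i) + (L i - s) *\<^sub>R (- U (Suc i)) \<in> table"
        using contact_leg[OF admissible_reverse[OF adm] C p(1), of "L i - s" "Suc i"] 2 s by simp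
      then show ?thesis by (simp add: U_def step algebra_simps)
    next
      case 3
      have y: "snd (p i + s *\<^sub>R w i) = snd (p i) + s * snd (w i)"
        "snd (p i + s *\<^sub>R w i) = snd (p (Suc i)) - (L i - s) * snd (w i)" by (simp_all add: step algebra_simps)
      have d: "\<bar>snd (p i) - snd (c i)\<bar> \<le> r" for i
        using dist_snd_le[of "c i" "p i"] p(1)[of i] by (simp add: dist_real_def abs_minus_commute)
      have "3/5 * h \<le> s * ((if even i then 1 else - 1) * snd (w i))"
        "3/5 * h \<le> (L i - s) * ((if even i then 1 else - 1) * snd (w i))"
        using mult_mono[OF 3(1) up[of i]] mult_mono[OF 3(2) up[of i]] s h_pos by (auto simp: mult.commute)
      then have "r \<le> snd (p i + s *\<^sub>R w i) \<and> snd (p i + s *\<^sub>R w i) \<le> 1 - r"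
        using d[of i] d[of "Suc i"] rowc[of i] rowc[of "Suc i"] h_big y by (cases "even i") auto
      then show ?thesis unfolding in_table_iff
      proof (intro ballI)
        fix c' assume "c' \<in> C" and y: "r \<le> snd (p i + s *\<^sub>R w i) \<and> snd (p i + s *\<^sub>R w i) \<le> 1 - r"
        then obtain k b where c': "c' = (real_of_int k / real n, real_of_int b)" using disk_centers_eq[OF n_pos] by auto
        have "b \<le> 0 \<or> 1 \<le> b" by linarith
        then have "real_of_int b \<le> 0 \<or> 1 \<le> real_of_int b" by linarith
        then have "r \<le> \<bar>snd c' - snd (p i + s *\<^sub>R w i)\<bar>" unfolding c' snd_conv using y by linarith
        then show "r \<le> dist c' (p i + s *\<^sub>R w i)"
          using dist_snd_le[of c' "p i + s *\<^sub>R w i"] unfolding dist_real_def by linarith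
      qed
    qed
  qed
  have unbounded: "\<exists>k. B < (\<Sum>j<k. L j)" for B
  proof -
    obtain k where k: "B < real k * (998/1000)" using reals_Archimedean3[of "998/1000"] by auto
    have "real k * (998/1000) \<le> (\<Sum>j<k. L j)" using sum_mono[of "{..<k}" "\<lambda>_. 998/1000" L] L by simp
    then show ?thesis using k by (intro exI[of _ k]) linarith
  qed
  have US: "U (Suc k) = w k" for k by (simp add: U_def)
  obtain q u v where f0: "q 0 = p 0" and f: "\<forall>t\<ge>0. admissible (q t) (u t) (v t) \<and> motion_right q u v t" "\<forall>t>0. motion_left q u v t"
    and fl: "\<forall>k s. 0 \<le> s \<and> s < L k \<longrightarrow> q (T k + s) = p k + s *\<^sub>R w k \<and> v (T k + s) = w k"
    using forward_of_legs[of p U w L, OF adm Lpos leg step US unbounded] unfolding T_def by blast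
  obtain q' u' v' where tr: "trajectory q' u' v'" and ag: "\<forall>t\<ge>0. q' t = q t \<and> u' t = u t \<and> v' t = v t"
    using trajectory_extend[OF f] by blast
  have TS: "T (Suc i) = T i + L i" for i by (simp add: T_def)
  have T0: "0 \<le> T i" for i unfolding T_def using Lpos less_imp_le by (intro sum_nonneg) auto
  have "chain K T p w c" for K unfolding chain_def
  proof (intro conjI allI impI)
    show "T i \<le> T (Suc i)" "p (Suc i) = p i + (T (Suc i) - T i) *\<^sub>R w i" "norm (w i) = 1" for i
      using Lpos[of i] step[of i] w1[of i] by (simp_all add: TS)
    show "c i \<in> C" "dist (c i) (p i) = r" for i by (rule C p)+
    fix i assume "1 \<le> i \<and> i \<le> K"
    then obtain j where "i = Suc j" by (cases i) auto
    then show "w i - w (i - 1) = (norm (w i - w (i - 1)) / r) *\<^sub>R (p i - c i)"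
      using nD[of j] r_pos' by (simp add: pc)
  qed
  moreover have "q' t = p i + (t - T i) *\<^sub>R w i \<and> v' t = w i" if "T i \<le> t \<and> t < T (Suc i)" for i t
  proof -
    have "0 \<le> t" using T0[of i] that by linarith
    moreover have "q (T i + (t - T i)) = p i + (t - T i) *\<^sub>R w i \<and> v (T i + (t - T i)) = w i"
      using fl[rule_format, of "t - T i" i] that by (simp add: TS)
    ultimately show ?thesis using ag by simp
  qed
  moreover have "T 0 = 0" "q' 0 = p 0" using ag f0 by (auto simp: T_def)
  moreover have "T (Suc i) - T i = norm (p (Suc i) - p i)" for i by (simp add: TS L_def)
  ultimately show ?thesis using tr p w_def by blast
qed

end

section \<open>The lower bound\<close>

text \<open>No element of \<open>\<W>\<close> contains two of the points, so choosing an element for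
  each point is an injection into every subcover.\<close>

lemma cover_entropy_lower:
  assumes fin: "finite I" and x: "\<And>i. i \<in> I \<Longrightarrow> x i \<in> topspace X" and ne: "I \<noteq> {}"
    and sep: "\<And>i j W. \<lbrakk>i \<in> I; j \<in> I; W \<in> \<W>; x i \<in> W; x j \<in> W\<rbrakk> \<Longrightarrow> i = j"
  shows "ereal (ln (real (card I))) \<le> cover_entropy X \<W>"
  unfolding cover_entropy_def
proof (rule INF_greatest)
  fix \<V> assume "\<V> \<in> {\<V>. \<V> \<subseteq> \<W> \<and> finite \<V> \<and> \<Union>\<V> = topspace X}"
  then have \<V>: "\<V> \<subseteq> \<W>" "finite \<V>" "\<Union>\<V> = topspace X" by auto
  have "\<forall>i\<in>I. \<exists>W\<in>\<V>. x i \<in> W" using x \<V>(3) by blast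
  then obtain W where W: "\<And>i. i \<in> I \<Longrightarrow> W i \<in> \<V>" "\<And>i. i \<in> I \<Longrightarrow> x i \<in> W i" by metis
  have "inj_on W I"
  proof (rule inj_onI)
    fix i j assume ij: "i \<in> I" "j \<in> I" "W i = W j"
    then have "x j \<in> W i" using W(2)[of j] by simp
    then show "i = j" using sep[OF ij(1,2) _ W(2)[OF ij(1)]] W(1)[OF ij(1)] \<V>(1) by blast
  qed
  then have "card I \<le> card \<V>" using card_inj_on_le[of W I \<V>] W(1) \<V>(2) by blast
  moreover have "0 < card I" using fin ne by (simp add: card_gt_0_iff)
  ultimately show "ereal (ln (real (card I))) \<le> ereal (ln (real (card \<V>)))" by (simp add: ln_mono)
qed

section \<open>A cover that detects the disk approached\<close>

context disk_row begin

text \<open>Phase points between the rows whose straight continuation meets the disk of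
  \<open>c\<close> within time 2. The image form makes compactness immediate; the heights from 1/50
  to 49/50 keep away from all disks, so that no reflection identifies these points with
  others.\<close>

definition midflight :: "point \<Rightarrow> (point \<times> point) set" where
  "midflight c = (\<lambda>(p, s, v). (p - s *\<^sub>R v, v)) ` (cball c r \<times> {0..2} \<times> sphere 0 1) \<inter>
     {z. 1/50 \<le> snd (fst z) \<and> snd (fst z) \<le> 49/50}"

definition midflight_states :: "point \<Rightarrow> (point \<times> point) set set" where
  "midflight_states c = {state q v | q v. (q, v) \<in> midflight c}"

lemma midflight_iff:
  "(q, v) \<in> midflight c \<longleftrightarrow> norm v = 1 \<and> 1/50 \<le> snd q \<and> snd q \<le> 49/50 \<and> (\<exists>s\<in>{0..2}. dist c (q + s *\<^sub>R v) \<le> r)"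
proof
  assume "(q, v) \<in> midflight c"
  then obtain p s where ps: "dist c p \<le> r" "s \<in> {0..2}" "norm v = 1" "q = p - s *\<^sub>R v" "1/50 \<le> snd q" "snd q \<le> 49/50"
    by (auto simp: midflight_def)
  then have "dist c (q + s *\<^sub>R v) \<le> r" by simp
  then show "norm v = 1 \<and> 1/50 \<le> snd q \<and> snd q \<le> 49/50 \<and> (\<exists>s\<in>{0..2}. dist c (q + s *\<^sub>R v) \<le> r)"
    using ps by blast
next
  assume A: "norm v = 1 \<and> 1/50 \<le> snd q \<and> snd q \<le> 49/50 \<and> (\<exists>s\<in>{0..2}. dist c (q + s *\<^sub>R v) \<le> r)"
  then obtain s where s: "s \<in> {0..2}" "dist c (q + s *\<^sub>R v) \<le> r" by blast
  have "(q, v) \<in> (\<lambda>(p, s, v). (p - s *\<^sub>R v, v)) ` (cball c r \<times> {0..2} \<times> sphere 0 1)"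
    using A s by (intro image_eqI[of _ _ "(q + s *\<^sub>R v, s, v)"]) auto
  then show "(q, v) \<in> midflight c" using A by (simp add: midflight_def)
qed

lemma compact_midflight: "compact (midflight c)"
  unfolding midflight_def
proof (rule compact_Int_closed)
  show "compact ((\<lambda>(p, s, v). (p - s *\<^sub>R v, v)) ` (cball c r \<times> {0..2} \<times> sphere 0 1))"
    unfolding case_prod_beta
    by (intro compact_continuous_image compact_Times compact_cball compact_Icc compact_sphere continuous_intros)
  have "closed ((\<lambda>z::point \<times> point. snd (fst z)) -` {1/50..49/50})"
    by (intro closed_vimage closed_atLeastAtMost continuous_intros)
  then show "closed {z::point \<times> point. 1/50 \<le> snd (fst z) \<and> snd (fst z) \<le> 49/50}"
    by (simp add: vimage_def)
qed

lemma strip_off_disks: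
  assumes "1/50 \<le> y" "y \<le> (49/50::real)"
  shows "1/50 \<le> \<bar>real_of_int b - y\<bar>"
proof -
  have "b \<le> 0 \<or> 1 \<le> b" by linarith
  then have "real_of_int b \<le> 0 \<or> 1 \<le> real_of_int b" by linarith
  then show ?thesis using assms by linarith
qed

lemma midflight_no_contact:
  assumes "(q, v) \<in> midflight c" "c' \<in> C" shows "r < dist c' q"
proof -
  obtain k b where c': "c' = (real_of_int k / real n, real_of_int b)" using assms(2) disk_centers_eq[OF n_pos] by auto
  have "1/50 \<le> \<bar>snd c' - snd q\<bar>" unfolding c' snd_conv using assms(1) by (intro strip_off_disks) (auto simp: midflight_iff)
  then show ?thesis using dist_snd_le[of c' q] r_n unfolding dist_real_def by linarith
qed

lemma midflight_lifted: "(q, v) \<in> midflight c \<Longrightarrow> (q, v) \<in> \<Lambda>"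
  using midflight_no_contact[of q v c] by (auto simp: lifted_eq in_table_iff midflight_iff less_imp_le)

lemma state_midflight_iff:
  assumes "(q, v) \<in> \<Lambda>"
  shows "state q v \<in> midflight_states c \<longleftrightarrow> (\<exists>a b. (q + lattice_vec a b, v) \<in> midflight c)"
proof
  assume "state q v \<in> midflight_states c"
  then obtain q' v' where m: "(q', v') \<in> midflight c" "state q v = state q' v'" by (auto simp: midflight_states_def)
  then obtain a b where ab: "q' = q + lattice_vec a b" "mates q v v'"
    using state_eq_iff[OF assms midflight_lifted[OF m(1)]] by blast
  have "mates q' v v'" using ab mates_translate by simp
  then have "v' = v" using midflight_no_contact[OF m(1)] unfolding mates_def by (metis less_irrefl)
  then show "\<exists>a b. (q + lattice_vec a b, v) \<in> midflight c" using m(1) ab(1) by blast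
next
  assume "\<exists>a b. (q + lattice_vec a b, v) \<in> midflight c"
  then obtain a b where "(q + lattice_vec a b, v) \<in> midflight c" by blast
  then have "state (q + lattice_vec a b) v \<in> midflight_states c" unfolding midflight_states_def by blast
  then show "state q v \<in> midflight_states c" using state_translate[OF assms] by simp
qed

text \<open>In the lift the removed set is the union of all lattice translates of a compact set,
  which is closed as the sum of a compact and a closed set.\<close>

lemma openin_complement_midflight:
  "openin (phase_space n r) (topspace (phase_space n r) - midflight_states c)"
proof -
  define Z where "Z = (\<lambda>z::point \<times> point. - z) ` ((\<int> \<times> \<int>) \<times> {0::point})"
  have "closed Z" unfolding Z_def by (intro closed_negations closed_Times closed_Ints closed_singleton)
  then have "closed (\<Union>x\<in>midflight c. \<Union>y\<in>Z. {x + y})" by (rule compact_closed_sums[OF compact_midflight])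
  moreover have mem: "(q, v) \<in> (\<Union>x\<in>midflight c. \<Union>y\<in>Z. {x + y}) \<longleftrightarrow> (\<exists>a b. (q + lattice_vec a b, v) \<in> midflight c)" for q v
  proof
    assume "(q, v) \<in> (\<Union>x\<in>midflight c. \<Union>y\<in>Z. {x + y})"
    then obtain x a b where x: "x \<in> midflight c" "(q, v) = x + (- ((real_of_int a, real_of_int b), 0))"
      by (auto simp: Z_def Ints_def)
    then have "x = (q + lattice_vec a b, v)" by (simp add: lattice_vec_def prod_eq_iff)
    then show "\<exists>a b. (q + lattice_vec a b, v) \<in> midflight c" using x by blast
  next
    assume "\<exists>a b. (q + lattice_vec a b, v) \<in> midflight c"
    then obtain a b where m: "(q + lattice_vec a b, v) \<in> midflight c" by blast
    have "- (lattice_vec a b, 0) \<in> Z" unfolding Z_def lattice_vec_def by (intro imageI) auto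
    moreover have "(q, v) = (q + lattice_vec a b, v) + (- (lattice_vec a b, 0))" by simp
    ultimately show "(q, v) \<in> (\<Union>x\<in>midflight c. \<Union>y\<in>Z. {x + y})" using m by blast
  qed
  moreover have "{x \<in> \<Lambda>. phase_rel n r `` {x} \<in> topspace (phase_space n r) - midflight_states c}
      = \<Lambda> \<inter> - (\<Union>x\<in>midflight c. \<Union>y\<in>Z. {x + y})"
  proof (intro set_eqI)
    fix x :: "point \<times> point"
    obtain q v where x: "x = (q, v)" by (cases x)
    have "state q v \<in> topspace (phase_space n r)" if "(q, v) \<in> \<Lambda>" using that topspace_phase_space by blast
    then show "x \<in> {x \<in> \<Lambda>. phase_rel n r `` {x} \<in> topspace (phase_space n r) - midflight_states c} \<longleftrightarrow>
        x \<in> \<Lambda> \<inter> - (\<Union>x\<in>midflight c. \<Union>y\<in>Z. {x + y})"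
      using state_midflight_iff[of q v c] mem[of q v] unfolding x state_def by blast
  qed
  ultimately have "openin (top_of_set \<Lambda>) {x \<in> \<Lambda>. phase_rel n r `` {x} \<in> topspace (phase_space n r) - midflight_states c}"
    by (auto simp: openin_open open_Compl)
  then show ?thesis
    unfolding phase_space_def openin_quotient_topology topspace_quotient_topology by auto
qed

text \<open>A line that meets two disks of the same row is nearly horizontal and stays close to that row.\<close>

lemma midflight_disjoint:
  assumes m: "(q, v) \<in> midflight c" "(q, v) \<in> midflight c'" and c: "c \<in> C" "c' \<in> C"
    and rows: "snd c \<in> {0, 1}" "snd c' \<in> {0, 1}"
  shows "c = c'"
proof (rule ccontr)
  assume ne: "c \<noteq> c'"
  obtain s where s: "0 \<le> s" "s \<le> 2" "dist c (q + s *\<^sub>R v) \<le> r" using m(1) by (auto simp: midflight_iff)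
  obtain s' where s': "0 \<le> s'" "s' \<le> 2" "dist c' (q + s' *\<^sub>R v) \<le> r" using m(2) by (auto simp: midflight_iff)
  have q: "norm v = 1" "1/50 \<le> snd q" "snd q \<le> 49/50" using m(1) by (auto simp: midflight_iff)
  have y: "\<bar>snd c - (snd q + s * snd v)\<bar> \<le> r" "\<bar>snd c' - (snd q + s' * snd v)\<bar> \<le> r"
    using dist_snd_le[of c "q + s *\<^sub>R v"] dist_snd_le[of c' "q + s' *\<^sub>R v"] s s' by (auto simp: dist_real_def)
  show False
  proof (cases "snd c = snd c'")
    case True
    have "1 / real n \<le> dist c c'" using separated c ne by blast
    also have "\<dots> \<le> dist c (q + s *\<^sub>R v) + dist (q + s *\<^sub>R v) (q + s' *\<^sub>R v) + dist c' (q + s' *\<^sub>R v)"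
      using dist_triangle[of c c' "q + s *\<^sub>R v"] dist_triangle[of "q + s *\<^sub>R v" c' "q + s' *\<^sub>R v"]
      by (simp add: dist_commute)
    also have "\<dots> \<le> 2 * r + \<bar>s - s'\<bar>" using s s' q(1) by (simp add: dist_norm flip: scaleR_diff_left)
    finally have ss: "h \<le> \<bar>s - s'\<bar>" by (simp add: h_def)
    have "1000 * r \<le> 1 / real n" using r_n n_pos by (simp add: field_simps)
    then have hr: "998 * r \<le> h" by (simp add: h_def)
    \<comment> \<open>The height differs by at most \<open>2 * r\<close> between two times at least
      \<open>h \<ge> 998 * r\<close> apart, so within time 2 it changes by at most
      \<open>4 / 998\<close>, too little to reach the row from distance 1/50.\<close>
    have "\<bar>(s - s') * snd v\<bar> \<le> 2 * r" using y True by (simp add: left_diff_distrib)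
    then have "h * \<bar>snd v\<bar> \<le> 2 * r" using mult_right_mono[OF ss, of "\<bar>snd v\<bar>"] by (simp add: abs_mult)
    moreover have "998 * r * \<bar>snd v\<bar> \<le> h * \<bar>snd v\<bar>" using hr by (intro mult_right_mono) auto
    ultimately have "r * (998 * \<bar>snd v\<bar>) \<le> r * 2" by simp
    then have sv: "998 * \<bar>snd v\<bar> \<le> 2" using r_pos' by (simp only: mult_le_cancel_left_pos)
    have "\<bar>s * snd v\<bar> \<le> 2 * \<bar>snd v\<bar>" using s by (simp add: abs_mult mult_right_mono)
    then have "\<bar>s * snd v\<bar> \<le> 4 / 998" using sv by linarith
    moreover have "1/50 \<le> \<bar>snd c - snd q\<bar>" using rows q by auto
    ultimately show False using y(1) r_n by linarith
  next
    case False
    \<comment> \<open>Disks of different rows are told apart by the sign of the vertical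
      velocity.\<close>
    have *: "0 < snd v" if "snd c = 1" "\<bar>snd c - (snd q + s * snd v)\<bar> \<le> r" "0 \<le> s" for c s
    proof -
      have "0 < s * snd v" using that q r_n by linarith
      then show ?thesis using that by (simp add: zero_less_mult_iff)
    qed
    have **: "snd v < 0" if "snd c = 0" "\<bar>snd c - (snd q + s * snd v)\<bar> \<le> r" "0 \<le> s" for c s
    proof -
      have "s * snd v < 0" using that q r_n by linarith
      then show ?thesis using that by (simp add: mult_less_0_iff)
    qed
    show False using False rows *[of c s] *[of c' s'] **[of c s] **[of c' s'] y s s' by auto
  qed
qed

text \<open>Even steps aim at the beginning of the lower row, odd steps at the end of the upper row,
  counted from the right. With \<open>k < n div 4\<close> the horizontal offset of successive
  targets is between 1/2 and 1.\<close>

definition target :: "nat \<Rightarrow> nat \<Rightarrow> point" where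
  "target i k = (if even i then (real k / real n, 0) else (real (n - 1 - k) / real n, 1))"

definition targets :: "point set" where
  "targets = (\<lambda>(i, k). target i k) ` ({0, 1} \<times> {..<n div 4})"

lemma target_in: "target i k \<in> C"
proof -
  have "target i k = (real_of_int (if even i then int k else int (n - 1 - k)) / real n, real_of_int (if even i then 0 else 1))"
    by (simp add: target_def)
  then show ?thesis unfolding disk_centers_eq[OF n_pos] by blast
qed

lemma target_targets: "k < n div 4 \<Longrightarrow> target i k \<in> targets"
  unfolding targets_def by (intro image_eqI[of _ _ "(i mod 2, k)"]) (auto simp: target_def)

lemma target_inj: "\<lbrakk>k < n div 4; k' < n div 4; target i k = target i k'\<rbrakk> \<Longrightarrow> k = k'"
  using n_pos by (auto simp: target_def of_nat_diff split: if_splits)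

lemma targets_fst: "c \<in> targets \<Longrightarrow> 0 \<le> fst c \<and> fst c < 1 \<and> snd c \<in> {0, 1}"
  using n_pos by (auto simp: targets_def target_def field_simps)

text \<open>A state could approach the two disks through different lifts. The range of heights
  forces the vertical shift to be 0; after \<open>midflight_disjoint\<close> has identified the
  shifted disks, the horizontal shift is 0 because targets have first coordinates in
  \<open>[0, 1)\<close>.\<close>

lemma midflight_states_disjoint:
  assumes x: "x \<in> midflight_states c" "x \<in> midflight_states c'" and c: "c \<in> targets" "c' \<in> targets"
  shows "c = c'"
proof -
  obtain q v where q: "(q, v) \<in> midflight c" "x = state q v" using x(1) by (auto simp: midflight_states_def)
  obtain a b where ab: "(q + lattice_vec a b, v) \<in> midflight c'"
    using x(2) q state_midflight_iff[OF midflight_lifted[OF q(1)]] by auto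
  have "1/50 \<le> snd q" "snd q \<le> 49/50" "1/50 \<le> snd q + real_of_int b" "snd q + real_of_int b \<le> 49/50"
    using q(1) ab by (auto simp: midflight_iff lattice_vec_def)
  then have "- 1 < real_of_int b" "real_of_int b < 1" by linarith+
  then have b: "b = 0" by linarith
  let ?c = "c' - lattice_vec a 0"
  have cC: "c \<in> C" "c' \<in> C" using c target_in by (auto simp: targets_def)
  have "(q, v) \<in> midflight ?c"
  proof -
    obtain s where s: "s \<in> {0..2}" "dist c' (q + lattice_vec a b + s *\<^sub>R v) \<le> r" using ab unfolding midflight_iff by blast
    have "dist ?c (q + s *\<^sub>R v) = dist c' (q + lattice_vec a b + s *\<^sub>R v)" unfolding b by (simp add: dist_norm algebra_simps)
    then have "dist ?c (q + s *\<^sub>R v) \<le> r" using s(2) by simp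
    then show ?thesis using q(1) s(1) unfolding midflight_iff by blast
  qed
  moreover have "?c \<in> C" by (rule translate_center_diff[OF cC(2)])
  ultimately have "c = ?c"
    using targets_fst[OF c(1)] targets_fst[OF c(2)]
    by (intro midflight_disjoint[OF q(1) _ cC(1)]) (simp_all add: lattice_vec_def)
  then have "fst c = fst c' - real_of_int a" "snd c = snd c'" by (auto simp: lattice_vec_def prod_eq_iff)
  moreover from this have "real_of_int a < 1" "- 1 < real_of_int a"
    using targets_fst[OF c(1)] targets_fst[OF c(2)] by linarith+
  then have "a = 0" by linarith
  ultimately show ?thesis by (simp add: prod_eq_iff)
qed

text \<open>Complements of closed sets, hence open; they cover since a state approaches at most one
  target. Each of them contains midflight states of a single target, so it reveals the
  target.\<close>

definition target_cover :: "(point \<times> point) set set set" where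
  "target_cover = (\<lambda>c. topspace (phase_space n r) - (\<Union>c'\<in>targets - {c}. midflight_states c')) ` targets"

lemma target_cover_open:
  assumes "4 \<le> n" shows "target_cover \<in> open_covers (phase_space n r)"
  unfolding open_covers_def
proof (intro CollectI conjI ballI)
  have fin: "finite targets" by (simp add: targets_def)
  fix U assume "U \<in> target_cover"
  then obtain c where U: "U = topspace (phase_space n r) - (\<Union>c'\<in>targets - {c}. midflight_states c')"
    by (auto simp: target_cover_def)
  show "openin (phase_space n r) U"
  proof (cases "targets - {c} = {}")
    case False
    then have "U = (\<Inter>c'\<in>targets - {c}. topspace (phase_space n r) - midflight_states c')" unfolding U by blast
    moreover have "openin (phase_space n r) (\<Inter>c'\<in>targets - {c}. topspace (phase_space n r) - midflight_states c')"
      by (rule openin_Inter) (use fin False openin_complement_midflight in blast)+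
    ultimately show ?thesis by (simp only:)
  next
    case True
    then show ?thesis unfolding U by (metis Diff_empty SUP_empty openin_topspace)
  qed
next
  show "\<Union>target_cover = topspace (phase_space n r)"
  proof
    show "\<Union>target_cover \<subseteq> topspace (phase_space n r)" by (auto simp: target_cover_def)
    show "topspace (phase_space n r) \<subseteq> \<Union>target_cover"
    proof
      fix x assume x: "x \<in> topspace (phase_space n r)"
      have "target 0 0 \<in> targets" using assms by (intro target_targets) auto
      then obtain c where c: "c \<in> targets" "x \<in> midflight_states c \<or> (\<forall>c'\<in>targets. x \<notin> midflight_states c')" by blast
      then have "x \<notin> midflight_states c'" if "c' \<in> targets - {c}" for c'
        using midflight_states_disjoint[of x c c'] that by blast
      then have "x \<in> topspace (phase_space n r) - (\<Union>c'\<in>targets - {c}. midflight_states c')" using x by blast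
      then show "x \<in> \<Union>target_cover" unfolding target_cover_def using c(1) by blast
    qed
  qed
qed

lemma target_cover_separates:
  assumes "U \<in> target_cover" "x \<in> U" "y \<in> U" "x \<in> midflight_states c" "y \<in> midflight_states c'"
    "c \<in> targets" "c' \<in> targets"
  shows "c = c'"
proof -
  obtain d where "U = topspace (phase_space n r) - (\<Union>c'\<in>targets - {d}. midflight_states c')"
    using assms(1) by (auto simp: target_cover_def)
  then have "c = d" "c' = d" using assms by blast+
  then show ?thesis by simp
qed

text \<open>The letters sit at indices 1 to \<open>length l\<close>. Index 0 and the tail are filled
  with the letter 0, so that all itineraries start at the same disk and are infinite.\<close>

definition word_centers :: "nat list \<Rightarrow> nat \<Rightarrow> point" where
  "word_centers l i = target i (if 1 \<le> i \<and> i \<le> length l then l ! (i - 1) else 0)"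

lemma word_centers_steps:
  assumes n: "4 \<le> n" and l: "set l \<subseteq> {..<n div 4}"
  shows "snd (word_centers l (Suc i)) - snd (word_centers l i) = (if even i then 1 else - 1)"
    and "1/2 \<le> \<bar>fst (word_centers l (Suc i)) - fst (word_centers l i)\<bar>"
    and "\<bar>fst (word_centers l (Suc i)) - fst (word_centers l i)\<bar> \<le> 1"
    and "word_centers l i \<in> targets"
proof -
  define k where "k i = (if 1 \<le> i \<and> i \<le> length l then l ! (i - 1) else 0)" for i
  have k: "k i < n div 4" for i
  proof (cases "1 \<le> i \<and> i \<le> length l")
    case True
    then have "l ! (i - 1) \<in> set l" by (intro nth_mem) auto
    then show ?thesis using l True by (auto simp: k_def)
  qed (use n in \<open>auto simp: k_def\<close>)
  have wc: "word_centers l i = target i (k i)" for i by (simp add: word_centers_def k_def)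
  show "word_centers l i \<in> targets" unfolding wc by (rule target_targets[OF k])
  show "snd (word_centers l (Suc i)) - snd (word_centers l i) = (if even i then 1 else - 1)"
    by (simp add: wc target_def)
  have *: "1/2 \<le> real (n - 1 - b) / real n - real a / real n \<and> real (n - 1 - b) / real n - real a / real n \<le> 1"
    if "a < n div 4" "b < n div 4" for a b
  proof -
    have "4 * a + 4 \<le> n" "4 * b + 4 \<le> n" using that by linarith+
    then have "real (n - 1 - b) = real n - 1 - real b" "4 * real a + 4 \<le> real n" "4 * real b + 4 \<le> real n"
      by (auto simp: of_nat_diff)
    moreover from this have "real (n - 1 - b) / real n - real a / real n = (real n - 1 - real b - real a) / real n"
      by (simp flip: diff_divide_distrib)
    ultimately show ?thesis using n_pos by (simp add: pos_le_divide_eq pos_divide_le_eq)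
  qed
  have "1/2 \<le> \<bar>fst (word_centers l (Suc i)) - fst (word_centers l i)\<bar> \<and>
    \<bar>fst (word_centers l (Suc i)) - fst (word_centers l i)\<bar> \<le> 1"
  proof (cases "even i")
    case True
    then have "fst (word_centers l (Suc i)) - fst (word_centers l i)
        = real (n - 1 - k (Suc i)) / real n - real (k i) / real n" by (simp add: wc target_def)
    then show ?thesis using *[OF k[of i] k[of "Suc i"]] by linarith
  next
    case False
    then have "fst (word_centers l (Suc i)) - fst (word_centers l i)
        = - (real (n - 1 - k i) / real n - real (k (Suc i)) / real n)" by (simp add: wc target_def)
    then show ?thesis using *[OF k[of "Suc i"] k[of i]] by linarith
  qed
  then show "1/2 \<le> \<bar>fst (word_centers l (Suc i)) - fst (word_centers l i)\<bar>"
    "\<bar>fst (word_centers l (Suc i)) - fst (word_centers l i)\<bar> \<le> 1" by blast+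
qed

lemma word_itinerary:
  assumes "4 \<le> n" "set l \<subseteq> {..<n div 4}" shows "itinerary (word_centers l) r"
  using word_centers_steps[OF assms] r_n r_pos' by unfold_locales auto

text \<open>Before the first differing letter both orbits hit the same disks, so by
  \<open>chain_time\<close> their last common collisions are at most \<open>2 * r\<close> apart in
  time. The next flights last at least 1116/1000; with 1/20 cut off at both ends they still overlap
  for more than 1 and contain an integer time, at which the orbits approach different
  targets.\<close>

lemma common_flight_separates:
  assumes n: "4 \<le> n" and l: "set l \<subseteq> {..<n div 4}" "set l' \<subseteq> {..<n div 4}" "length l = J" "length l' = J" "l \<noteq> l'"
    and X: "trajectory q u v" "T 0 = 0" "p 0 = word_centers l 0 + (0, r)" "\<And>K. chain K T p w (word_centers l)"
      "\<And>i. dist (word_centers l i) (p i) = r" "\<And>i. w i = sgn (p (Suc i) - p i)"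
      "\<And>i. T (Suc i) - T i = norm (p (Suc i) - p i)"
      "\<And>i t. T i \<le> t \<Longrightarrow> t < T (Suc i) \<Longrightarrow> q t = p i + (t - T i) *\<^sub>R w i \<and> v t = w i"
    and X': "trajectory q' u' v'" "T' 0 = 0" "p' 0 = word_centers l' 0 + (0, r)" "\<And>K. chain K T' p' w' (word_centers l')"
      "\<And>i. dist (word_centers l' i) (p' i) = r" "\<And>i. w' i = sgn (p' (Suc i) - p' i)"
      "\<And>i. T' (Suc i) - T' i = norm (p' (Suc i) - p' i)"
      "\<And>i t. T' i \<le> t \<Longrightarrow> t < T' (Suc i) \<Longrightarrow> q' t = p' i + (t - T' i) *\<^sub>R w' i \<and> v' t = w' i"
  shows "\<exists>k\<le>2 * J. \<exists>c\<in>targets. \<exists>c'\<in>targets. c \<noteq> c' \<and>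
    state (q (real k)) (v (real k)) \<in> midflight_states c \<and> state (q' (real k)) (v' (real k)) \<in> midflight_states c'"
proof -
  define j where "j = (LEAST j. word_centers l (Suc j) \<noteq> word_centers l' (Suc j))"
  obtain i where i: "i < J" "l ! i \<noteq> l' ! i" using l(3-5) by (metis nth_equalityI)
  have "word_centers l (Suc i) \<noteq> word_centers l' (Suc i)"
  proof
    assume "word_centers l (Suc i) = word_centers l' (Suc i)"
    then have "target (Suc i) (l ! i) = target (Suc i) (l' ! i)" using i l(3,4) by (simp add: word_centers_def)
    moreover have "l ! i < n div 4" "l' ! i < n div 4" using i l nth_mem by (metis lessThan_iff subsetD)+
    ultimately show False using target_inj i(2) by blast
  qed
  then have ne: "word_centers l (Suc j) \<noteq> word_centers l' (Suc j)" and ji: "j \<le> i"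
    unfolding j_def by (rule LeastI, rule Least_le)
  have jJ: "Suc j \<le> J" using ji i by simp
  have same: "word_centers l m = word_centers l' m" if "m \<le> j" for m
  proof (cases m)
    case 0
    then show ?thesis by (simp add: word_centers_def)
  next
    case (Suc m')
    then show ?thesis using not_less_Least[of m' "\<lambda>j. word_centers l (Suc j) \<noteq> word_centers l' (Suc j)"] that
      by (auto simp: j_def)
  qed
  have T0: "0 \<le> T m" "T m \<le> 2 * real m" and L: "1116/1000 \<le> T (Suc m) - T m" "T (Suc m) - T m \<le> 3/2"
    if c: "\<And>i. 1/2 \<le> \<bar>fst (c (Suc i)) - fst (c i)\<bar> \<and> \<bar>fst (c (Suc i)) - fst (c i)\<bar> \<le> 1 \<and> \<bar>snd (c (Suc i)) - snd (c i)\<bar> = 1"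
      and p: "\<And>i. dist (c i) (p i) = r" and T: "T 0 = 0" "\<And>i. T (Suc i) - T i = norm (p (Suc i) - p i)"
    for c p :: "nat \<Rightarrow> point" and T :: "nat \<Rightarrow> real" and m
  proof -
    have L: "1116/1000 \<le> T (Suc m) - T m" "T (Suc m) - T m \<le> 3/2" for m
      using flight_bounds(1,4)[of "c m" "p m" r "c (Suc m)" "p (Suc m)"] p c[of m] r_n T(2)[of m] by auto
    show "0 \<le> T m"
    proof (induction m)
      case (Suc m)
      then show ?case using L(1)[of m] by linarith
    qed (use T in simp)
    show "T m \<le> 2 * real m"
    proof (induction m)
      case (Suc m)
      then show ?case using L(2)[of m] by simp
    qed (use T in simp)
    show "1116/1000 \<le> T (Suc m) - T m" "T (Suc m) - T m \<le> 3/2" by (rule L)+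
  qed
  have wc: "1/2 \<le> \<bar>fst (word_centers l (Suc i)) - fst (word_centers l i)\<bar> \<and>
      \<bar>fst (word_centers l (Suc i)) - fst (word_centers l i)\<bar> \<le> 1 \<and> \<bar>snd (word_centers l (Suc i)) - snd (word_centers l i)\<bar> = 1"
    if "set l \<subseteq> {..<n div 4}" for l i
    using word_centers_steps[OF n that, of i] by auto
  note TX = T0[OF wc[OF l(1)] X(5,2,7)] L[OF wc[OF l(1)] X(5,2,7)]
  note TX' = T0[OF wc[OF l(2)] X'(5,2,7)] L[OF wc[OF l(2)] X'(5,2,7)]
  have close: "\<bar>T j - T' j\<bar> \<le> 2 * r"
  proof (cases "j = 0")
    case False
    \<comment> \<open>As the disks agree up to index \<open>j\<close>, the second orbit is also a
      chain for the first itinerary.\<close>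
    have ch: "chain j T' p' w' (word_centers l)"
      using X'(4)[of j] same unfolding chain_def by auto
    have "\<bar>T j - T' j\<bar> \<le> norm (p 0 - p' 0) + norm (p j - p' j)"
      using False by (intro chain_time[OF X(4)[of j] ch X(2) X'(2)]) auto
    moreover have "p 0 = p' 0" using X(3) X'(3) same[of 0] by simp
    moreover have "norm (p j - p' j) \<le> 2 * r"
      using dist_triangle[of "p j" "p' j" "word_centers l j"] X(5)[of j] X'(5)[of j] same[of j]
      by (simp add: dist_commute flip: dist_norm)
    ultimately show ?thesis by simp
  qed (use X X' r_pos' in simp)
  \<comment> \<open>The margin 1/20 gives a vertical distance of at least
    \<open>1/20 * (3/5) = 3/100\<close> from the contact point, which exceeds
    \<open>1/50 + r\<close>.\<close>
  define a where "a = max (T j) (T' j) + 1/20"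
  define k where "k = nat \<lceil>a\<rceil>"
  have a0: "0 \<le> a" using TX(1)[of j] by (simp add: a_def)
  have k: "a \<le> real k" "real k < a + 1" using a0 by (auto simp: k_def) linarith+
  have win: "T j + 1/20 \<le> real k" "T' j + 1/20 \<le> real k" "real k \<le> T (Suc j) - 1/20" "real k \<le> T' (Suc j) - 1/20"
    using k TX(3)[of j] TX'(3)[of j] close r_n unfolding a_def by linarith+
  \<comment> \<open>Each flight takes less than 2, so flight \<open>j\<close> ends no later than
    \<open>2 * (j + 1)\<close>.\<close>
  have "real k \<le> 2 * real J" using win(3) TX(2)[of "Suc j"] jJ by (auto intro: order_trans)
  then have kJ: "k \<le> 2 * J" by linarith
  have mid: "state (q t) (v t) \<in> midflight_states (c (Suc j))"
    if c: "\<And>i. \<bar>fst (c (Suc i)) - fst (c i)\<bar> \<le> 1" "\<And>i. snd (c i) = (if even i then 0 else 1)"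
      and p: "\<And>i. dist (c i) (p i) = r" and w: "w j = sgn (p (Suc j) - p j)"
      and T: "T (Suc j) - T j = norm (p (Suc j) - p j)" "T (Suc j) - T j \<le> 3/2"
      and qv: "q t = p j + (t - T j) *\<^sub>R w j" "v t = w j"
      and t: "T j + 1/20 \<le> t" "t \<le> T (Suc j) - 1/20"
    for c p w :: "nat \<Rightarrow> point" and q v :: "real \<Rightarrow> point" and t and T :: "nat \<Rightarrow> real"
  proof -
    have rows: "snd (c (Suc j)) - snd (c j) = (if even j then 1 else - 1)" using c(2)[of j] c(2)[of "Suc j"] by simp
    have up: "3/5 \<le> (if even j then 1 else - 1) * snd (w j)"
      using flight_bounds(3)[of "c j" "p j" r "c (Suc j)" "p (Suc j)"] p r_n c(1)[of j] unfolding rows w by auto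
    have Lpos: "p (Suc j) - p j \<noteq> 0" using T(1) t by auto
    have w1: "norm (w j) = 1" using Lpos by (simp add: w norm_sgn)
    have pS: "p (Suc j) = p j + (T (Suc j) - T j) *\<^sub>R w j" unfolding T(1) w norm_scaleR_sgn by simp
    have y: "snd (q t) = snd (p j) + (t - T j) * snd (w j)" "snd (q t) = snd (p (Suc j)) - (T (Suc j) - t) * snd (w j)"
      by (simp_all add: qv pS algebra_simps)
    have d: "\<bar>snd (p i) - snd (c i)\<bar> \<le> r" for i
      using dist_snd_le[of "c i" "p i"] p[of i] by (simp add: dist_real_def abs_minus_commute)
    have "1/20 * (3/5) \<le> (t - T j) * ((if even j then 1 else - 1) * snd (w j))"
      "1/20 * (3/5) \<le> (T (Suc j) - t) * ((if even j then 1 else - 1) * snd (w j))"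
      using t up by (intro mult_mono; simp)+
    then have "1/50 \<le> snd (q t) \<and> snd (q t) \<le> 49/50"
      using d[of j] d[of "Suc j"] c(2)[of j] c(2)[of "Suc j"] y r_n by (cases "even j") auto
    moreover have "q t + (T (Suc j) - t) *\<^sub>R v t = p (Suc j)" by (simp add: qv pS algebra_simps)
    ultimately have "(q t, v t) \<in> midflight (c (Suc j))"
      unfolding midflight_iff using w1 qv(2) p[of "Suc j"] t T(2)
      by (intro conjI bexI[of _ "T (Suc j) - t"]) auto
    then show ?thesis unfolding midflight_states_def by blast
  qed
  have rowc: "snd (word_centers l i) = (if even i then 0 else 1)" for l i by (simp add: word_centers_def target_def)
  have s1: "state (q (real k)) (v (real k)) \<in> midflight_states (word_centers l (Suc j))"
  proof (rule mid[of "word_centers l" p w T q "real k" v])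
    show "q (real k) = p j + (real k - T j) *\<^sub>R w j" "v (real k) = w j"
      using X(8)[of j "real k"] win by auto
  qed (use wc[OF l(1)] rowc X TX win in auto)
  have s2: "state (q' (real k)) (v' (real k)) \<in> midflight_states (word_centers l' (Suc j))"
  proof (rule mid[of "word_centers l'" p' w' T' q' "real k" v'])
    show "q' (real k) = p' j + (real k - T' j) *\<^sub>R w' j" "v' (real k) = w' j"
      using X'(8)[of j "real k"] win by auto
  qed (use wc[OF l(2)] rowc X' TX' win in auto)
  show ?thesis using kJ ne s1 s2 word_centers_steps(4)[OF n l(1)] word_centers_steps(4)[OF n l(2)] by blast
qed

text \<open>The separated points are the initial states of the orbits of the
  \<open>(n div 4) ^ J\<close> words. Two of them in one element of the join would share an element
  of \<open>target_cover\<close> at every integer time up to \<open>2 * J\<close>, against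
  \<open>common_flight_separates\<close>.\<close>

lemma join_entropy_lower:
  assumes n: "4 \<le> n" and m: "2 * J < m"
  shows "ereal (real J * ln (real (n div 4)))
    \<le> cover_entropy (phase_space n r) (dynamical_join (phase_space n r) (billiard_flow n r 1) target_cover m)"
proof -
  let ?X = "phase_space n r" and ?f = "billiard_flow n r 1"
  define I where "I = {l. set l \<subseteq> {..<n div 4} \<and> length l = J}"
  have I: "finite I" "card I = (n div 4) ^ J" unfolding I_def by (simp_all add: finite_lists_length_eq card_lists_length_eq)
  define P where "P l = (\<lambda>(q, u, v, p, w, T). trajectory q u v \<and> T 0 = 0 \<and> p 0 = word_centers l 0 + (0, r) \<and> q 0 = p 0 \<and>
    (\<forall>K. chain K T p w (word_centers l)) \<and> (\<forall>i. dist (word_centers l i) (p i) = r) \<and> (\<forall>i. w i = sgn (p (Suc i) - p i)) \<and>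
    (\<forall>i. T (Suc i) - T i = norm (p (Suc i) - p i)) \<and>
    (\<forall>i t. T i \<le> t \<and> t < T (Suc i) \<longrightarrow> q t = p i + (t - T i) *\<^sub>R w i \<and> v t = w i))" for l
  have "\<forall>l\<in>I. \<exists>y. P l y"
  proof
    fix l assume l: "l \<in> I"
    then have it: "itinerary (word_centers l) r" using word_itinerary n by (simp add: I_def)
    have "word_centers l i \<in> C" for i by (simp add: word_centers_def target_in)
    moreover have "snd (word_centers l 0) = 0" by (simp add: word_centers_def target_def)
    ultimately obtain q u v p w T where "P l (q, u, v, p, w, T)"
      using itinerary_trajectory[OF it] unfolding P_def prod.case by blast
    then show "\<exists>y. P l y" ..
  qed
  then obtain Y where Y: "\<forall>l\<in>I. P l (Y l)" by (rule bchoice[THEN exE])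
  define x where "x l = (case Y l of (q, u, v, p, w, T) \<Rightarrow> state (q 0) (v 0))" for l
  have "ereal (ln (real (card I))) \<le> cover_entropy ?X (dynamical_join ?X ?f target_cover m)"
  proof (rule cover_entropy_lower[OF I(1)])
    have "0 < n div 4" using n by (simp add: div_greater_zero_iff)
    then show "I \<noteq> {}" using I(2) by (metis card.empty less_irrefl zero_less_power)
    show "x l \<in> topspace ?X" if l: "l \<in> I" for l
    proof -
      obtain q u v p w T where y: "Y l = (q, u, v, p, w, T)" by (cases "Y l")
      then have "trajectory q u v" using bspec[OF Y l] by (simp add: P_def)
      then have "(q 0, v 0) \<in> \<Lambda>" by (rule admissible_lifted[OF trajectory_admissible])
      then show ?thesis unfolding x_def y topspace_phase_space prod.case by blast
    qed
    fix l l' W assume l: "l \<in> I" "l' \<in> I" and W: "W \<in> dynamical_join ?X ?f target_cover m" "x l \<in> W" "x l' \<in> W"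
    show "l = l'"
    proof (rule ccontr)
      assume ne: "l \<noteq> l'"
      obtain q u v p w T where y: "Y l = (q, u, v, p, w, T)" by (cases "Y l")
      obtain q' u' v' p' w' T' where y': "Y l' = (q', u', v', p', w', T')" by (cases "Y l'")
      note A = bspec[OF Y l(1), unfolded y P_def prod.case]
      note A' = bspec[OF Y l(2), unfolded y' P_def prod.case]
      have "\<exists>k\<le>2 * J. \<exists>c\<in>targets. \<exists>c'\<in>targets. c \<noteq> c' \<and>
        state (q (real k)) (v (real k)) \<in> midflight_states c \<and> state (q' (real k)) (v' (real k)) \<in> midflight_states c'"
        by (rule common_flight_separates[OF n _ _ _ _ ne, of J q u v T p w q' u' v' T' p' w'])
          (use l A A' in \<open>auto simp: I_def\<close>)
      then obtain k c c' where k: "k \<le> 2 * J" and c: "c \<in> targets" "c' \<in> targets" "c \<noteq> c'"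
        and s: "state (q (real k)) (v (real k)) \<in> midflight_states c" "state (q' (real k)) (v' (real k)) \<in> midflight_states c'"
        by blast
      obtain B where "W = {x \<in> topspace ?X. \<forall>k<m. (?f ^^ k) x \<in> B k}" "\<forall>k<m. B k \<in> target_cover"
        using W(1) unfolding dynamical_join_def by blast
      then have B: "B k \<in> target_cover" "(?f ^^ k) (x l) \<in> B k" "(?f ^^ k) (x l') \<in> B k" using W k m by auto
      have "(?f ^^ k) (x l) = state (q (real k)) (v (real k))" "(?f ^^ k) (x l') = state (q' (real k)) (v' (real k))"
        using flow_iterate A A' unfolding x_def y y' prod.case by blast+
      then show False using target_cover_separates[OF B s[folded \<open>(?f ^^ k) (x l) = _\<close> \<open>(?f ^^ k) (x l') = _\<close>] c(1,2)] c(3) by simp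
    qed
  qed
  moreover have "ln (real (card I)) = real J * ln (real (n div 4))" using n I(2) by (simp add: ln_realpow)
  ultimately show ?thesis by simp
qed

lemma lower_rate_limit: "(\<lambda>m::nat. ((real m / 2 - 1) * L) / real m) \<longlonglongrightarrow> 1 / 2 * (L::real)"
  by real_asymp

lemma entropy_lower:
  assumes n: "4 \<le> n" shows "ereal (1 / 2 * ln (real (n div 4))) \<le> h_top n r"
proof -
  let ?X = "phase_space n r" and ?f = "billiard_flow n r 1" and ?L = "ln (real (n div 4))"
  let ?E = "\<lambda>m. cover_entropy ?X (dynamical_join ?X ?f target_cover m) / ereal (real m)"
  have L0: "0 \<le> ?L" using n by simp
  have "ereal ((real m / 2 - 1) * ?L / real m) \<le> ?E m" if m: "0 < m" for m
  proof -
    \<comment> \<open>The largest \<open>J\<close> with \<open>2 * J < m\<close>, so that all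
      detection times belong to the join.\<close>
    let ?J = "(m - 1) div 2"
    have "2 * ?J < m" using m by presburger
    have "m \<le> 2 * ?J + 2" using m by presburger
    then have "real m / 2 - 1 \<le> real ?J" by linarith
    then have "(real m / 2 - 1) * ?L / real m \<le> real ?J * ?L / real m"
      using L0 by (intro divide_right_mono mult_right_mono) auto
    then have "ereal ((real m / 2 - 1) * ?L / real m) \<le> ereal (real ?J * ?L) / ereal (real m)" using m by simp
    also have "\<dots> \<le> ?E m"
      using join_entropy_lower[OF n \<open>2 * ?J < m\<close>] m by (intro ereal_divide_right_mono) auto
    finally show ?thesis .
  qed
  then have ev: "eventually (\<lambda>m. ereal ((real m / 2 - 1) * ?L / real m) \<le> ?E m) sequentially"
    using eventually_gt_at_top[of 0] by (rule eventually_mono[rotated])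
  have "limsup (\<lambda>m. ereal ((real m / 2 - 1) * ?L / real m)) = ereal (1 / 2 * ?L)"
    using lower_rate_limit by (intro lim_imp_Limsup) auto
  then have "ereal (1 / 2 * ?L) \<le> limsup ?E" using Limsup_mono[OF ev] by simp
  also have "\<dots> \<le> topological_entropy ?X ?f"
    unfolding topological_entropy_def using target_cover_open[OF n] by (rule SUP_upper)
  finally show ?thesis unfolding h_top_def .
qed

end

theorem theorem4p1:
  shows "\<exists>r0 :: nat \<Rightarrow> real. (\<forall>n\<ge>1. 0 < r0 n) \<and>
    (\<forall>r :: nat \<Rightarrow> real. (\<forall>n\<ge>1. 0 < r n \<and> r n < r0 n) \<longrightarrow>
       ereal (1 / sqrt 5) \<le> liminf (\<lambda>n. h_top n (r n) / ereal (ln (real n))) \<and>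
       liminf (\<lambda>n. h_top n (r n) / ereal (ln (real n)))
         \<le> limsup (\<lambda>n. h_top n (r n) / ereal (ln (real n))) \<and>
       limsup (\<lambda>n. h_top n (r n) / ereal (ln (real n))) \<le> ereal (2 * sqrt 2))"
proof (intro exI[of _ "\<lambda>n. 1 / (1000 * real n)"] conjI allI impI)
  show "0 < 1 / (1000 * real n)" if "1 \<le> n" for n using that by simp
next
  fix r :: "nat \<Rightarrow> real" assume r: "\<forall>n\<ge>1. 0 < r n \<and> r n < 1 / (1000 * real n)"
  let ?F = "\<lambda>n. h_top n (r n) / ereal (ln (real n))"
  have row: "disk_row n (r n)" if "1 \<le> n" for n
    using r that by unfold_locales (auto simp: less_imp_le)
  show "liminf ?F \<le> limsup ?F" by (rule Liminf_le_Limsup) simp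
  have low: "ereal (1 / 2 * ln (real n / 8) / ln (real n)) \<le> ?F n" if n: "4 \<le> n" for n
  proof -
    interpret disk_row n "r n" using row n by simp
    have ln: "0 < ln (real n)" using n by simp
    \<comment> \<open>Rounding is absorbed into a constant factor, which disappears after division
      by \<open>ln n\<close>.\<close>
    have "n \<le> 8 * (n div 4)" using n by presburger
    then have "real n / 8 \<le> real (n div 4)" by linarith
    then have "ln (real n / 8) \<le> ln (real (n div 4))" using n by (intro ln_mono) auto
    then have "1 / 2 * ln (real n / 8) / ln (real n) \<le> 1 / 2 * ln (real (n div 4)) / ln (real n)"
      using ln by (intro divide_right_mono mult_left_mono) auto
    then have "ereal (1 / 2 * ln (real n / 8) / ln (real n)) \<le> ereal (1 / 2 * ln (real (n div 4))) / ereal (ln (real n))"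
      using ln by simp
    also have "\<dots> \<le> ?F n" using entropy_lower[OF n] ln by (intro ereal_divide_right_mono) auto
    finally show ?thesis .
  qed
  have up: "?F n \<le> ereal (4 / 3 * ln (576 * (real n)\<^sup>2) / ln (real n))" if n: "4 \<le> n" for n
  proof -
    interpret disk_row n "r n" using row n by simp
    have ln: "0 < ln (real n)" using n by simp
    have "?F n \<le> ereal (4 / 3 * ln (576 * (real n)\<^sup>2)) / ereal (ln (real n))"
      using entropy_upper ln by (intro ereal_divide_right_mono) auto
    then show ?thesis using ln by simp
  qed
  have "(\<lambda>n::nat. 1 / 2 * ln (real n / 8) / ln (real n)) \<longlonglongrightarrow> 1 / 2" by real_asymp
  then have lim: "liminf (\<lambda>n. ereal (1 / 2 * ln (real n / 8) / ln (real n))) = ereal (1 / 2)"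
    by (intro lim_imp_Liminf) auto
  have mono: "liminf (\<lambda>n. ereal (1 / 2 * ln (real n / 8) / ln (real n))) \<le> liminf ?F"
    by (rule Liminf_mono[OF eventually_mono[OF eventually_ge_at_top[of 4] low]])
  have "ereal (1 / sqrt 5) \<le> ereal (1 / 2)"
  proof -
    have "2 \<le> sqrt 5" by (intro real_le_rsqrt) simp
    then show ?thesis by (simp add: field_simps)
  qed
  then show "ereal (1 / sqrt 5) \<le> liminf ?F" using mono unfolding lim by (rule order_trans)
  have "(\<lambda>n::nat. 4 / 3 * ln (576 * (real n)\<^sup>2) / ln (real n)) \<longlonglongrightarrow> 8 / 3" by real_asymp
  then have lim': "limsup (\<lambda>n. ereal (4 / 3 * ln (576 * (real n)\<^sup>2) / ln (real n))) = ereal (8 / 3)"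
    by (intro lim_imp_Limsup) auto
  have "limsup ?F \<le> limsup (\<lambda>n. ereal (4 / 3 * ln (576 * (real n)\<^sup>2) / ln (real n)))"
    by (rule Limsup_mono[OF eventually_mono[OF eventually_ge_at_top[of 4] up]])
  moreover have "limsup (\<lambda>n. ereal (4 / 3 * ln (576 * (real n)\<^sup>2) / ln (real n))) \<le> ereal (2 * sqrt 2)"
  proof -
    \<comment> \<open>The exponent 2 of \<open>n\<close> per window of length 3/4 gives 8/3, and
      \<open>(4/3)\<^sup>2 = 16/9\<close> is below 2.\<close>
    have "4 / 3 \<le> sqrt 2" by (intro real_le_rsqrt) (simp add: power2_eq_square)
    then show ?thesis unfolding lim' by simp
  qed
  ultimately show "limsup ?F \<le> ereal (2 * sqrt 2)" by (rule order_trans)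
qed

end
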